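(* Let $n\ge2$ and let $(S_1,\dots,S_{n-1},P)$ be a c.n.u. $\Gamma_n$-contraction on a Hilbert space $\mathcal H$ with $S_i^*P=PS_i^*$ for all $i=1,\dots,n-1$. Let $(A_1,\dots,A_{n-1})$ and $(B_1,\dots,B_{n-1})$ be the $\mathcal F_O$-tuples of $(S_1,\dots,S_{n-1},P)$ and $(S_1^*,\dots,S_{n-1}^*,P^* )$ respectively. Let $W=(W_1,W_2):\mathcal H\to(H^2(\mathbb D)\otimes\mathcal D_P)\oplus(L^2(\mathbb T)\otimes\mathcal D_{P^*})$ be the isometry defined in the context and let $\mathcal L=\mathrm{Ran}(W)$. Then, for $i=1,\dots,n-1$, $$S_i\cong\big((I\otimes A_i+M_z^*\otimes A_{n-i}^* )\oplus(I\otimes B_i^*+M_{e^{it}}^*\otimes PP^*B_{n-i})\big)\big|_{\mathcal L}$$ and $$P\cong\big((M_z^*\otimes I_{\mathcal D_P})\oplus(M_{e^{it}}^*\otimes I_{\mathcal D_{P^*}})\big)\big|_{\mathcal L},$$ where $\cong$ denotes unitary equivalence, implemented for all of these operators by the unitary $W:\mathcal H\to\mathcal L$.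
   Context: All operators are bounded and act on complex Hilbert spaces. $\mathbb D$ is the open unit disc, $\mathbb T$ the unit circle. $\Gamma_n=\{(\sum_i z_i,\sum_{i<j}z_iz_j,\dots,\prod_i z_i):|z_i|\le1,\ 1\le i\le n\}\subset\mathbb C^n$. A commuting tuple $(S_1,\dots,S_{n-1},P)$ is a $\Gamma_n$-contraction if $\Gamma_n$ is a spectral set for it: its Taylor joint spectrum lies in $\Gamma_n$ and $\|r(S_1,\dots,S_{n-1},P)\|\le\sup_{\Gamma_n}|r|$ for all rational functions $r$ with poles off $\Gamma_n$. A contraction is c.n.u. (completely non-unitary) if it has no nonzero reducing subspace on which it is unitary; a $\Gamma_n$-contraction is c.n.u. if the contraction $P$ is c.n.u. For a contraction $P$, $D_P=(I-P^*P)^{1/2}$, $\mathcal D_P=\overline{\mathrm{Ran}}\,D_P$. For every $\Gamma_n$-contraction there are unique $A_1,\dots,A_{n-1}\in\mathcal B(\mathcal D_P)$ with $S_i-S_{n-i}^*P=D_PA_iD_P$ ($1\le i\le n-1$); $(A_1,\dots,A_{n-1})$ is its $\mathcal F_O$-tuple. The adjoint tuple is also a $\Gamma_n$-contraction, so its $\mathcal F_O$-tuple consists of operators on $\mathcal D_{P^*}$. $M_z$ is multiplication by $z$ on $H^2(\mathbb D)$ and $M_{e^{it}}$ is multiplication by $e^{it}$ on $L^2(\mathbb T)$. Definition of $W$: let $\mathcal A$ and $\mathcal A_*$ be the strong limits of $P^{*k}P^k$ and $P^kP^{*k}$ as $k\to\infty$. Let $V:\overline{\mathrm{Ran}}(\mathcal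 A)\to\overline{\mathrm{Ran}}(\mathcal A)$ be the isometry determined by $V\mathcal A^{1/2}x=\mathcal A^{1/2}Px$. Let $Q=(I-\mathcal A^{1/2}\mathcal A_*\mathcal A^{1/2})^{1/2}$ on $\overline{\mathrm{Ran}}(\mathcal A)$; $Q$ commutes with $V$ and $V^*$, and when $P$ is c.n.u., $\ker Q=\{0\}$ and $\mathcal H_0=\{x\in\mathcal H:\mathcal A^{1/2}x\in\mathrm{Ran}(Q)\}$ is a dense linear subspace of $\mathcal H$. Define $$W_1h=\sum_{k=0}^\infty z^k\otimes D_PP^kh\in H^2(\mathbb D)\otimes\mathcal D_P,\qquad h\in\mathcal H,$$ $$W_2x=\sum_{k=-\infty}^{-1}z^k\otimes D_{P^*}\mathcal A^{1/2}Q^{-1}V^{*(-k)}\mathcal A^{1/2}x+\sum_{k=0}^\infty z^k\otimes D_{P^*}\mathcal A^{1/2}Q^{-1}V^k\mathcal A^{1/2}x\in L^2(\mathbb T)\otimes\mathcal D_{P^*},\qquad x\in\mathcal H_0,$$ where $z=e^{it}$ in the second formula and $Q^{-1}$ is defined on $\mathrm{Ran}(Q)$. It is known (Durszt) that $x\mapsto W_1x\oplus W_2x$ on $\mathcal H_0$ extends to an isometry $W$ on $\mathcal H$ with $WP=\big((M_z^*\otimes I_{\mathcal D_P})\oplus(M_{e^{it}}^*\otimes I_{\mathcal D_{P^*}})\big)W$. *)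

theory Defs
  imports "HOL-Complex_Analysis.Complex_Analysis" "HOL-Library.Poly_Mapping"
begin

text \<open>The complex inner product is linear in its first argument. Its real part is the inner product
  of the library class, so that norm, topology and completeness are the ones of the library.\<close>

class complex_inner = real_inner +
  fixes scaleC :: "complex \<Rightarrow> 'a \<Rightarrow> 'a" (infixr "*\<^sub>C" 75)
    and cinner :: "'a \<Rightarrow> 'a \<Rightarrow> complex"
  assumes scaleC_add_right: "c *\<^sub>C (x + y) = c *\<^sub>C x + c *\<^sub>C y"
    and scaleC_add_left: "(c + d) *\<^sub>C x = c *\<^sub>C x + d *\<^sub>C x"
    and scaleC_scaleC: "c *\<^sub>C d *\<^sub>C x = (c * d) *\<^sub>C x"
    and scaleC_of_real: "complex_of_real r *\<^sub>C x = r *\<^sub>R x"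
    and cinner_commute: "cinner x y = cnj (cinner y x)"
    and cinner_add_left: "cinner (x + y) z = cinner x z + cinner y z"
    and cinner_scaleC_left: "cinner (c *\<^sub>C x) y = c * cinner x y"
    and Re_cinner: "Re (cinner x y) = inner x y"

class chilbert_space = complex_inner + complete_space

global_interpretation complex_vector:
  vector_space "scaleC :: complex \<Rightarrow> 'a::complex_inner \<Rightarrow> 'a"
proof
  show "1 *\<^sub>C x = x" for x :: 'a
    using scaleC_of_real[of 1 x] by simp
qed (simp_all add: scaleC_add_right scaleC_add_left scaleC_scaleC)

instantiation prod :: (complex_inner, complex_inner) complex_inner
begin

definition scaleC_prod :: "complex \<Rightarrow> 'a \<times> 'b \<Rightarrow> 'a \<times> 'b" where
  "scaleC_prod c u = (c *\<^sub>C fst u, c *\<^sub>C snd u)"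

definition cinner_prod :: "'a \<times> 'b \<Rightarrow> 'a \<times> 'b \<Rightarrow> complex" where
  "cinner_prod u v = cinner (fst u) (fst v) + cinner (snd u) (snd v)"

instance
proof
  show "cinner u v = cnj (cinner v u)" for u v :: "'a \<times> 'b"
    using cinner_commute[of "fst u" "fst v"] cinner_commute[of "snd u" "snd v"]
    by (simp add: cinner_prod_def)
qed (simp_all add: scaleC_prod_def cinner_prod_def scaleC_add_right scaleC_add_left scaleC_scaleC
      scaleC_of_real scaleR_prod_def cinner_add_left cinner_scaleC_left Re_cinner inner_prod_def
      distrib_left)

end

instance prod :: (chilbert_space, chilbert_space) chilbert_space ..

text \<open>Operators on a closed subspace \<open>E\<close> are functions on the ambient type of which only the values
  on \<open>E\<close> matter.\<close>

definition bounded_clinear_on ::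
  "'a::complex_inner set \<Rightarrow> 'b::complex_inner set \<Rightarrow> ('a \<Rightarrow> 'b) \<Rightarrow> bool" where
  "bounded_clinear_on E F T \<longleftrightarrow>
     (\<forall>x\<in>E. T x \<in> F) \<and>
     (\<forall>x\<in>E. \<forall>y\<in>E. T (x + y) = T x + T y) \<and>
     (\<forall>c. \<forall>x\<in>E. T (c *\<^sub>C x) = c *\<^sub>C T x) \<and>
     (\<exists>K. \<forall>x\<in>E. norm (T x) \<le> K * norm x)"

abbreviation bounded_clinear :: "('a::complex_inner \<Rightarrow> 'b::complex_inner) \<Rightarrow> bool" where
  "bounded_clinear \<equiv> bounded_clinear_on UNIV UNIV"

text \<open>The space is given by a carrier \<open>X\<close> and an inner product \<open>ip\<close>, which may be degenerate:
  below, elements of function spaces are represented by functions, and the adjoint is then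
  determined up to functions of norm zero.\<close>

definition adjoint_wrt :: "'f set \<Rightarrow> ('f \<Rightarrow> 'f \<Rightarrow> complex) \<Rightarrow> ('f \<Rightarrow> 'f) \<Rightarrow> 'f \<Rightarrow> 'f" where
  "adjoint_wrt X ip T =
     (SOME T'. (\<forall>x\<in>X. T' x \<in> X) \<and> (\<forall>x\<in>X. \<forall>y\<in>X. ip (T x) y = ip x (T' y)))"

definition cadjoint_on :: "'a::complex_inner set \<Rightarrow> ('a \<Rightarrow> 'a) \<Rightarrow> 'a \<Rightarrow> 'a" where
  "cadjoint_on E = adjoint_wrt E cinner"

abbreviation cadjoint :: "('a::complex_inner \<Rightarrow> 'a) \<Rightarrow> 'a \<Rightarrow> 'a" where
  "cadjoint \<equiv> cadjoint_on UNIV"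

definition psqrt_on :: "'a::complex_inner set \<Rightarrow> ('a \<Rightarrow> 'a) \<Rightarrow> 'a \<Rightarrow> 'a" where
  "psqrt_on E T =
     (SOME R. bounded_clinear_on E E R \<and> (\<forall>x\<in>E. cinner (R x) x \<in> \<real>\<^sub>\<ge>\<^sub>0) \<and>
        (\<forall>x\<in>E. R (R x) = T x))"

abbreviation psqrt :: "('a::complex_inner \<Rightarrow> 'a) \<Rightarrow> 'a \<Rightarrow> 'a" where
  "psqrt \<equiv> psqrt_on UNIV"

definition unitary_on :: "'a::complex_inner set \<Rightarrow> ('a \<Rightarrow> 'a) \<Rightarrow> bool" where
  "unitary_on M T \<longleftrightarrow> (\<forall>x\<in>M. norm (T x) = norm x) \<and> T ` M = M"

definition reducing :: "('a::complex_inner \<Rightarrow> 'a) \<Rightarrow> 'a set \<Rightarrow> bool" where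
  "reducing T M \<longleftrightarrow> closed M \<and> complex_vector.subspace M \<and> T ` M \<subseteq> M \<and> cadjoint T ` M \<subseteq> M"

definition cnu :: "('a::complex_inner \<Rightarrow> 'a) \<Rightarrow> bool" where
  "cnu T \<longleftrightarrow> (\<forall>M. reducing T M \<and> unitary_on M T \<longrightarrow> M = {0})"

text \<open>The operator \<open>T\<close> is unitarily equivalent to the restriction of \<open>R\<close> to the invariant subspace
  \<open>L\<close>, by means of the unitary \<open>U\<close> onto \<open>L\<close>.\<close>

definition unitarily_equivalent_via ::
  "('a::complex_inner \<Rightarrow> 'b::complex_inner) \<Rightarrow> ('a \<Rightarrow> 'a) \<Rightarrow> ('b \<Rightarrow> 'b) \<Rightarrow> 'b set \<Rightarrow> bool" where
  "unitarily_equivalent_via U T R L \<longleftrightarrow>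
     bounded_clinear U \<and> (\<forall>x. norm (U x) = norm x) \<and> range U = L \<and>
     R ` L \<subseteq> L \<and> (\<forall>x. U (T x) = R (U x))"


text \<open>Points of complex \<open>n\<close>-space and \<open>n\<close>-tuples of operators are indexed by \<open>{1..n}\<close>.\<close>

definition Gamma :: "nat \<Rightarrow> (nat \<Rightarrow> complex) set" where
  "Gamma n =
     {(\<lambda>i\<in>{1..n}. \<Sum>J | J \<subseteq> {1..n} \<and> card J = i. \<Prod>j\<in>J. z j) | z. \<forall>i\<in>{1..n}. cmod (z i) \<le> 1}"

text \<open>Koszul complex of \<open>T\<close>: the element \<open>\<Sum>J. \<xi> J \<otimes> e\<^sub>J\<close> of the tensor product of the Hilbert
  space with the exterior algebra on \<open>e\<^sub>1, \<dots>, e\<^sub>n\<close> is represented by the function \<open>\<xi>\<close>, and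
  the coboundary is \<open>\<Sum>j. T j \<otimes> (e\<^sub>j \<and> _)\<close>.\<close>

definition koszul_space :: "nat \<Rightarrow> (nat set \<Rightarrow> 'a::complex_inner) set" where
  "koszul_space n = {\<xi>. \<forall>J. \<not> J \<subseteq> {1..n} \<longrightarrow> \<xi> J = 0}"

definition koszul_map ::
  "nat \<Rightarrow> (nat \<Rightarrow> 'a::complex_inner \<Rightarrow> 'a) \<Rightarrow> (nat set \<Rightarrow> 'a) \<Rightarrow> nat set \<Rightarrow> 'a" where
  "koszul_map n T \<xi> J =
     (if J \<subseteq> {1..n} then \<Sum>j\<in>J. (-1) ^ card {i\<in>J. i < j} *\<^sub>R T j (\<xi> (J - {j})) else 0)"

definition taylor_spectrum ::
  "nat \<Rightarrow> (nat \<Rightarrow> 'a::complex_inner \<Rightarrow> 'a) \<Rightarrow> (nat \<Rightarrow> complex) set" where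
  "taylor_spectrum n T =
     {w \<in> extensional {1..n}.
        let \<delta> = koszul_map n (\<lambda>i x. T i x - w i *\<^sub>C x)
        in {\<xi> \<in> koszul_space n. \<forall>J. \<delta> \<xi> J = 0} \<noteq> \<delta> ` koszul_space n}"

type_synonym cmpoly = "(nat \<Rightarrow>\<^sub>0 nat) \<Rightarrow>\<^sub>0 complex"

definition mpoly_eval :: "nat \<Rightarrow> cmpoly \<Rightarrow> (nat \<Rightarrow> complex) \<Rightarrow> complex" where
  "mpoly_eval n p z =
     (\<Sum>m\<in>Poly_Mapping.keys p. Poly_Mapping.lookup p m *
        (\<Prod>i\<in>{1..n}. z i ^ Poly_Mapping.lookup m i))"

definition mpoly_op ::
  "nat \<Rightarrow> cmpoly \<Rightarrow> (nat \<Rightarrow> 'a::complex_inner \<Rightarrow> 'a) \<Rightarrow> 'a \<Rightarrow> 'a" where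
  "mpoly_op n p T x =
     (\<Sum>m\<in>Poly_Mapping.keys p. Poly_Mapping.lookup p m *\<^sub>C
        foldr (\<lambda>i R. (T i ^^ Poly_Mapping.lookup m i) \<circ> R) [1..<Suc n] id x)"

text \<open>Rational functions with poles off \<open>K\<close> are the quotients \<open>p / q\<close> of polynomials such that \<open>q\<close>
  has no zero in \<open>K\<close>. If \<open>K\<close> contains the Taylor spectrum of \<open>T\<close> then \<open>q(T)\<close> is invertible, by the
  spectral mapping theorem, so that \<open>inv\<close> is the inverse operator.\<close>

definition spectral_set ::
  "nat \<Rightarrow> (nat \<Rightarrow> complex) set \<Rightarrow> (nat \<Rightarrow> 'a::complex_inner \<Rightarrow> 'a) \<Rightarrow> bool" where
  "spectral_set n K T \<longleftrightarrow>
     taylor_spectrum n T \<subseteq> K \<and>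
     (\<forall>p q. (\<forall>z\<in>K. mpoly_eval n q z \<noteq> 0) \<longrightarrow>
        onorm (mpoly_op n p T \<circ> inv (mpoly_op n q T))
          \<le> (SUP z\<in>K. cmod (mpoly_eval n p z / mpoly_eval n q z)))"

definition Gamma_contraction ::
  "nat \<Rightarrow> (nat \<Rightarrow> 'a::complex_inner \<Rightarrow> 'a) \<Rightarrow> ('a \<Rightarrow> 'a) \<Rightarrow> bool" where
  "Gamma_contraction n S P \<longleftrightarrow>
     (let T = S(n := P)
      in (\<forall>i\<in>{1..n}. bounded_clinear (T i)) \<and>
         (\<forall>i\<in>{1..n}. \<forall>j\<in>{1..n}. T i \<circ> T j = T j \<circ> T i) \<and>
         spectral_set n (Gamma n) T)"


definition defect_op :: "('a::complex_inner \<Rightarrow> 'a) \<Rightarrow> 'a \<Rightarrow> 'a" where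
  "defect_op P = psqrt (\<lambda>x. x - cadjoint P (P x))"

definition defect_space :: "('a::complex_inner \<Rightarrow> 'a) \<Rightarrow> 'a set" where
  "defect_space P = closure (range (defect_op P))"

definition FO_tuple ::
  "nat \<Rightarrow> (nat \<Rightarrow> 'a::complex_inner \<Rightarrow> 'a) \<Rightarrow> ('a \<Rightarrow> 'a) \<Rightarrow> (nat \<Rightarrow> 'a \<Rightarrow> 'a) \<Rightarrow> bool" where
  "FO_tuple n S P A \<longleftrightarrow>
     (\<forall>i\<in>{1..n - 1}.
        bounded_clinear_on (defect_space P) (defect_space P) (A i) \<and>
        (\<forall>x. S i x - cadjoint (S (n - i)) (P x) = defect_op P (A i (defect_op P x))))"


definition taylor_coeff :: "(complex \<Rightarrow> complex) \<Rightarrow> nat \<Rightarrow> complex" where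
  "taylor_coeff f k = (deriv ^^ k) f 0 / fact k"

text \<open>Only the values on the open unit disc matter.\<close>

definition hardy2 :: "(complex \<Rightarrow> complex) set" where
  "hardy2 = {f. f holomorphic_on ball 0 1 \<and> summable (\<lambda>k. (cmod (taylor_coeff f k))\<^sup>2)}"

definition hardy2_inner :: "(complex \<Rightarrow> complex) \<Rightarrow> (complex \<Rightarrow> complex) \<Rightarrow> complex" where
  "hardy2_inner f g = suminf (\<lambda>k. taylor_coeff f k * cnj (taylor_coeff g k))"

text \<open>Normalized arc length on the unit circle.\<close>

definition circle_measure :: "complex measure" where
  "circle_measure = distr (uniform_measure lborel {0..2 * pi}) borel cis"

definition circle_L2 :: "(complex \<Rightarrow> complex) set" where
  "circle_L2 =
     {f \<in> borel_measurable borel. integrable circle_measure (\<lambda>z. (cmod (f z))\<^sup>2)}"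

definition circle_L2_inner :: "(complex \<Rightarrow> complex) \<Rightarrow> (complex \<Rightarrow> complex) \<Rightarrow> complex" where
  "circle_L2_inner f g = (\<integral>z. f z * cnj (g z) \<partial>circle_measure)"

definition mult_z :: "(complex \<Rightarrow> complex) \<Rightarrow> complex \<Rightarrow> complex" where
  "mult_z f = (\<lambda>z. z * f z)"

text \<open>The Hilbert space tensor product of a function space \<open>F\<close>, with inner product \<open>ip\<close>, and a closed
  subspace \<open>E\<close> is any Hilbert space that is densely spanned by vectors \<open>f \<otimes> v\<close> with the inner
  products required below. It is realized as a closed subspace of a Hilbert space type, \<open>tns f v\<close> is
  the vector \<open>f \<otimes> v\<close>. Bilinearity of \<open>tns\<close>, and independence of the function that represents
  an element of \<open>F\<close>, follow from the formula for the inner products.\<close>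

definition hilbert_tensor ::
  "'f set \<Rightarrow> ('f \<Rightarrow> 'f \<Rightarrow> complex) \<Rightarrow> 'a::complex_inner set \<Rightarrow>
   ('f \<Rightarrow> 'a \<Rightarrow> 't::chilbert_space) \<Rightarrow> bool" where
  "hilbert_tensor F ip E tns \<longleftrightarrow>
     (\<forall>f\<in>F. \<forall>g\<in>F. \<forall>v\<in>E. \<forall>w\<in>E. cinner (tns f v) (tns g w) = ip f g * cinner v w)"

definition tensor_space ::
  "'f set \<Rightarrow> 'a::complex_inner set \<Rightarrow> ('f \<Rightarrow> 'a \<Rightarrow> 't::chilbert_space) \<Rightarrow> 't set" where
  "tensor_space F E tns = closure (complex_vector.span {tns f v | f v. f \<in> F \<and> v \<in> E})"

definition tensor_op ::
  "'f set \<Rightarrow> 'a::complex_inner set \<Rightarrow> ('f \<Rightarrow> 'a \<Rightarrow> 't::chilbert_space) \<Rightarrow>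
   ('f \<Rightarrow> 'f) \<Rightarrow> ('a \<Rightarrow> 'a) \<Rightarrow> 't \<Rightarrow> 't" where
  "tensor_op F E tns M A =
     (SOME R. bounded_clinear_on (tensor_space F E tns) (tensor_space F E tns) R \<and>
        (\<forall>f\<in>F. \<forall>v\<in>E. R (tns f v) = tns (M f) (A v)))"


text \<open>For a contraction \<open>P\<close>, the operators \<open>\<A>\<close> and \<open>\<A>\<^sub>*\<close> are \<open>asymptotic_op P\<close> and
  \<open>asymptotic_op (cadjoint P)\<close>.\<close>

definition asymptotic_op :: "('a::complex_inner \<Rightarrow> 'a) \<Rightarrow> 'a \<Rightarrow> 'a" where
  "asymptotic_op P x = lim (\<lambda>k. (cadjoint P ^^ k) ((P ^^ k) x))"

abbreviation asymptotic_sqrt :: "('a::complex_inner \<Rightarrow> 'a) \<Rightarrow> 'a \<Rightarrow> 'a" where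
  "asymptotic_sqrt P \<equiv> psqrt (asymptotic_op P)"

definition asymptotic_space :: "('a::complex_inner \<Rightarrow> 'a) \<Rightarrow> 'a set" where
  "asymptotic_space P = closure (range (asymptotic_op P))"

definition durszt_V :: "('a::complex_inner \<Rightarrow> 'a) \<Rightarrow> 'a \<Rightarrow> 'a" where
  "durszt_V P =
     (SOME V. bounded_clinear_on (asymptotic_space P) (asymptotic_space P) V \<and>
        (\<forall>x. V (asymptotic_sqrt P x) = asymptotic_sqrt P (P x)))"

abbreviation durszt_V_adj :: "('a::complex_inner \<Rightarrow> 'a) \<Rightarrow> 'a \<Rightarrow> 'a" where
  "durszt_V_adj P \<equiv> cadjoint_on (asymptotic_space P) (durszt_V P)"

definition durszt_Q :: "('a::complex_inner \<Rightarrow> 'a) \<Rightarrow> 'a \<Rightarrow> 'a" where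
  "durszt_Q P = psqrt_on (asymptotic_space P)
     (\<lambda>x. x - asymptotic_sqrt P (asymptotic_op (cadjoint P) (asymptotic_sqrt P x)))"

abbreviation durszt_Q_inv :: "('a::complex_inner \<Rightarrow> 'a) \<Rightarrow> 'a \<Rightarrow> 'a" where
  "durszt_Q_inv P \<equiv> inv_into (asymptotic_space P) (durszt_Q P)"

definition durszt_dom :: "('a::complex_inner \<Rightarrow> 'a) \<Rightarrow> 'a set" where
  "durszt_dom P = {x. asymptotic_sqrt P x \<in> durszt_Q P ` asymptotic_space P}"

definition durszt_W1 ::
  "('a::complex_inner \<Rightarrow> 'a) \<Rightarrow> ((complex \<Rightarrow> complex) \<Rightarrow> 'a \<Rightarrow> 't::chilbert_space) \<Rightarrow> 'a \<Rightarrow> 't" where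
  "durszt_W1 P tns h = (\<Sum>\<^sub>\<infinity>k\<in>UNIV. tns (\<lambda>z. z ^ k) (defect_op P ((P ^^ k) h)))"

definition durszt_W2 ::
  "('a::complex_inner \<Rightarrow> 'a) \<Rightarrow> ((complex \<Rightarrow> complex) \<Rightarrow> 'a \<Rightarrow> 't::chilbert_space) \<Rightarrow> 'a \<Rightarrow> 't" where
  "durszt_W2 P tns x =
     (\<Sum>\<^sub>\<infinity>k\<in>{..-1::int}. tns (\<lambda>z. z powi k)
        (defect_op (cadjoint P) (asymptotic_sqrt P (durszt_Q_inv P
           ((durszt_V_adj P ^^ nat (- k)) (asymptotic_sqrt P x)))))) +
     (\<Sum>\<^sub>\<infinity>k\<in>{0::int..}. tns (\<lambda>z. z powi k)
        (defect_op (cadjoint P) (asymptotic_sqrt P (durszt_Q_inv P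
           ((durszt_V P ^^ nat k) (asymptotic_sqrt P x))))))"

definition durszt_W ::
  "('a::complex_inner \<Rightarrow> 'a) \<Rightarrow>
   ((complex \<Rightarrow> complex) \<Rightarrow> 'a \<Rightarrow> 't::chilbert_space) \<Rightarrow>
   ((complex \<Rightarrow> complex) \<Rightarrow> 'a \<Rightarrow> 'u::chilbert_space) \<Rightarrow> 'a \<Rightarrow> 't \<times> 'u" where
  "durszt_W P tns1 tns2 =
     (THE W. bounded_clinear W \<and>
        (\<forall>x\<in>durszt_dom P. W x = (durszt_W1 P tns1 x, durszt_W2 P tns2 x)))"

end

theory Submission
  imports Defs
begin

text \<open>Only two features of a \<open>\<Gamma>\<^sub>n\<close>-contraction matter: the operators commute and \<open>P\<close> is a contraction.
  Since every \<open>S\<^sub>i\<close> commutes with \<open>P\<close> and \<open>P\<^sup>*\<close>, it commutes with everything from which \<open>W\<close> is built.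

  The first component of the claim reduces to \<open>D\<^sub>P S\<^sub>i = A\<^sub>i D\<^sub>P + A\<^sub>n\<^sub>-\<^sub>i\<^sup>* D\<^sub>P P\<close>, which is verified after
  multiplication by the operator \<open>D\<^sub>P\<close>, injective on its defect space. The coefficients of \<open>W\<^sub>2 x\<close> are
  \<open>D\<^sub>P\<^sub>* y\<^sub>k\<close> with \<open>P\<^sup>* y\<^sub>k\<^sub>+\<^sub>1 = y\<^sub>k\<close>. Hence the sum of the squares of their norms
  telescopes to \<open>\<parallel>\<A>\<^sup>1\<^sup>/\<^sup>2 x\<parallel>\<^sup>2\<close>, which makes \<open>W\<close> isometric, and the second component of the claim
  reduces to \<open>D\<^sub>P\<^sub>* S\<^sub>i P\<^sup>* y = B\<^sub>i\<^sup>* D\<^sub>P\<^sub>* P\<^sup>* y + P P\<^sup>* B\<^sub>n\<^sub>-\<^sub>i D\<^sub>P\<^sub>* y\<close>.\<close>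

section \<open>Bounded operators on closed subspaces\<close>

text \<open>The adjoints, the square roots, \<open>V\<close>, \<open>W\<close> and the operators on
  tensor products are all introduced by description operators. Nothing can be said about them before
  existence, and for \<open>W\<close> also uniqueness, is established. This is why Durszt's theorem
  is derived from Riesz representation upwards, and why operators known only on a dense subspace are
  constructed through closures of graphs. An adjoint on a function space is unique only up to
  functions of norm zero, so it is handled through inner products.

  Complete non-unitarity enters in one place: the common fixed vectors of \<open>\<A>\<close> and
  \<open>\<A>\<^sub>*\<close> form a reducing subspace on which \<open>P\<close> is unitary. Their
  absence makes \<open>Q\<close> injective and the domain of \<open>W\<^sub>2\<close> dense.

  The last identity of the overview is confined to vectors \<open>P\<^sup>* y\<close> because this
  adjoint can be moved to the left of the inserted term
  \<open>P S\<^sub>n\<^sub>-\<^sub>i\<^sup>* P\<^sup>* y\<close>. The factor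
  \<open>P P\<^sup>*\<close> that arises there commutes with the defect operator and is the origin
  of the coefficient \<open>P P\<^sup>* B\<^sub>n\<^sub>-\<^sub>i\<close>.\<close>

lemma cinner_add_right: "cinner x (y + z) = cinner x y + cinner x z"
  by (metis cinner_add_left cinner_commute complex_cnj_add)

lemma cinner_scaleC_right: "cinner x (c *\<^sub>C y) = cnj c * cinner x y"
  by (metis cinner_commute cinner_scaleC_left complex_cnj_mult)

lemma cinner_self: "cinner x x = complex_of_real ((norm x)\<^sup>2)"
proof (rule complex_eqI)
  show "Re (cinner x x) = Re (complex_of_real ((norm x)\<^sup>2))"
    by (simp add: Re_cinner power2_norm_eq_inner)
  have "Im (cinner x x) = - Im (cinner x x)"
    using cinner_commute[of x x] by (metis complex_cnj complex.sel(2) complex.collapse)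
  then show "Im (cinner x x) = Im (complex_of_real ((norm x)\<^sup>2))"
    by simp
qed

lemma norm_scaleC: "norm (c *\<^sub>C x) = cmod c * norm x"
proof -
  have "c * cnj c = (complex_of_real (cmod c))\<^sup>2"
    using complex_norm_square[of c] by simp
  then have "complex_of_real ((norm (c *\<^sub>C x))\<^sup>2) = complex_of_real ((cmod c * norm x)\<^sup>2)"
    unfolding cinner_self[symmetric] cinner_scaleC_left cinner_scaleC_right
    by (simp add: cinner_self power_mult_distrib mult_ac)
  then show ?thesis
    by (metis mult_nonneg_nonneg norm_ge_zero of_real_eq_iff power2_eq_imp_eq)
qed

lemma norm_cinner_le: "cmod (cinner x y) \<le> norm x * norm y"
proof -
  \<comment> \<open>A unimodular phase that rotates the inner product onto the nonnegative real
    axis, where the real Cauchy-Schwarz inequality applies.\<close>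
  define c where "c = (if cinner x y = 0 then 1 else cnj (cinner x y) / cmod (cinner x y))"
  have "cnj (cinner x y) * cinner x y = complex_of_real (cmod (cinner x y)) * cmod (cinner x y)"
    using complex_norm_square[of "cinner x y"] by (simp add: power2_eq_square mult.commute)
  then have c: "cmod c = 1" "c * cinner x y = cmod (cinner x y)"
    by (auto simp: c_def norm_divide)
  have "cmod (cinner x y) = inner (c *\<^sub>C x) y"
    using c by (metis Re_cinner Re_complex_of_real cinner_scaleC_left)
  also have "\<dots> \<le> norm (c *\<^sub>C x) * norm y"
    by (rule norm_cauchy_schwarz)
  finally show ?thesis
    using c by (simp add: norm_scaleC)
qed

lemma bounded_bilinear_cinner: "bounded_bilinear (cinner :: 'a::complex_inner \<Rightarrow> 'a \<Rightarrow> complex)"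
proof
  show "\<exists>K. \<forall>a b. cmod (cinner a (b::'a)) \<le> norm a * norm b * K"
    by (intro exI[of _ 1]) (simp add: norm_cinner_le)
qed (simp_all add: cinner_add_left cinner_add_right cinner_scaleC_left cinner_scaleC_right
      scaleR_conv_of_real flip: scaleC_of_real)

lemma bounded_bilinear_scaleC: "bounded_bilinear (scaleC :: complex \<Rightarrow> 'a::complex_inner \<Rightarrow> 'a)"
proof
  show "\<exists>K. \<forall>a (b::'a). norm (a *\<^sub>C b) \<le> norm a * norm b * K"
    by (intro exI[of _ 1]) (simp add: norm_scaleC)
qed (simp_all add: scaleC_add_left scaleC_add_right scaleC_scaleC mult.commute
      scaleR_conv_of_real flip: scaleC_of_real)

global_interpretation cinner: bounded_bilinear "cinner :: 'a::complex_inner \<Rightarrow> 'a \<Rightarrow> complex"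
  by (rule bounded_bilinear_cinner)

global_interpretation scaleC: bounded_bilinear "scaleC :: complex \<Rightarrow> 'a::complex_inner \<Rightarrow> 'a"
  by (rule bounded_bilinear_scaleC)

declare cinner.zero_left [simp] cinner.zero_right [simp]

instance chilbert_space \<subseteq> banach ..

lemma cinner_eq_zero_iff [simp]: "cinner x x = 0 \<longleftrightarrow> x = 0"
  by (simp add: cinner_self)

lemma Re_cinner_self: "Re (cinner x x) = (norm x)\<^sup>2"
  by (simp add: cinner_self)

lemma norm_diff_sq: "(norm (x - y))\<^sup>2 = (norm x)\<^sup>2 - 2 * Re (cinner x y) + (norm y)\<^sup>2"
  for x y :: "'a::complex_inner"
  by (simp add: Re_cinner power2_norm_eq_inner inner_diff_left inner_diff_right inner_commute)

definition closed_csubspace :: "'a::complex_inner set \<Rightarrow> bool" where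
  "closed_csubspace E \<longleftrightarrow> closed E \<and> complex_vector.subspace E"

lemma csubspace_scaleR: "complex_vector.subspace E \<Longrightarrow> x \<in> E \<Longrightarrow> r *\<^sub>R x \<in> E"
  by (metis complex_vector.subspace_scale scaleC_of_real)

lemma closed_csubspaceD:
  assumes "closed_csubspace E"
  shows "complex_vector.subspace E" "closed E" "0 \<in> E"
    "x \<in> E \<Longrightarrow> y \<in> E \<Longrightarrow> x + y \<in> E" "x \<in> E \<Longrightarrow> y \<in> E \<Longrightarrow> x - y \<in> E"
    "x \<in> E \<Longrightarrow> c *\<^sub>C x \<in> E" "x \<in> E \<Longrightarrow> r *\<^sub>R x \<in> E"
  using assms
  by (auto simp: closed_csubspace_def csubspace_scaleR complex_vector.subspace_0
      complex_vector.subspace_add complex_vector.subspace_diff complex_vector.subspace_scale)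

lemma closed_csubspace_UNIV [simp]: "closed_csubspace UNIV"
  by (simp add: closed_csubspace_def)

lemma csubspace_closure:
  assumes "complex_vector.subspace D"
  shows "complex_vector.subspace (closure D)"
proof (rule complex_vector.subspaceI)
  show "0 \<in> closure D"
    using assms complex_vector.subspace_0 closure_subset by blast
next
  fix x y assume "x \<in> closure D" "y \<in> closure D"
  then obtain f g where fg: "\<And>n::nat. f n \<in> D" "f \<longlonglongrightarrow> x" "\<And>n::nat. g n \<in> D" "g \<longlonglongrightarrow> y"
    by (metis closure_sequential)
  have "(\<lambda>n. f n + g n) \<longlonglongrightarrow> x + y"
    by (intro tendsto_intros fg)
  moreover have "\<forall>n. f n + g n \<in> D"
    using fg assms complex_vector.subspace_add by blast
  ultimately show "x + y \<in> closure D"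
    unfolding closure_sequential by (intro exI[of _ "\<lambda>n. f n + g n"]) simp
next
  fix c x assume "x \<in> closure D"
  then obtain f where f: "\<And>n::nat. f n \<in> D" "f \<longlonglongrightarrow> x"
    by (metis closure_sequential)
  have "(\<lambda>n. c *\<^sub>C f n) \<longlonglongrightarrow> c *\<^sub>C x"
    by (intro tendsto_intros scaleC.tendsto f)
  moreover have "\<forall>n. c *\<^sub>C f n \<in> D"
    using f assms complex_vector.subspace_scale by blast
  ultimately show "c *\<^sub>C x \<in> closure D"
    unfolding closure_sequential by (intro exI[of _ "\<lambda>n. c *\<^sub>C f n"]) simp
qed

lemma closed_csubspace_closure: "complex_vector.subspace D \<Longrightarrow> closed_csubspace (closure D)"
  by (simp add: closed_csubspace_def csubspace_closure)

lemma bounded_clinear_onI: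
  assumes "\<And>x. x \<in> E \<Longrightarrow> T x \<in> F"
    and "\<And>x y. x \<in> E \<Longrightarrow> y \<in> E \<Longrightarrow> T (x + y) = T x + T y"
    and "\<And>c x. x \<in> E \<Longrightarrow> T (c *\<^sub>C x) = c *\<^sub>C T x"
    and "\<And>x. x \<in> E \<Longrightarrow> norm (T x) \<le> K * norm x"
  shows "bounded_clinear_on E F T"
  using assms unfolding bounded_clinear_on_def by blast

lemma bounded_clinear_onD:
  assumes "bounded_clinear_on E F T"
  shows "x \<in> E \<Longrightarrow> T x \<in> F" "x \<in> E \<Longrightarrow> y \<in> E \<Longrightarrow> T (x + y) = T x + T y"
    "x \<in> E \<Longrightarrow> T (c *\<^sub>C x) = c *\<^sub>C T x" "x \<in> E \<Longrightarrow> T (r *\<^sub>R x) = r *\<^sub>R T x"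
  using assms unfolding bounded_clinear_on_def by (auto simp flip: scaleC_of_real)

lemma bounded_clinear_on_bound:
  assumes "bounded_clinear_on E F T"
  obtains K where "K > 0" "\<And>x. x \<in> E \<Longrightarrow> norm (T x) \<le> K * norm x"
proof -
  obtain K where "\<And>x. x \<in> E \<Longrightarrow> norm (T x) \<le> K * norm x"
    using assms unfolding bounded_clinear_on_def by blast
  then have "norm (T x) \<le> max K 1 * norm x" if "x \<in> E" for x
    using that by (meson max.cobounded1 mult_right_mono norm_ge_zero order_trans)
  then show thesis
    using that[of "max K 1"] by simp
qed

lemma bounded_clinear_on_diff:
  assumes "bounded_clinear_on E F T" "complex_vector.subspace E" "x \<in> E" "y \<in> E"
  shows "T (x - y) = T x - T y"
proof -
  have "T (x + (-1) *\<^sub>C y) = T x + T ((-1) *\<^sub>C y)"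
    using assms complex_vector.subspace_scale by (intro bounded_clinear_onD(2)[OF assms(1)])
  also have "T ((-1) *\<^sub>C y) = (-1) *\<^sub>C T y"
    using assms by (intro bounded_clinear_onD(3)[OF assms(1)])
  finally show ?thesis
    by simp
qed

lemma bounded_clinear_on_0:
  assumes "bounded_clinear_on E F T" "complex_vector.subspace E"
  shows "T 0 = 0"
  using bounded_clinear_on_diff[OF assms, of 0 0] assms complex_vector.subspace_0 by fastforce

lemma bounded_clinear_on_sum:
  assumes "bounded_clinear_on E F T" "complex_vector.subspace E" "\<And>i. i \<in> I \<Longrightarrow> f i \<in> E"
  shows "T (sum f I) = (\<Sum>i\<in>I. T (f i))"
  using assms(3)
proof (induction I rule: infinite_finite_induct)
  case (insert i I)
  then show ?case
    using assms complex_vector.subspace_sum[of E I f] by (simp add: bounded_clinear_onD)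
qed (simp_all add: bounded_clinear_on_0[OF assms(1,2)])

lemma bounded_clinear_on_tendsto:
  assumes T: "bounded_clinear_on E F T" and E: "complex_vector.subspace E"
    and f: "\<forall>\<^sub>F n in G. f n \<in> E" and x: "x \<in> E" and lim: "(f \<longlongrightarrow> x) G"
  shows "((\<lambda>n. T (f n)) \<longlongrightarrow> T x) G"
proof -
  obtain K where K: "K > 0" "\<And>x. x \<in> E \<Longrightarrow> norm (T x) \<le> K * norm x"
    using bounded_clinear_on_bound[OF T] by blast
  have "((\<lambda>n. K * norm (f n - x)) \<longlongrightarrow> K * 0) G"
    by (intro tendsto_intros tendsto_norm_zero LIM_zero lim)
  then have "((\<lambda>n. T (f n) - T x) \<longlongrightarrow> 0) G"
  proof (rule Lim_null_comparison[rotated, OF tendsto_eq_rhs])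
    show "\<forall>\<^sub>F n in G. norm (T (f n) - T x) \<le> K * norm (f n - x)"
      using f by eventually_elim
        (metis K(2) T E x bounded_clinear_on_diff complex_vector.subspace_diff)
  qed simp
  then show ?thesis
    by (rule LIM_zero_cancel)
qed

lemma bounded_clinear_imp_bounded_linear:
  assumes "bounded_clinear T"
  shows "bounded_linear T"
proof -
  obtain K where "\<And>x. norm (T x) \<le> K * norm x"
    using assms unfolding bounded_clinear_on_def by auto
  then show ?thesis
    using bounded_clinear_onD[OF assms] 
    by (intro bounded_linear_intro[where K = K]) (auto simp: mult.commute)
qed

lemma bounded_clinear_on_compose:
  assumes S: "bounded_clinear_on F G S" and T: "bounded_clinear_on E F T"
  shows "bounded_clinear_on E G (\<lambda>x. S (T x))"
proof -
  obtain K where K: "K > 0" "\<And>x. x \<in> F \<Longrightarrow> norm (S x) \<le> K * norm x"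
    using bounded_clinear_on_bound[OF S] by blast
  obtain L where L: "L > 0" "\<And>x. x \<in> E \<Longrightarrow> norm (T x) \<le> L * norm x"
    using bounded_clinear_on_bound[OF T] by blast
  show ?thesis
  proof (rule bounded_clinear_onI)
    fix x assume x: "x \<in> E"
    have "norm (S (T x)) \<le> K * norm (T x)"
      using K x bounded_clinear_onD(1)[OF T] by blast
    also have "\<dots> \<le> K * (L * norm x)"
      using K L x by (intro mult_left_mono) auto
    finally show "norm (S (T x)) \<le> K * L * norm x"
      by simp
  qed (auto simp: bounded_clinear_onD[OF T] bounded_clinear_onD[OF S])
qed

lemma bounded_clinear_on_add:
  assumes S: "bounded_clinear_on E F S" and T: "bounded_clinear_on E F T"
    and F: "complex_vector.subspace F"
  shows "bounded_clinear_on E F (\<lambda>x. S x + T x)"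
proof -
  obtain K where K: "K > 0" "\<And>x. x \<in> E \<Longrightarrow> norm (S x) \<le> K * norm x"
    using bounded_clinear_on_bound[OF S] by blast
  obtain L where L: "L > 0" "\<And>x. x \<in> E \<Longrightarrow> norm (T x) \<le> L * norm x"
    using bounded_clinear_on_bound[OF T] by blast
  show ?thesis
  proof (rule bounded_clinear_onI)
    fix x assume x: "x \<in> E"
    show "norm (S x + T x) \<le> (K + L) * norm x"
      using K(2)[OF x] L(2)[OF x] by (smt (verit) norm_triangle_ineq distrib_right)
  qed (auto simp: bounded_clinear_onD[OF T] bounded_clinear_onD[OF S] scaleC_add_right
      complex_vector.subspace_add[OF F])
qed

lemma bounded_clinear_on_scaleC:
  assumes T: "bounded_clinear_on E F T" and F: "complex_vector.subspace F"
  shows "bounded_clinear_on E F (\<lambda>x. c *\<^sub>C T x)"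
proof -
  obtain L where L: "L > 0" "\<And>x. x \<in> E \<Longrightarrow> norm (T x) \<le> L * norm x"
    using bounded_clinear_on_bound[OF T] by blast
  show ?thesis
  proof (rule bounded_clinear_onI)
    fix x assume x: "x \<in> E"
    show "norm (c *\<^sub>C T x) \<le> (cmod c * L) * norm x"
      using L(2)[OF x] by (simp add: norm_scaleC mult_left_mono mult.assoc)
  qed (auto simp: bounded_clinear_onD[OF T] scaleC_add_right scaleC_scaleC mult.commute
      complex_vector.subspace_scale[OF F])
qed

lemma bounded_clinear_on_minus:
  assumes S: "bounded_clinear_on E F S" and T: "bounded_clinear_on E F T"
    and F: "complex_vector.subspace F"
  shows "bounded_clinear_on E F (\<lambda>x. S x - T x)"
  using bounded_clinear_on_add[OF S bounded_clinear_on_scaleC[OF T F, of "-1"] F] by simp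

lemma bounded_clinear_on_ident: "E \<subseteq> F \<Longrightarrow> bounded_clinear_on E F (\<lambda>x. x)"
  by (rule bounded_clinear_onI[where K = 1]) auto

lemma bounded_clinear_on_subset:
  assumes "bounded_clinear_on E F T" "E' \<subseteq> E" "\<And>x. x \<in> E' \<Longrightarrow> T x \<in> F'"
  shows "bounded_clinear_on E' F' T"
  using assms unfolding bounded_clinear_on_def by (meson subsetD)

lemma bounded_clinear_on_image_closure:
  assumes T: "bounded_clinear_on UNIV UNIV T" and "\<And>x. x \<in> D \<Longrightarrow> T x \<in> D" and "x \<in> closure D"
  shows "T x \<in> closure D"
proof -
  obtain f where f: "\<And>n::nat. f n \<in> D" "f \<longlonglongrightarrow> x"
    using assms(3) by (metis closure_sequential)
  have "(\<lambda>n. T (f n)) \<longlonglongrightarrow> T x"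
    by (rule bounded_clinear_on_tendsto[OF T]) (use f in auto)
  then show ?thesis
    unfolding closure_sequential using f assms(2) by (intro exI[of _ "\<lambda>n. T (f n)"]) simp
qed

lemma bounded_clinear_on_eq_closure:
  assumes T: "bounded_clinear_on E F T" and S: "bounded_clinear_on E G S"
    and E: "complex_vector.subspace E" and D: "D \<subseteq> E" and eq: "\<And>x. x \<in> D \<Longrightarrow> T x = S x"
    and x: "x \<in> closure D" "x \<in> E"
  shows "T x = S x"
proof -
  obtain f where f: "\<And>n::nat. f n \<in> D" "f \<longlonglongrightarrow> x"
    using x by (metis closure_sequential)
  have "(\<lambda>n. T (f n)) \<longlonglongrightarrow> T x"
    using f x D by (intro bounded_clinear_on_tendsto[OF T E] always_eventually) auto
  moreover have "(\<lambda>n. S (f n)) \<longlonglongrightarrow> S x"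
    using f x D by (intro bounded_clinear_on_tendsto[OF S E] always_eventually) auto
  ultimately show ?thesis
    using LIMSEQ_unique eq f(1) by auto
qed

lemma csubspace_image:
  assumes T: "bounded_clinear_on E F T" and E: "complex_vector.subspace E"
  shows "complex_vector.subspace (T ` E)"
proof (rule complex_vector.subspaceI)
  show "0 \<in> T ` E"
    using bounded_clinear_on_0[OF T E] complex_vector.subspace_0[OF E] by force
qed (use bounded_clinear_onD(2,3)[OF T] complex_vector.subspace_add[OF E]
    complex_vector.subspace_scale[OF E] in \<open>auto simp: image_iff\<close>, metis+)

text \<open>A linear term dominates a quadratic one near 0. This extracts the first-order condition
  at a minimum, in the Riesz theorem as well as for positive forms.\<close>

lemma quadratic_nonneg_imp_zero:
  fixes a b :: real
  assumes "a \<ge> 0" and "\<And>t. 0 \<le> a * t\<^sup>2 + 2 * b * t"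
  shows "b = 0"
proof -
  \<comment> \<open>Shifting the denominator of the minimizer \<open>- b / a\<close> by 1 avoids a
    case distinction for \<open>a = 0\<close>.\<close>
  have "0 \<le> a * (- b / (a + 1))\<^sup>2 + 2 * b * (- b / (a + 1))"
    by (rule assms)
  also have "\<dots> = - (a + 2) * b\<^sup>2 / (a + 1)\<^sup>2"
    using assms(1) by (simp add: divide_simps power2_eq_square) (simp add: algebra_simps)
  finally have "0 \<le> - (a + 2) * b\<^sup>2"
    using assms(1) by (simp add: zero_le_divide_iff)
  then have "(a + 2) * b\<^sup>2 \<le> 0"
    by (simp add: algebra_simps)
  then have "b\<^sup>2 \<le> 0"
    using assms(1) by (smt (verit) mult_pos_pos)
  then show ?thesis by simp
qed

text \<open>The representing vector minimizes \<open>\<parallel>x\<parallel>\<^sup>2 - 2 Re (\<phi> x)\<close> over \<open>E\<close>.\<close>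

lemma riesz_representation_on:
  fixes E :: "'a::chilbert_space set" and \<phi> :: "'a \<Rightarrow> complex"
  assumes E: "closed_csubspace E"
    and add: "\<And>x y. x \<in> E \<Longrightarrow> y \<in> E \<Longrightarrow> \<phi> (x + y) = \<phi> x + \<phi> y"
    and scale: "\<And>c x. x \<in> E \<Longrightarrow> \<phi> (c *\<^sub>C x) = c * \<phi> x"
    and bound: "\<And>x. x \<in> E \<Longrightarrow> cmod (\<phi> x) \<le> K * norm x"
  obtains y where "y \<in> E" "\<And>x. x \<in> E \<Longrightarrow> \<phi> x = cinner x y"
proof -
  note Es = closed_csubspaceD[OF E]
  define f where "f x = (norm x)\<^sup>2 - 2 * Re (\<phi> x)" for x
  have scaleR: "\<phi> (r *\<^sub>R x) = r * \<phi> x" if "x \<in> E" for r x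
    using scale[OF that, of "complex_of_real r"] by (simp add: scaleC_of_real)
  have lower: "f x \<ge> - K\<^sup>2" if "x \<in> E" for x
  proof -
    have "Re (\<phi> x) \<le> K * norm x"
      using bound[OF that] abs_Re_le_cmod[of "\<phi> x"] by linarith
    moreover have "0 \<le> (norm x - K)\<^sup>2" by simp
    ultimately show ?thesis
      by (simp add: f_def power2_diff mult.commute)
  qed
  define m where "m = Inf (f ` E)"
  have bdd: "bdd_below (f ` E)"
    using lower by (intro bdd_belowI2) auto
  have m_le: "m \<le> f x" if "x \<in> E" for x
    using bdd that by (simp add: m_def cInf_lower)
  have "\<exists>x\<in>E. f x < m + inverse (Suc n)" for n
  proof -
    have "m < m + inverse (Suc n)" by simp
    then show ?thesis
      using Es(3) bdd unfolding m_def by (subst (asm) cInf_less_iff) auto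
  qed
  then obtain y where yE: "\<And>n. y n \<in> E" and y: "\<And>n. f (y n) < m + inverse (Suc n)"
    by metis
  \<comment> \<open>Parallelogram law: the linear parts of \<open>f\<close> cancel against the one
    at the midpoint, so two near-minimizers are close to each other.\<close>
  have par: "(norm (u - v))\<^sup>2 \<le> 2 * (f u - m) + 2 * (f v - m)" if "u \<in> E" "v \<in> E" for u v
  proof -
    let ?w = "(1/2) *\<^sub>R (u + v)"
    have "?w \<in> E" using that Es by simp
    then have "m \<le> f ?w" by (rule m_le)
    moreover have "(norm (u - v))\<^sup>2 = 2 * f u + 2 * f v - 4 * f ?w"
      using that Es by (simp add: f_def scaleR add power2_norm_eq_inner inner_diff_left
          inner_diff_right inner_add_left inner_add_right inner_commute field_simps)
    ultimately show ?thesis by simp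
  qed
  have "Cauchy y"
  proof (rule CauchyI)
    fix e :: real assume e: "e > 0"
    obtain N where N: "inverse (real (Suc N)) < e\<^sup>2 / 4"
      using e reals_Archimedean[of "e\<^sup>2 / 4"] by auto
    show "\<exists>M. \<forall>m\<ge>M. \<forall>n\<ge>M. norm (y m - y n) < e"
    proof (intro exI allI impI)
      fix i j assume "i \<ge> N" "j \<ge> N"
      then have ij: "inverse (real (Suc i)) \<le> inverse (real (Suc N))"
        "inverse (real (Suc j)) \<le> inverse (real (Suc N))"
        by auto
      have "(norm (y i - y j))\<^sup>2 \<le> 2 * (f (y i) - m) + 2 * (f (y j) - m)"
        by (intro par yE)
      also have "\<dots> < e\<^sup>2"
      proof -
        have "f (y i) - m < e\<^sup>2 / 4" "f (y j) - m < e\<^sup>2 / 4"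
          using ij N y[of i] y[of j] by linarith+
        then show ?thesis by simp
      qed
      finally show "norm (y i - y j) < e"
        using e power_less_imp_less_base by (metis less_eq_real_def)
    qed
  qed
  then obtain w where w: "y \<longlonglongrightarrow> w"
    using Cauchy_convergent convergent_def by blast
  have wE: "w \<in> E"
    using closed_sequentially[OF Es(2)] yE w by blast
  have "(\<lambda>n. \<phi> (y n) - \<phi> w) \<longlonglongrightarrow> 0"
  proof (rule Lim_null_comparison)
    have "\<phi> (y n) = \<phi> (y n - w) + \<phi> w" for n
      using add[of "y n - w" w] yE wE Es by simp
    then show "\<forall>\<^sub>F n in sequentially. cmod (\<phi> (y n) - \<phi> w) \<le> K * norm (y n - w)"
      using bound yE wE Es by (intro always_eventually allI) simp
    show "(\<lambda>n. K * norm (y n - w)) \<longlonglongrightarrow> 0"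
      using w by (intro tendsto_mult_right_zero tendsto_norm_zero LIM_zero)
  qed
  then have "(\<lambda>n. \<phi> (y n)) \<longlonglongrightarrow> \<phi> w"
    by (rule LIM_zero_cancel)
  then have lim: "(\<lambda>n. f (y n)) \<longlonglongrightarrow> f w"
    unfolding f_def by (intro tendsto_intros w)
  have "(\<lambda>n. m + inverse (real (Suc n))) \<longlonglongrightarrow> m + 0"
    by (intro tendsto_intros LIMSEQ_inverse_real_of_nat)
  with lim have "f w \<le> m + 0"
    by (rule LIMSEQ_le) (use y less_imp_le in blast)
  then have min: "f w \<le> f x" if "x \<in> E" for x
    using m_le[OF that] by simp
  have Re: "Re (\<phi> x) = Re (cinner x w)" if x: "x \<in> E" for x
  proof -
    have "0 \<le> (norm x)\<^sup>2 * t\<^sup>2 + 2 * (inner x w - Re (\<phi> x)) * t" for t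
    proof -
      have "f w \<le> f (w + t *\<^sub>R x)"
        using min x wE Es by simp
      moreover have "(norm (w + t *\<^sub>R x))\<^sup>2 = (norm w)\<^sup>2 + 2 * t * inner x w + t\<^sup>2 * (norm x)\<^sup>2"
        unfolding power2_norm_eq_inner
        by (simp add: inner_add_left inner_add_right inner_commute power2_eq_square)
      ultimately show ?thesis
        using x wE Es by (simp add: f_def add scaleR algebra_simps)
    qed
    then have "inner x w - Re (\<phi> x) = 0"
      by (rule quadratic_nonneg_imp_zero[rotated]) simp
    then show ?thesis by (simp add: Re_cinner)
  qed
  have "\<phi> x = cinner x w" if x: "x \<in> E" for x
  proof (rule complex_eqI[OF Re[OF x]])
    \<comment> \<open>The imaginary part at \<open>x\<close> is the real part at
      \<open>-\<i> x\<close>, so agreement of real parts suffices.\<close>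
    have "Re (\<phi> ((-\<i>) *\<^sub>C x)) = Re (cinner ((-\<i>) *\<^sub>C x) w)"
      by (rule Re[OF Es(6)[OF x]])
    then show "Im (\<phi> x) = Im (cinner x w)"
      using x by (simp add: scale cinner_scaleC_left del: complex_vector.scale_minus_left)
  qed
  then show thesis
    using that wE by blast
qed

lemma cinner_eq_imp_eq_on:
  assumes "complex_vector.subspace E" "u \<in> E" "v \<in> E" "\<And>x. x \<in> E \<Longrightarrow> cinner x u = cinner x v"
  shows "u = v"
proof -
  have "cinner (u - v) (u - v) = 0"
    using assms by (simp add: cinner.diff_right complex_vector.subspace_diff)
  then show ?thesis by simp
qed

text \<open>Orthogonality to \<open>v\<close> passes to the closure of \<open>D\<close>, which
  contains \<open>v\<close> itself.\<close>

lemma orthogonal_to_dense_eq_0: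
  fixes v :: "'a::complex_inner"
  assumes v: "v \<in> closure D" and orth: "\<And>x. x \<in> D \<Longrightarrow> cinner x v = 0"
  shows "v = 0"
proof -
  have "closed {w. cinner w v = 0}"
    by (intro closed_Collect_eq continuous_intros linear_continuous_on cinner.bounded_linear_left)
  then have "closure D \<subseteq> {w. cinner w v = 0}"
    using orth by (intro closure_minimal) auto
  then show ?thesis
    using v by auto
qed

lemma closure_eq_if_orthogonal_zero:
  fixes E :: "'a::chilbert_space set"
  assumes E: "closed_csubspace E" and D: "complex_vector.subspace D" "D \<subseteq> E"
    and orth: "\<And>y. y \<in> E \<Longrightarrow> (\<And>x. x \<in> D \<Longrightarrow> cinner x y = 0) \<Longrightarrow> y = 0"
  shows "closure D = E"
proof
  show "closure D \<subseteq> E"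
    using D E by (simp add: closure_minimal closed_csubspace_def)
  show "E \<subseteq> closure D"
  proof
    fix x assume x: "x \<in> E"
    \<comment> \<open>Representing the functional \<open>\<lambda>z. cinner z x\<close> on
      \<open>closure D\<close> yields the orthogonal projection \<open>y\<close> of
      \<open>x\<close>.\<close>
    obtain y where y: "y \<in> closure D" "\<And>z. z \<in> closure D \<Longrightarrow> cinner z x = cinner z y"
      by (rule riesz_representation_on[OF closed_csubspace_closure[OF D(1)],
            of "\<lambda>z. cinner z x" "norm x"])
        (auto simp: cinner_add_left cinner_scaleC_left norm_cinner_le mult.commute)
    have "x - y = 0"
    proof (rule orth)
      show "x - y \<in> E"
        using x y(1) \<open>closure D \<subseteq> E\<close> closed_csubspaceD[OF E] by blast
      show "cinner z (x - y) = 0" if "z \<in> D" for z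
        using y(2)[of z] that closure_subset by (auto simp: cinner.diff_right)
    qed
    then show "x \<in> closure D"
      using y(1) by simp
  qed
qed

section \<open>Adjoints on closed subspaces and extension by density\<close>

lemma cadjoint_on_exists:
  fixes E :: "'a::chilbert_space set"
  assumes E: "closed_csubspace E" and T: "bounded_clinear_on E E T"
  shows "\<exists>T'. (\<forall>x\<in>E. T' x \<in> E) \<and> (\<forall>x\<in>E. \<forall>y\<in>E. cinner (T x) y = cinner x (T' y))"
proof -
  obtain K where K: "\<And>x. x \<in> E \<Longrightarrow> norm (T x) \<le> K * norm x"
    using bounded_clinear_on_bound[OF T] by blast
  have "\<exists>z\<in>E. \<forall>x\<in>E. cinner (T x) y = cinner x z" if "y \<in> E" for y
  proof (rule riesz_representation_on[OF E, of "\<lambda>x. cinner (T x) y" "K * norm y"])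
    fix x assume x: "x \<in> E"
    have "cmod (cinner (T x) y) \<le> norm (T x) * norm y" by (rule norm_cinner_le)
    also have "\<dots> \<le> K * norm x * norm y" using K[OF x] by (simp add: mult_right_mono)
    finally show "cmod (cinner (T x) y) \<le> K * norm y * norm x" by (simp add: mult_ac)
  qed (auto simp: bounded_clinear_onD[OF T] cinner_add_left cinner_scaleC_left)
  then show ?thesis by metis
qed

lemma
  fixes E :: "'a::chilbert_space set"
  assumes E: "closed_csubspace E" and T: "bounded_clinear_on E E T"
  shows cadjoint_on_in: "x \<in> E \<Longrightarrow> cadjoint_on E T x \<in> E"
    and cinner_cadjoint_on: "x \<in> E \<Longrightarrow> y \<in> E \<Longrightarrow> cinner x (cadjoint_on E T y) = cinner (T x) y"
  unfolding cadjoint_on_def adjoint_wrt_def using someI_ex[OF cadjoint_on_exists[OF assms]] by auto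

lemma cinner_cadjoint_on_left:
  fixes E :: "'a::chilbert_space set"
  assumes E: "closed_csubspace E" and T: "bounded_clinear_on E E T" and "x \<in> E" "y \<in> E"
  shows "cinner (cadjoint_on E T x) y = cinner x (T y)"
  using cinner_cadjoint_on[OF E T \<open>y \<in> E\<close> \<open>x \<in> E\<close>] cinner_commute by metis

lemma bounded_clinear_cadjoint_on:
  fixes E :: "'a::chilbert_space set"
  assumes E: "closed_csubspace E" and T: "bounded_clinear_on E E T"
    and K: "\<And>x. x \<in> E \<Longrightarrow> norm (T x) \<le> K * norm x"
  shows "bounded_clinear_on E E (cadjoint_on E T)"
    and "x \<in> E \<Longrightarrow> norm (cadjoint_on E T x) \<le> K * norm x"
proof -
  note Es = closed_csubspaceD[OF E]
  note T' = cadjoint_on_in[OF E T] cinner_cadjoint_on[OF E T]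
  have bound: "norm (cadjoint_on E T x) \<le> K * norm x" if x: "x \<in> E" for x
  proof (cases "cadjoint_on E T x = 0")
    case True
    have "0 \<le> norm (T x)" "norm (T x) \<le> K * norm x" using K[OF x] by auto
    then have "0 \<le> K * norm x" by linarith
    then show ?thesis using True by simp
  next
    case False
    let ?y = "cadjoint_on E T x"
    have "(norm ?y)\<^sup>2 = Re (cinner (T ?y) x)"
      unfolding Re_cinner_self[symmetric] T'(2)[OF T'(1)[OF x] x] ..
    also have "\<dots> \<le> norm (T ?y) * norm x"
      using norm_cinner_le[of "T ?y" x] complex_Re_le_cmod order_trans by blast
    also have "\<dots> \<le> K * norm ?y * norm x"
      using K[OF T'(1)[OF x]] by (simp add: mult_right_mono)
    finally show ?thesis
      using False by (simp add: power2_eq_square mult_ac)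
  qed
  show "bounded_clinear_on E E (cadjoint_on E T)"
  proof (rule bounded_clinear_onI[OF _ _ _ bound])
    fix x y assume x: "x \<in> E" and y: "y \<in> E"
    show "cadjoint_on E T (x + y) = cadjoint_on E T x + cadjoint_on E T y"
      by (rule cinner_eq_imp_eq_on[OF Es(1)]) (auto simp: T' Es x y cinner_add_right)
  next
    fix c x assume x: "x \<in> E"
    show "cadjoint_on E T (c *\<^sub>C x) = c *\<^sub>C cadjoint_on E T x"
      by (rule cinner_eq_imp_eq_on[OF Es(1)]) (auto simp: T' Es x cinner_scaleC_right)
  qed (use T' in auto)
  show "x \<in> E \<Longrightarrow> norm (cadjoint_on E T x) \<le> K * norm x"
    by (rule bound)
qed

lemma bounded_clinear_cadjoint_on':
  fixes E :: "'a::chilbert_space set"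
  assumes "closed_csubspace E" and T: "bounded_clinear_on E E T"
  shows "bounded_clinear_on E E (cadjoint_on E T)"
  using bounded_clinear_cadjoint_on(1)[OF assms] bounded_clinear_on_bound[OF T] by metis

lemma cadjoint_on_eqI:
  fixes E :: "'a::chilbert_space set"
  assumes E: "closed_csubspace E" and T: "bounded_clinear_on E E T" and "y \<in> E" "z \<in> E"
    and "\<And>x. x \<in> E \<Longrightarrow> cinner (T x) y = cinner x z"
  shows "cadjoint_on E T y = z"
  by (rule cinner_eq_imp_eq_on[OF closed_csubspaceD(1)[OF E]])
    (simp_all add: cinner_cadjoint_on[OF E T] cadjoint_on_in[OF E T] assms(3-))

lemma cadjoint_on_cadjoint_on:
  fixes E :: "'a::chilbert_space set"
  assumes E: "closed_csubspace E" and T: "bounded_clinear_on E E T" and "x \<in> E"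
  shows "cadjoint_on E (cadjoint_on E T) x = T x"
  by (rule cadjoint_on_eqI[OF E bounded_clinear_cadjoint_on'[OF E T]])
    (simp_all add: assms(3) cinner_cadjoint_on_left[OF E T] bounded_clinear_onD(1)[OF T])

lemma cadjoint_cadjoint: "bounded_clinear T \<Longrightarrow> cadjoint (cadjoint T) = T"
  for T :: "'a::chilbert_space \<Rightarrow> 'a"
  using cadjoint_on_cadjoint_on[OF closed_csubspace_UNIV, of T] by (intro ext) blast

text \<open>The bound survives the closure of the graph. Applied over 0 it makes the closed graph
  single-valued, and by completeness the domain of the closed graph is closed. Starting from a
  relation means that well-definedness follows from the bound, which matters where a vector has many
  representations.\<close>

lemma extension_from_graph:
  fixes \<Gamma> :: "('a::chilbert_space \<times> 'b::chilbert_space) set"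
  assumes \<Gamma>: "complex_vector.subspace \<Gamma>" and K: "\<And>x y. (x, y) \<in> \<Gamma> \<Longrightarrow> norm y \<le> K * norm x"
  obtains g where "bounded_clinear_on (closure (fst ` \<Gamma>)) (closure (snd ` \<Gamma>)) g"
    "\<forall>(x, y)\<in>\<Gamma>. g x = y"
proof -
  have \<Gamma>': "complex_vector.subspace (closure \<Gamma>)"
    using \<Gamma> by (rule csubspace_closure)
  have bound: "norm y \<le> K * norm x" if "(x, y) \<in> closure \<Gamma>" for x y
  proof -
    have "closure \<Gamma> \<subseteq> {p. norm (snd p) \<le> K * norm (fst p)}"
      using K by (intro closure_minimal closed_Collect_le continuous_intros) auto
    then show ?thesis using that by auto
  qed
  have uniq: "y = y'" if "(x, y) \<in> closure \<Gamma>" "(x, y') \<in> closure \<Gamma>" for x y y'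
    using complex_vector.subspace_diff[OF \<Gamma>' that] bound[of 0 "y - y'"] by simp
  have ex: "\<exists>y. (x, y) \<in> closure \<Gamma>" if x: "x \<in> closure (fst ` \<Gamma>)" for x
  proof -
    obtain u where u: "\<And>n::nat. u n \<in> fst ` \<Gamma>" "u \<longlonglongrightarrow> x"
      using x unfolding closure_sequential by blast
    have "\<exists>y. (u n, y) \<in> \<Gamma>" for n
      using u(1)[of n] by force
    then obtain v where v: "\<And>n. (u n, v n) \<in> \<Gamma>"
      by metis
    \<comment> \<open>The constant is made positive because the Cauchy estimate below divides by
      it.\<close>
    have K0: "norm (v m - v n) \<le> max K 1 * norm (u m - u n)" for m n
    proof -
      have "(u m - u n, v m - v n) \<in> \<Gamma>"
        using complex_vector.subspace_diff[OF \<Gamma> v v] by simp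
      then have "norm (v m - v n) \<le> K * norm (u m - u n)" by (rule K)
      also have "\<dots> \<le> max K 1 * norm (u m - u n)" by (intro mult_right_mono) auto
      finally show ?thesis .
    qed
    have "Cauchy v"
    proof (rule CauchyI)
      fix e :: real assume "e > 0"
      then have "e / max K 1 > 0" by simp
      then obtain M where "\<forall>m\<ge>M. \<forall>n\<ge>M. norm (u m - u n) < e / max K 1"
        using LIMSEQ_imp_Cauchy[OF u(2)] by (meson CauchyD)
      then show "\<exists>M. \<forall>m\<ge>M. \<forall>n\<ge>M. norm (v m - v n) < e"
        using K0 by (intro exI[of _ M]) (force simp: pos_less_divide_eq mult.commute
            intro: le_less_trans[OF K0])
    qed
    then obtain y where "v \<longlonglongrightarrow> y"
      using Cauchy_convergent convergent_def by blast
    then have "(\<lambda>n. (u n, v n)) \<longlonglongrightarrow> (x, y)"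
      by (intro tendsto_Pair u)
    then show ?thesis
      unfolding closure_sequential using v by (intro exI[of _ y] exI[of _ "\<lambda>n. (u n, v n)"]) simp
  qed
  define g where "g x = (THE y. (x, y) \<in> closure \<Gamma>)" for x
  have g_eq: "g x = y" if "(x, y) \<in> closure \<Gamma>" for x y
    unfolding g_def using that uniq by blast
  have g: "(x, g x) \<in> closure \<Gamma>" if "x \<in> closure (fst ` \<Gamma>)" for x
    using ex[OF that] g_eq by auto
  have "bounded_clinear_on (closure (fst ` \<Gamma>)) (closure (snd ` \<Gamma>)) g"
  proof (rule bounded_clinear_onI)
    fix x assume x: "x \<in> closure (fst ` \<Gamma>)"
    show "norm (g x) \<le> K * norm x"
      using bound g x by blast
    have "snd ` closure \<Gamma> \<subseteq> closure (snd ` \<Gamma>)"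
      by (intro image_closure_subset continuous_intros) (auto simp: closure_subset)
    then show "g x \<in> closure (snd ` \<Gamma>)"
      using g[OF x] by force
    show "g (c *\<^sub>C x) = c *\<^sub>C g x" for c
      using complex_vector.subspace_scale[OF \<Gamma>' g[OF x], of c]
      by (intro g_eq) (simp add: scaleC_prod_def)
    fix y assume y: "y \<in> closure (fst ` \<Gamma>)"
    show "g (x + y) = g x + g y"
      using complex_vector.subspace_add[OF \<Gamma>' g[OF x] g[OF y]] by (intro g_eq) simp
  qed
  moreover have "\<forall>(x, y)\<in>\<Gamma>. g x = y"
    using g_eq closure_subset by blast
  ultimately show thesis
    by (rule that)
qed

section \<open>Positive square roots\<close>

definition selfadjoint_on :: "'a::complex_inner set \<Rightarrow> ('a \<Rightarrow> 'a) \<Rightarrow> bool" where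
  "selfadjoint_on E T \<longleftrightarrow> (\<forall>x\<in>E. \<forall>y\<in>E. cinner (T x) y = cinner x (T y))"

definition positive_on :: "'a::complex_inner set \<Rightarrow> ('a \<Rightarrow> 'a) \<Rightarrow> bool" where
  "positive_on E T \<longleftrightarrow> bounded_clinear_on E E T \<and> (\<forall>x\<in>E. cinner (T x) x \<in> \<real>\<^sub>\<ge>\<^sub>0)"

text \<open>Polarization: the form \<open>b\<close>, which measures the failure of symmetry,
  vanishes on the diagonal. Its values at \<open>x + y\<close> and
  \<open>x + \<i> *\<^sub>C y\<close> give \<open>b x y + b y x = 0\<close> and
  \<open>b y x = b x y\<close>.\<close>

lemma positive_on_selfadjoint:
  assumes E: "complex_vector.subspace E" and T: "positive_on E T"
  shows "selfadjoint_on E T"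
proof -
  have bcl: "bounded_clinear_on E E T" and pos: "\<And>x. x \<in> E \<Longrightarrow> cinner (T x) x \<in> \<real>\<^sub>\<ge>\<^sub>0"
    using T by (auto simp: positive_on_def)
  note Es = complex_vector.subspace_add[OF E] complex_vector.subspace_scale[OF E]
  define b where "b x y = cinner (T x) y - cinner x (T y)" for x y
  have diag: "b x x = 0" if "x \<in> E" for x
  proof -
    have "cinner (T x) x \<in> \<real>"
      using pos[OF that] nonneg_Reals_subset_Reals by blast
    then have "cnj (cinner (T x) x) = cinner (T x) x"
      by (simp add: Reals_cnj_iff)
    then show ?thesis
      using cinner_commute[of x "T x"] by (simp add: b_def)
  qed
  show ?thesis
    unfolding selfadjoint_on_def
  proof (intro ballI)
    fix x y assume x: "x \<in> E" and y: "y \<in> E"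
    have 1: "b x y + b y x = 0"
      using diag[of x] diag[of y] diag[of "x + y"] x y Es
      by (simp add: b_def bounded_clinear_onD[OF bcl] cinner_add_left cinner_add_right
          algebra_simps)
    have "- \<i> * b x y + \<i> * b y x = b (x + \<i> *\<^sub>C y) (x + \<i> *\<^sub>C y) - b x x - b y y"
      using x y Es
      by (simp add: b_def bounded_clinear_onD[OF bcl] cinner_add_left cinner_add_right
          cinner_scaleC_left cinner_scaleC_right algebra_simps)
    also have "\<dots> = 0"
      using x y Es by (simp add: diag)
    finally have "\<i> * (b y x - b x y) = 0"
      by (simp add: algebra_simps)
    then have "b y x = b x y"
      by simp
    with 1 have "2 * b x y = 0"
      by simp
    then have "b x y = 0"
      by simp
    then show "cinner (T x) y = cinner x (T y)"
      by (simp add: b_def)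
  qed
qed

lemma selfadjoint_onI_positive:
  assumes "bounded_clinear_on E E T" "selfadjoint_on E T" "\<And>x. x \<in> E \<Longrightarrow> 0 \<le> Re (cinner (T x) x)"
  shows "positive_on E T"
proof -
  have "cinner (T x) x \<in> \<real>\<^sub>\<ge>\<^sub>0" if x: "x \<in> E" for x
  proof -
    have "cnj (cinner (T x) x) = cinner (T x) x"
      using assms(2) x cinner_commute[of x "T x"] by (simp add: selfadjoint_on_def)
    then have "Im (cinner (T x) x) = 0"
      by (metis Reals_cnj_iff complex_is_Real_iff)
    then show ?thesis
      using assms(3)[OF x] by (simp add: complex_nonneg_Reals_iff)
  qed
  then show ?thesis
    using assms(1) by (simp add: positive_on_def)
qed

text \<open>Along the line \<open>x + t *\<^sub>R T x\<close> the form of \<open>T\<close> is a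
  nonnegative quadratic polynomial in \<open>t\<close> that vanishes at 0; its linear coefficient
  \<open>2 * (norm (T x))\<^sup>2\<close> must be 0.\<close>

lemma positive_on_eq_0:
  assumes E: "complex_vector.subspace E" and T: "positive_on E T" and x: "x \<in> E"
    and 0: "cinner (T x) x = 0"
  shows "T x = 0"
proof -
  have bcl: "bounded_clinear_on E E T" and pos: "\<And>x. x \<in> E \<Longrightarrow> cinner (T x) x \<in> \<real>\<^sub>\<ge>\<^sub>0"
    using T by (auto simp: positive_on_def)
  have sa: "cinner (T x) y = cinner x (T y)" if "x \<in> E" "y \<in> E" for x y
    using positive_on_selfadjoint[OF E T] that by (simp add: selfadjoint_on_def)
  let ?y = "T x"
  have y: "?y \<in> E" "T ?y \<in> E"
    using bounded_clinear_onD(1)[OF bcl] x by auto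
  have "0 \<le> Re (cinner (T ?y) ?y) * t\<^sup>2 + 2 * (norm ?y)\<^sup>2 * t" for t :: real
  proof -
    let ?z = "x + t *\<^sub>R ?y"
    have z: "?z \<in> E"
      using x y E complex_vector.subspace_add csubspace_scaleR by blast
    have "T ?z = ?y + t *\<^sub>R T ?y"
      using x y bounded_clinear_onD[OF bcl] csubspace_scaleR[OF E] by simp
    then have "cinner (T ?z) ?z = cinner (T x) x + t * cinner ?y ?y + t * cinner (T ?y) x
        + t * t * cinner (T ?y) ?y"
      by (simp add: cinner.add_left cinner.add_right cinner.scaleR_left cinner.scaleR_right
          scaleR_conv_of_real algebra_simps)
    moreover have "cinner (T ?y) x = cinner ?y ?y"
      using sa x y by simp
    moreover have "0 \<le> Re (cinner (T ?z) ?z)"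
      using pos[OF z] by (simp add: complex_nonneg_Reals_iff)
    ultimately show ?thesis
      using 0 by (simp add: cinner_self power2_eq_square algebra_simps flip: of_real_mult)
  qed
  then have "(norm ?y)\<^sup>2 = 0"
    using pos[OF y(1)] by (intro quadratic_nonneg_imp_zero) (auto simp: complex_nonneg_Reals_iff)
  then show ?thesis
    by simp
qed

text \<open>The iteration \<open>X\<^sub>0 = 0\<close>, \<open>X\<^sub>n\<^sub>+\<^sub>1 = (B + X\<^sub>n\<^sup>2) / 2\<close> converges to \<open>1 - sqrt (1 - B)\<close> for every contraction
  \<open>B\<close>; the scalar iteration for \<open>B = 1\<close> dominates the norms of \<open>X\<^sub>n\<close> and of \<open>X\<^sub>n\<^sub>+\<^sub>1 - X\<^sub>n\<close>.\<close>

primrec sqrt_iter :: "('a::complex_inner \<Rightarrow> 'a) \<Rightarrow> nat \<Rightarrow> 'a \<Rightarrow> 'a" where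
  "sqrt_iter B 0 x = 0"
| "sqrt_iter B (Suc n) x = (1/2) *\<^sub>C (B x + sqrt_iter B n (sqrt_iter B n x))"

primrec sqrt_maj :: "nat \<Rightarrow> real" where
  "sqrt_maj 0 = 0"
| "sqrt_maj (Suc n) = (1 + (sqrt_maj n)\<^sup>2) / 2"

lemma sqrt_maj_bounds: "0 \<le> sqrt_maj n \<and> sqrt_maj n \<le> 1"
proof (induction n)
  case (Suc n)
  then have "(sqrt_maj n)\<^sup>2 \<le> 1"
    by (simp add: power_le_one)
  then show ?case by simp
qed simp

lemma sqrt_maj_mono: "sqrt_maj n \<le> sqrt_maj (Suc n)"
  using sum_squares_bound[of "sqrt_maj n" 1] by (simp add: power2_eq_square)

text \<open>\<open>B\<close> plays the role of \<open>I - T\<close> for the operator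
  \<open>T\<close> whose square root is sought.\<close>

locale contraction_on =
  fixes E :: "'a::chilbert_space set" and B :: "'a \<Rightarrow> 'a"
  assumes E: "closed_csubspace E" and B: "bounded_clinear_on E E B"
    and contr: "\<And>x. x \<in> E \<Longrightarrow> norm (B x) \<le> norm x"
begin

lemma bounded_clinear_sqrt_iter: "bounded_clinear_on E E (sqrt_iter B n)"
proof (induction n)
  case 0
  show ?case
    by (rule bounded_clinear_onI[where K = 0]) (auto simp: closed_csubspaceD[OF E])
next
  case (Suc n)
  then show ?case
    using bounded_clinear_on_scaleC[OF bounded_clinear_on_add[OF B bounded_clinear_on_compose]]
      closed_csubspaceD(1)[OF E] by auto
qed

lemma norm_sqrt_iter_le: "x \<in> E \<Longrightarrow> norm (sqrt_iter B n x) \<le> sqrt_maj n * norm x"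
proof (induction n arbitrary: x)
  case (Suc n)
  have "norm (sqrt_iter B n (sqrt_iter B n x)) \<le> sqrt_maj n * norm (sqrt_iter B n x)"
    using Suc bounded_clinear_onD(1)[OF bounded_clinear_sqrt_iter] by blast
  also have "\<dots> \<le> sqrt_maj n * (sqrt_maj n * norm x)"
    using Suc sqrt_maj_bounds by (intro mult_left_mono) auto
  finally have "norm (B x + sqrt_iter B n (sqrt_iter B n x)) \<le> norm x + (sqrt_maj n)\<^sup>2 * norm x"
    using contr[OF Suc.prems] by (intro norm_triangle_le add_mono) (auto simp: power2_eq_square)
  then show ?case
    unfolding sqrt_iter.simps norm_scaleC by (simp add: field_simps)
qed simp

text \<open>For consecutive iterates, \<open>X X - Y Y = X (X - Y) + (X - Y) Y\<close> holds for
  operators that need not commute, and matches the factorization of the difference of squares for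
  the scalar majorant.\<close>

lemma norm_sqrt_iter_diff_le:
  "x \<in> E \<Longrightarrow> norm (sqrt_iter B (Suc n) x - sqrt_iter B n x)
     \<le> (sqrt_maj (Suc n) - sqrt_maj n) * norm x"
proof (induction n arbitrary: x)
  case 0
  then show ?case
    using contr by (simp add: norm_scaleC)
next
  case (Suc n)
  let ?X = "sqrt_iter B (Suc n)" and ?Y = "sqrt_iter B n"
  let ?s = "sqrt_maj (Suc n)" and ?t = "sqrt_maj n"
  have X: "?X y \<in> E" and Y: "?Y y \<in> E" if "y \<in> E" for y
    using bounded_clinear_onD(1)[OF bounded_clinear_sqrt_iter] that by blast+
  have eq: "sqrt_iter B (Suc (Suc n)) x - ?X x
      = (1/2) *\<^sub>C (?X (?X x - ?Y x) + (?X (?Y x) - ?Y (?Y x)))"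
  proof -
    have "?X (?X x - ?Y x) = ?X (?X x) - ?X (?Y x)"
      by (rule bounded_clinear_on_diff[OF bounded_clinear_sqrt_iter closed_csubspaceD(1)[OF E]
            X[OF Suc.prems] Y[OF Suc.prems]])
    moreover have "sqrt_iter B (Suc (Suc n)) x - ?X x
      = (1/2) *\<^sub>C (B x + ?X (?X x)) - (1/2) *\<^sub>C (B x + ?Y (?Y x))"
      by (simp only: sqrt_iter.simps)
    ultimately show ?thesis
      by (simp only: flip: scaleC.diff_right) (simp only: algebra_simps)
  qed
  have 1: "norm (?X (?X x - ?Y x)) \<le> ?s * ((?s - ?t) * norm x)"
  proof -
    have "norm (?X (?X x - ?Y x)) \<le> ?s * norm (?X x - ?Y x)"
      by (rule norm_sqrt_iter_le[OF closed_csubspaceD(5)[OF E X[OF Suc.prems] Y[OF Suc.prems]]])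
    also have "\<dots> \<le> ?s * ((?s - ?t) * norm x)"
      using Suc sqrt_maj_bounds by (intro mult_left_mono) blast+
    finally show ?thesis .
  qed
  have 2: "norm (?X (?Y x) - ?Y (?Y x)) \<le> (?s - ?t) * (?t * norm x)"
  proof -
    have "norm (?X (?Y x) - ?Y (?Y x)) \<le> (?s - ?t) * norm (?Y x)"
      using Suc Y by blast
    also have "\<dots> \<le> (?s - ?t) * (?t * norm x)"
      using norm_sqrt_iter_le[OF Suc.prems] sqrt_maj_mono[of n] by (intro mult_left_mono) auto
    finally show ?thesis .
  qed
  have "norm (sqrt_iter B (Suc (Suc n)) x - ?X x)
      = (1/2) * norm (?X (?X x - ?Y x) + (?X (?Y x) - ?Y (?Y x)))"
    unfolding eq by (simp add: norm_scaleC)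
  also have "\<dots> \<le> (1/2) * (?s * ((?s - ?t) * norm x) + (?s - ?t) * (?t * norm x))"
    using 1 2 by (intro mult_left_mono norm_triangle_le add_mono) simp_all
  also have "\<dots> = ((1 + ?s\<^sup>2) / 2 - (1 + ?t\<^sup>2) / 2) * norm x"
    by (simp only: power2_eq_square) (simp add: field_simps del: sqrt_maj.simps)
  finally show ?case
    by (simp only: sqrt_maj.simps)
qed

lemma convergent_sqrt_iter:
  assumes x: "x \<in> E"
  shows "convergent (\<lambda>n. sqrt_iter B n x)"
proof -
  \<comment> \<open>The scalar increments telescope, so their partial sums are the values
    \<open>sqrt_maj n\<close>, all at most 1.\<close>
  have "summable (\<lambda>n. sqrt_maj (Suc n) - sqrt_maj n)"
  proof (rule summableI_nonneg_bounded[where x = 1])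
    show "(\<Sum>i<n. sqrt_maj (Suc i) - sqrt_maj i) \<le> 1" for n
      using sqrt_maj_bounds[of n] by (simp add: sum_lessThan_telescope del: sqrt_maj.simps(2))
  qed (use sqrt_maj_mono in \<open>simp del: sqrt_maj.simps\<close>)
  then have "summable (\<lambda>n. (sqrt_maj (Suc n) - sqrt_maj n) * norm x)"
    by (rule summable_mult2)
  then have "summable (\<lambda>n. sqrt_iter B (Suc n) x - sqrt_iter B n x)"
    by (rule summable_comparison_test'[where N = 0]) (rule norm_sqrt_iter_diff_le[OF x])
  then have "convergent (\<lambda>n. \<Sum>i<n. sqrt_iter B (Suc i) x - sqrt_iter B i x)"
    by (simp only: summable_iff_convergent)
  then show ?thesis
    by (simp only: sum_lessThan_telescope[of "\<lambda>i. sqrt_iter B i x"]) simp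
qed

definition sqrt_lim :: "'a \<Rightarrow> 'a" where
  "sqrt_lim x = lim (\<lambda>n. sqrt_iter B n x)"

lemma tendsto_sqrt_lim: "x \<in> E \<Longrightarrow> (\<lambda>n. sqrt_iter B n x) \<longlonglongrightarrow> sqrt_lim x"
  unfolding sqrt_lim_def by (simp add: convergent_sqrt_iter flip: convergent_LIMSEQ_iff)

lemma sqrt_iter_in: "x \<in> E \<Longrightarrow> sqrt_iter B n x \<in> E"
  using bounded_clinear_onD(1)[OF bounded_clinear_sqrt_iter] .

lemma sqrt_lim_in: "x \<in> E \<Longrightarrow> sqrt_lim x \<in> E"
  using closed_sequentially[OF closed_csubspaceD(2)[OF E] _ tendsto_sqrt_lim] sqrt_iter_in by simp

lemma norm_sqrt_iter_le1: "x \<in> E \<Longrightarrow> norm (sqrt_iter B n x) \<le> norm x"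
  using norm_sqrt_iter_le[of x n] sqrt_maj_bounds[of n]
  by (meson mult_left_le_one_le norm_ge_zero order_trans)

lemma norm_sqrt_lim_le: "x \<in> E \<Longrightarrow> norm (sqrt_lim x) \<le> norm x"
  using norm_sqrt_iter_le1
  by (intro LIMSEQ_le_const2[OF tendsto_norm[OF tendsto_sqrt_lim]]) auto

lemma bounded_clinear_sqrt_lim: "bounded_clinear_on E E sqrt_lim"
proof (rule bounded_clinear_onI[where K = 1])
  note Es = closed_csubspaceD[OF E]
  fix x assume x: "x \<in> E"
  show "sqrt_lim x \<in> E" "norm (sqrt_lim x) \<le> 1 * norm x"
    using x by (simp_all add: sqrt_lim_in norm_sqrt_lim_le)
  show "sqrt_lim (c *\<^sub>C x) = c *\<^sub>C sqrt_lim x" for c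
  proof (rule LIMSEQ_unique[OF tendsto_sqrt_lim])
    show "(\<lambda>n. sqrt_iter B n (c *\<^sub>C x)) \<longlonglongrightarrow> c *\<^sub>C sqrt_lim x"
      using scaleC.tendsto[OF tendsto_const tendsto_sqrt_lim[OF x]]
      by (simp only: bounded_clinear_onD(3)[OF bounded_clinear_sqrt_iter x])
  qed (simp add: x Es)
  fix y assume y: "y \<in> E"
  show "sqrt_lim (x + y) = sqrt_lim x + sqrt_lim y"
  proof (rule LIMSEQ_unique[OF tendsto_sqrt_lim])
    show "(\<lambda>n. sqrt_iter B n (x + y)) \<longlonglongrightarrow> sqrt_lim x + sqrt_lim y"
      using tendsto_add[OF tendsto_sqrt_lim[OF x] tendsto_sqrt_lim[OF y]]
      by (simp only: bounded_clinear_onD(2)[OF bounded_clinear_sqrt_iter x y])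
  qed (simp add: x y Es)
qed

text \<open>Strong convergence survives composition because the iterates \<open>X n\<close> are
  contractions: \<open>X n (X n x) = X n (X n x - sqrt_lim x) + X n (sqrt_lim x)\<close>, and the
  first term tends to 0.\<close>

lemma sqrt_lim_equation:
  assumes x: "x \<in> E"
  shows "sqrt_lim x = (1/2) *\<^sub>C (B x + sqrt_lim (sqrt_lim x))"
proof (rule LIMSEQ_unique[OF LIMSEQ_Suc[OF tendsto_sqrt_lim[OF x]]])
  note Es = closed_csubspaceD[OF E]
  have "(\<lambda>n. sqrt_iter B n (sqrt_iter B n x - sqrt_lim x)) \<longlonglongrightarrow> 0"
  proof (rule Lim_null_comparison)
    show "\<forall>\<^sub>F n in sequentially. norm (sqrt_iter B n (sqrt_iter B n x - sqrt_lim x))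
        \<le> norm (sqrt_iter B n x - sqrt_lim x)"
      by (intro always_eventually allI norm_sqrt_iter_le1 Es(5) sqrt_iter_in sqrt_lim_in x)
    show "(\<lambda>n. norm (sqrt_iter B n x - sqrt_lim x)) \<longlonglongrightarrow> 0"
      using tendsto_sqrt_lim[OF x] by (intro tendsto_norm_zero LIM_zero)
  qed
  from tendsto_add[OF this tendsto_sqrt_lim[OF sqrt_lim_in[OF x]]]
  have "(\<lambda>n. sqrt_iter B n (sqrt_iter B n x - sqrt_lim x) + sqrt_iter B n (sqrt_lim x))
      \<longlonglongrightarrow> sqrt_lim (sqrt_lim x)"
    by simp
  then have "(\<lambda>n. sqrt_iter B n (sqrt_iter B n x)) \<longlonglongrightarrow> sqrt_lim (sqrt_lim x)"
    using bounded_clinear_on_diff[OF bounded_clinear_sqrt_iter Es(1) sqrt_iter_in[OF x]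
        sqrt_lim_in[OF x]] by simp
  then show "(\<lambda>n. sqrt_iter B (Suc n) x) \<longlonglongrightarrow> (1/2) *\<^sub>C (B x + sqrt_lim (sqrt_lim x))"
    by (auto intro!: scaleC.tendsto tendsto_add)
qed

lemma sqrt_lim_commute:
  assumes C: "bounded_clinear_on E E C" and comm: "\<And>x. x \<in> E \<Longrightarrow> C (B x) = B (C x)" and x: "x \<in> E"
  shows "C (sqrt_lim x) = sqrt_lim (C x)"
proof -
  note Es = closed_csubspaceD[OF E]
  note Cs = bounded_clinear_onD[OF C]
  have eq: "C (sqrt_iter B n x) = sqrt_iter B n (C x)" if "x \<in> E" for n x
    using that
  proof (induction n arbitrary: x)
    case 0
    then show ?case using bounded_clinear_on_0[OF C Es(1)] by simp
  next
    case (Suc n)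
    have "B x \<in> E" "sqrt_iter B n (sqrt_iter B n x) \<in> E"
      using Suc.prems sqrt_iter_in bounded_clinear_onD(1)[OF B] by auto
    then show ?case
      using Suc sqrt_iter_in Es by (simp add: Cs comm)
  qed
  have "(\<lambda>n. C (sqrt_iter B n x)) \<longlonglongrightarrow> C (sqrt_lim x)"
    using x sqrt_iter_in sqrt_lim_in tendsto_sqrt_lim
    by (intro bounded_clinear_on_tendsto[OF C Es(1)]) auto
  then show ?thesis
    using tendsto_sqrt_lim[of "C x"] Cs(1) x LIMSEQ_unique by (simp add: eq)
qed

lemma selfadjoint_sqrt_lim:
  assumes sa: "selfadjoint_on E B"
  shows "selfadjoint_on E sqrt_lim"
proof -
  have "selfadjoint_on E (sqrt_iter B n)" for n
  proof (induction n)
    case (Suc n)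
    show ?case
      unfolding selfadjoint_on_def
    proof (intro ballI)
      fix x y assume x: "x \<in> E" and y: "y \<in> E"
      have "cinner (sqrt_iter B n (sqrt_iter B n x)) y = cinner x (sqrt_iter B n (sqrt_iter B n y))"
        using Suc x y sqrt_iter_in unfolding selfadjoint_on_def by metis
      then show "cinner (sqrt_iter B (Suc n) x) y = cinner x (sqrt_iter B (Suc n) y)"
        using sa x y by (simp add: selfadjoint_on_def cinner_scaleC_left cinner_scaleC_right
            cinner.add_left cinner.add_right)
    qed
  qed (simp add: selfadjoint_on_def)
  then have eq: "cinner (sqrt_iter B n x) y = cinner x (sqrt_iter B n y)"
    if "x \<in> E" "y \<in> E" for n x y
    using that by (simp add: selfadjoint_on_def)
  show ?thesis
    unfolding selfadjoint_on_def
  proof (intro ballI)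
    fix x y assume x: "x \<in> E" and y: "y \<in> E"
    have "(\<lambda>n. cinner (sqrt_iter B n x) y) \<longlonglongrightarrow> cinner (sqrt_lim x) y"
      by (intro cinner.tendsto tendsto_sqrt_lim x tendsto_const)
    moreover have "(\<lambda>n. cinner x (sqrt_iter B n y)) \<longlonglongrightarrow> cinner x (sqrt_lim y)"
      by (intro cinner.tendsto tendsto_sqrt_lim y tendsto_const)
    ultimately show "cinner (sqrt_lim x) y = cinner x (sqrt_lim y)"
      unfolding eq[OF x y] using LIMSEQ_unique by blast
  qed
qed

end

text \<open>With \<open>L = sqrt_lim\<close>, the limit equation \<open>2 L = I - T + L L\<close>
  says that \<open>I - L\<close> squares to \<open>T\<close>. Positivity comes from \<open>L\<close>
  being a contraction. Commutation with \<open>C\<close> is inherited from the iterates, which are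
  polynomials in \<open>T\<close>; uniqueness of the root will rest on it.\<close>

lemma positive_sqrt_exists:
  fixes E :: "'a::chilbert_space set"
  assumes E: "closed_csubspace E" and T: "bounded_clinear_on E E T" and sa: "selfadjoint_on E T"
    and contr: "\<And>x. x \<in> E \<Longrightarrow> norm (x - T x) \<le> norm x"
  obtains R where "positive_on E R" "\<And>x. x \<in> E \<Longrightarrow> R (R x) = T x"
    "\<And>C. bounded_clinear_on E E C \<Longrightarrow> \<forall>x\<in>E. C (T x) = T (C x) \<Longrightarrow> \<forall>x\<in>E. C (R x) = R (C x)"
proof -
  note Es = closed_csubspaceD[OF E]
  interpret contraction_on E "\<lambda>x. x - T x"
    using E contr bounded_clinear_on_minus[OF bounded_clinear_on_ident T Es(1)]
    by unfold_locales auto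
  define R where "R x = x - sqrt_lim x" for x
  have R: "bounded_clinear_on E E R"
    unfolding R_def
    by (intro bounded_clinear_on_minus bounded_clinear_on_ident bounded_clinear_sqrt_lim Es) simp
  have "selfadjoint_on E (\<lambda>x. x - T x)"
    using sa by (simp add: selfadjoint_on_def cinner.diff_left cinner.diff_right)
  then have "selfadjoint_on E sqrt_lim"
    by (rule selfadjoint_sqrt_lim)
  then have saR: "selfadjoint_on E R"
    by (simp add: selfadjoint_on_def R_def cinner.diff_left cinner.diff_right)
  have "positive_on E R"
  proof (rule selfadjoint_onI_positive[OF R saR])
    fix x assume x: "x \<in> E"
    have "Re (cinner (sqrt_lim x) x) \<le> norm (sqrt_lim x) * norm x"
      using norm_cinner_le complex_Re_le_cmod order_trans by blast
    also have "\<dots> \<le> norm x * norm x"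
      using norm_sqrt_lim_le[OF x] by (intro mult_right_mono) auto
    finally show "0 \<le> Re (cinner (R x) x)"
      by (simp add: R_def cinner.diff_left Re_cinner_self power2_eq_square)
  qed
  moreover have "R (R x) = T x" if x: "x \<in> E" for x
  proof -
    have "R (R x) = x - sqrt_lim x - (sqrt_lim x - sqrt_lim (sqrt_lim x))"
      using bounded_clinear_on_diff[OF bounded_clinear_sqrt_lim Es(1) x sqrt_lim_in[OF x]]
      by (simp add: R_def)
    moreover have "sqrt_lim x + sqrt_lim x = x - T x + sqrt_lim (sqrt_lim x)"
    proof -
      have "sqrt_lim x + sqrt_lim x = 2 *\<^sub>C sqrt_lim x"
        using scaleC_add_left[of 1 1 "sqrt_lim x"] by simp
      also have "\<dots> = 2 *\<^sub>C (1/2) *\<^sub>C (x - T x + sqrt_lim (sqrt_lim x))"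
        using sqrt_lim_equation[OF x] by simp
      finally show ?thesis
        unfolding scaleC_scaleC by simp
    qed
    ultimately show ?thesis
      by (simp add: algebra_simps)
  qed
  moreover have "C (R x) = R (C x)"
    if C: "bounded_clinear_on E E C" and comm: "\<And>x. x \<in> E \<Longrightarrow> C (T x) = T (C x)" and x: "x \<in> E"
    for C x
  proof -
    have "C (sqrt_lim x) = sqrt_lim (C x)"
      using bounded_clinear_on_diff[OF C Es(1)] bounded_clinear_onD(1)[OF T] comm
      by (intro sqrt_lim_commute[OF C _ x]) simp
    then show ?thesis
      using bounded_clinear_on_diff[OF C Es(1) x sqrt_lim_in[OF x]] by (simp add: R_def)
  qed
  ultimately show thesis
    using that by blast
qed

text \<open>For \<open>y = R x - R' x\<close>, commutativity gives \<open>R y + R' y = 0\<close>.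
  Both forms are nonnegative, so each vanishes at \<open>y\<close>, whence
  \<open>R y = R' y = 0\<close>, and \<open>cinner y y\<close> is the inner product of
  \<open>x\<close> with \<open>R y - R' y\<close>.\<close>

lemma positive_sqrt_unique:
  assumes E: "complex_vector.subspace E" and R: "positive_on E R" and R': "positive_on E R'"
    and eq: "\<And>x. x \<in> E \<Longrightarrow> R (R x) = R' (R' x)" and comm: "\<And>x. x \<in> E \<Longrightarrow> R (R' x) = R' (R x)"
    and x: "x \<in> E"
  shows "R x = R' x"
proof -
  have bR: "bounded_clinear_on E E R" and bR': "bounded_clinear_on E E R'"
    using R R' by (auto simp: positive_on_def)
  note Rs = bounded_clinear_onD(1)[OF bR] bounded_clinear_on_diff[OF bR E]
  note Rs' = bounded_clinear_onD(1)[OF bR'] bounded_clinear_on_diff[OF bR' E]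
  let ?y = "R x - R' x"
  have y: "?y \<in> E"
    using E complex_vector.subspace_diff Rs(1) Rs'(1) x by blast
  have "R ?y + R' ?y = 0"
    using x Rs Rs' eq comm by simp
  then have "cinner (R ?y) ?y + cinner (R' ?y) ?y = 0"
    by (metis cinner.add_left cinner.zero_left)
  moreover have "cinner (R ?y) ?y \<in> \<real>\<^sub>\<ge>\<^sub>0" "cinner (R' ?y) ?y \<in> \<real>\<^sub>\<ge>\<^sub>0"
    using R R' y by (auto simp: positive_on_def)
  ultimately have "cinner (R ?y) ?y = 0" "cinner (R' ?y) ?y = 0"
    by (auto simp: complex_nonneg_Reals_iff complex_eq_iff)
  then have 0: "R ?y = 0" "R' ?y = 0"
    using positive_on_eq_0[OF E R y] positive_on_eq_0[OF E R' y] by auto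
  have "cinner ?y ?y = cinner x (R ?y) - cinner x (R' ?y)"
    using positive_on_selfadjoint[OF E R] positive_on_selfadjoint[OF E R'] x y
    by (simp add: selfadjoint_on_def cinner.diff_left)
  then show ?thesis
    by (simp add: 0)
qed

text \<open>The root selected by \<open>SOME\<close> commutes with its own square \<open>T\<close>,
  hence with the constructed root, which commutes with everything that commutes with
  \<open>T\<close>. Uniqueness then identifies the two, and the selected root inherits the
  commutation property.\<close>

lemma
  fixes E :: "'a::chilbert_space set"
  assumes E: "closed_csubspace E" and T: "bounded_clinear_on E E T" and sa: "selfadjoint_on E T"
    and contr: "\<And>x. x \<in> E \<Longrightarrow> norm (x - T x) \<le> norm x"
  shows positive_psqrt_on: "positive_on E (psqrt_on E T)"
    and psqrt_on_psqrt_on: "x \<in> E \<Longrightarrow> psqrt_on E T (psqrt_on E T x) = T x"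
    and psqrt_on_commute: "bounded_clinear_on E E C \<Longrightarrow> (\<And>x. x \<in> E \<Longrightarrow> C (T x) = T (C x)) \<Longrightarrow>
      x \<in> E \<Longrightarrow> C (psqrt_on E T x) = psqrt_on E T (C x)"
proof -
  note Es = closed_csubspaceD[OF E]
  obtain R where R: "positive_on E R" "\<And>x. x \<in> E \<Longrightarrow> R (R x) = T x"
    and comm: "\<And>C. bounded_clinear_on E E C \<Longrightarrow> \<forall>x\<in>E. C (T x) = T (C x) \<Longrightarrow> \<forall>x\<in>E. C (R x) = R (C x)"
    using positive_sqrt_exists[OF assms] by blast
  let ?S = "psqrt_on E T"
  have "positive_on E ?S \<and> (\<forall>x\<in>E. ?S (?S x) = T x)"
    using someI[of "\<lambda>R. bounded_clinear_on E E R \<and> (\<forall>x\<in>E. cinner (R x) x \<in> \<real>\<^sub>\<ge>\<^sub>0) \<and>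
        (\<forall>x\<in>E. R (R x) = T x)" R] R
    unfolding psqrt_on_def positive_on_def by blast
  then have S: "positive_on E ?S" "\<And>x. x \<in> E \<Longrightarrow> ?S (?S x) = T x"
    by auto
  have bS: "bounded_clinear_on E E ?S"
    using S(1) by (simp add: positive_on_def)
  have "?S (T x) = T (?S x)" if "x \<in> E" for x
    using S(2)[OF that] S(2)[OF bounded_clinear_onD(1)[OF bS that]] by simp
  then have "\<forall>x\<in>E. ?S (R x) = R (?S x)"
    by (intro comm[OF bS]) auto
  then have eq: "?S x = R x" if "x \<in> E" for x
    by (intro positive_sqrt_unique[OF Es(1) S(1) R(1) _ _ that]) (simp_all add: S(2) R(2))
  show "positive_on E ?S" "x \<in> E \<Longrightarrow> ?S (?S x) = T x"
    by (fact S)+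
  show "C (?S x) = ?S (C x)"
    if C: "bounded_clinear_on E E C" "\<And>x. x \<in> E \<Longrightarrow> C (T x) = T (C x)" and x: "x \<in> E"
    using comm[OF C(1)] C(2) x eq[OF x] eq[OF bounded_clinear_onD(1)[OF C(1) x]] by simp
qed

section \<open>Asymptotic limits of contractions\<close>

lemma bounded_clinear_funpow: "bounded_clinear_on E E T \<Longrightarrow> bounded_clinear_on E E (T ^^ k)"
proof (induction k)
  case 0
  then show ?case
    using bounded_clinear_on_ident[of E E] by (simp add: id_def)
next
  case (Suc k)
  then show ?case
    using bounded_clinear_on_compose[of E E T E "T ^^ k"] by (simp add: o_def)
qed

lemma norm_funpow_le:
  fixes T :: "'a::real_normed_vector \<Rightarrow> 'a"
  assumes "\<And>x. norm (T x) \<le> norm x"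
  shows "norm ((T ^^ k) x) \<le> norm x"
proof (induction k)
  case (Suc k)
  then show ?case
    using assms[of "(T ^^ k) x"] by simp
qed simp

lemma bounded_clinear_UNIV:
  assumes "bounded_clinear T"
  shows "T (x + y) = T x + T y" "T (x - y) = T x - T y" "T (c *\<^sub>C x) = c *\<^sub>C T x" "T 0 = 0"
  using bounded_clinear_onD[OF assms] bounded_clinear_on_diff[OF assms] bounded_clinear_on_0[OF assms]
  by auto

lemma bounded_clinear_tendsto:
  assumes "bounded_clinear T" "(f \<longlongrightarrow> x) G"
  shows "((\<lambda>n. T (f n)) \<longlongrightarrow> T x) G"
  using bounded_clinear_on_tendsto[OF assms(1)] assms(2) by simp

lemma norm_sq_diff_le_of_contraction:
  assumes "Re (cinner y x) = r" "(norm y)\<^sup>2 \<le> r"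
  shows "(norm (x - y))\<^sup>2 \<le> (norm x)\<^sup>2 - r"
proof -
  have "Re (cinner x y) = r"
    using assms(1) cinner_commute[of x y] by simp
  then show ?thesis
    using assms(2) by (simp add: norm_diff_sq)
qed

text \<open>Below \<open>Pa\<close> and \<open>Va\<close> are the adjoints of \<open>P\<close> and \<open>V\<close>, \<open>A\<close> and \<open>Aa\<close> are the strong limits \<open>\<A>\<close>
  and \<open>\<A>\<^sub>*\<close>, and \<open>R\<close> is the square root of \<open>\<A>\<close>.\<close>

locale contraction =
  fixes P :: "'a::chilbert_space \<Rightarrow> 'a"
  assumes bounded_clinear_P: "bounded_clinear P" and norm_P_le: "norm (P x) \<le> norm x"
begin

abbreviation "Pa \<equiv> cadjoint P"
abbreviation "A \<equiv> asymptotic_op P"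
abbreviation "R \<equiv> asymptotic_sqrt P"
abbreviation "E \<equiv> asymptotic_space P"
abbreviation "D \<equiv> defect_op P"
abbreviation "DS \<equiv> defect_space P"

lemma bounded_clinear_Pa: "bounded_clinear Pa"
  by (simp add: bounded_clinear_cadjoint_on' bounded_clinear_P)

lemma norm_Pa_le: "norm (Pa x) \<le> norm x"
  using bounded_clinear_cadjoint_on(2)[OF closed_csubspace_UNIV bounded_clinear_P, of 1 x] norm_P_le
  by simp

lemma cinner_Pa: "cinner x (Pa y) = cinner (P x) y"
  by (simp add: cinner_cadjoint_on bounded_clinear_P)

lemma cinner_Pa_left: "cinner (Pa x) y = cinner x (P y)"
  by (simp add: cinner_cadjoint_on_left bounded_clinear_P)

lemma cadjoint_Pa: "cadjoint Pa = P"
  by (rule cadjoint_cadjoint[OF bounded_clinear_P])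

lemma contraction_Pa: "contraction Pa"
  by unfold_locales (fact bounded_clinear_Pa norm_Pa_le)+

lemma bounded_clinear_P_pow: "bounded_clinear (P ^^ k)"
  by (rule bounded_clinear_funpow[OF bounded_clinear_P])

lemma norm_P_pow_le: "norm ((P ^^ k) x) \<le> norm x"
  by (rule norm_funpow_le[OF norm_P_le])

lemma bounded_clinear_Pa_pow: "bounded_clinear (Pa ^^ k)"
  by (rule bounded_clinear_funpow[OF bounded_clinear_Pa])

lemma norm_Pa_pow_le: "norm ((Pa ^^ k) x) \<le> norm x"
  by (rule norm_funpow_le[OF norm_Pa_le])

lemma cinner_Pa_pow: "cinner x ((Pa ^^ k) y) = cinner ((P ^^ k) x) y"
  by (induction k arbitrary: x y) (simp_all add: cinner_Pa funpow_swap1)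

lemma cinner_Pa_pow_left: "cinner ((Pa ^^ k) x) y = cinner x ((P ^^ k) y)"
  using cinner_Pa_pow[of y k x] cinner_commute by metis

lemma bounded_clinear_PaP_pow: "bounded_clinear (\<lambda>x. (Pa ^^ k) ((P ^^ k) x))"
  by (rule bounded_clinear_on_compose[OF bounded_clinear_Pa_pow bounded_clinear_P_pow])

text \<open>Quantifies that a vector whose norm is nearly preserved by \<open>P ^^ k\<close> is
  nearly fixed by \<open>Pa ^^ k\<close> after \<open>P ^^ k\<close>. Both the convergence to
  \<open>A\<close> and the study of its fixed vectors rest on it.\<close>

lemma norm_minus_PaP_pow_le: "(norm (x - (Pa ^^ k) ((P ^^ k) x)))\<^sup>2 \<le> (norm x)\<^sup>2 - (norm ((P ^^ k) x))\<^sup>2"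
proof (rule norm_sq_diff_le_of_contraction)
  show "Re (cinner ((Pa ^^ k) ((P ^^ k) x)) x) = (norm ((P ^^ k) x))\<^sup>2"
    by (simp add: cinner_Pa_pow_left Re_cinner_self)
  show "(norm ((Pa ^^ k) ((P ^^ k) x)))\<^sup>2 \<le> (norm ((P ^^ k) x))\<^sup>2"
    using norm_Pa_pow_le by (simp add: power_mono)
qed

section \<open>The defect operator\<close>

lemma
  shows positive_D: "positive_on UNIV D"
    and D_D: "D (D x) = x - Pa (P x)"
    and D_commute: "bounded_clinear C \<Longrightarrow> (\<And>x. C (Pa (P x)) = Pa (P (C x))) \<Longrightarrow> C (D x) = D (C x)"
proof -
  let ?T = "\<lambda>x. x - Pa (P x)"
  have bT: "bounded_clinear ?T"
    by (intro bounded_clinear_on_minus bounded_clinear_on_ident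
        bounded_clinear_on_compose[OF bounded_clinear_Pa bounded_clinear_P]) auto
  have sT: "selfadjoint_on UNIV ?T"
    by (simp add: selfadjoint_on_def cinner.diff_left cinner.diff_right cinner_Pa cinner_Pa_left)
  have cT: "norm (x - ?T x) \<le> norm x" for x
    using norm_Pa_le norm_P_le order_trans by fastforce
  note * = closed_csubspace_UNIV bT sT cT
  show "positive_on UNIV D"
    unfolding defect_op_def by (rule positive_psqrt_on[OF *])
  show "D (D x) = x - Pa (P x)"
    unfolding defect_op_def by (rule psqrt_on_psqrt_on[OF * UNIV_I])
  show "C (D x) = D (C x)" if "bounded_clinear C" "\<And>x. C (Pa (P x)) = Pa (P (C x))"
    unfolding defect_op_def
    by (rule psqrt_on_commute[OF *]) (use that in \<open>simp_all add: bounded_clinear_UNIV\<close>)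
qed

lemma bounded_clinear_D: "bounded_clinear D"
  using positive_D by (simp add: positive_on_def)

lemmas D_linear = bounded_clinear_UNIV[OF bounded_clinear_D]

lemma cinner_D: "cinner (D x) y = cinner x (D y)"
  using positive_on_selfadjoint[OF _ positive_D] by (simp add: selfadjoint_on_def)

lemma norm_D_sq: "(norm (D x))\<^sup>2 = (norm x)\<^sup>2 - (norm (P x))\<^sup>2"
proof -
  have "(norm (D x))\<^sup>2 = Re (cinner (D (D x)) x)"
    by (simp only: cinner_D[of "D x" x] Re_cinner_self)
  then show ?thesis
    by (simp add: D_D cinner.diff_left cinner_Pa_left Re_cinner_self)
qed

lemma closed_csubspace_DS: "closed_csubspace DS"
  unfolding defect_space_def
  by (rule closed_csubspace_closure[OF csubspace_image[OF bounded_clinear_D]]) simp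

lemma D_in: "D x \<in> DS"
  unfolding defect_space_def by (rule subsetD[OF closure_subset]) simp

text \<open>The kernel of the self-adjoint \<open>D\<close> is orthogonal to its range, which is
  dense in the defect space.\<close>

lemma D_inj_on_DS: "v \<in> defect_space P \<Longrightarrow> D v = 0 \<Longrightarrow> v = 0"
  unfolding defect_space_def by (erule orthogonal_to_dense_eq_0) (auto simp: cinner_D)

lemma defect_space_eqI:
  assumes "v \<in> DS" "w \<in> DS" "D v = D w"
  shows "v = w"
  using D_inj_on_DS[of "v - w"] assms closed_csubspaceD(5)[OF closed_csubspace_DS]
  by (simp add: D_linear)

section \<open>The strong limit \<open>A\<close>, its square root and operators commuting with
  them\<close>

lemma decseq_norm_P_pow: "decseq (\<lambda>k. (norm ((P ^^ k) x))\<^sup>2)"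
  unfolding decseq_Suc_iff using norm_P_le by (simp add: power_mono)

text \<open>The squared distance between two terms is at most the drop of
  \<open>(norm ((P ^^ k) x))\<^sup>2\<close> between the two indices. That sequence decreases and is
  bounded, so it is Cauchy.\<close>

lemma tendsto_A: "(\<lambda>k. (Pa ^^ k) ((P ^^ k) x)) \<longlonglongrightarrow> A x"
proof -
  let ?T = "\<lambda>k. (Pa ^^ k) ((P ^^ k) x)" and ?a = "\<lambda>k. (norm ((P ^^ k) x))\<^sup>2"
  have le: "(norm (?T m - ?T n))\<^sup>2 \<le> ?a m - ?a n" if mn: "m \<le> n" for m n
  proof -
    obtain j where n: "n = m + j"
      using mn le_Suc_ex by blast
    have pow: "(P ^^ (m + j)) x = (P ^^ j) ((P ^^ m) x)"
      by (subst add.commute) (simp add: funpow_add)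
    have "?T m - ?T n = (Pa ^^ m) ((P ^^ m) x - (Pa ^^ j) ((P ^^ j) ((P ^^ m) x)))"
      by (simp add: n pow funpow_add[of m j Pa] bounded_clinear_UNIV[OF bounded_clinear_Pa_pow])
    then have "(norm (?T m - ?T n))\<^sup>2 \<le> (norm ((P ^^ m) x - (Pa ^^ j) ((P ^^ j) ((P ^^ m) x))))\<^sup>2"
      using norm_Pa_pow_le by (simp add: power_mono)
    also have "\<dots> \<le> (norm ((P ^^ m) x))\<^sup>2 - (norm ((P ^^ j) ((P ^^ m) x)))\<^sup>2"
      by (rule norm_minus_PaP_pow_le)
    also have "\<dots> = ?a m - ?a n"
      by (simp add: n pow)
    finally show ?thesis .
  qed
  have "convergent ?a"
    by (rule Bseq_monoseq_convergent)
      (use decseq_norm_P_pow decseq_bounded[OF decseq_norm_P_pow, of 0] in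
        \<open>auto simp: monoseq_iff\<close>)
  then have "Cauchy ?a"
    by (rule convergent_Cauchy)
  have "Cauchy ?T"
  proof (rule CauchyI')
    fix e :: real assume "e > 0"
    then obtain M where M: "\<And>m n. m \<ge> M \<Longrightarrow> n \<ge> M \<Longrightarrow> norm (?a m - ?a n) < e\<^sup>2"
      using CauchyD[OF \<open>Cauchy ?a\<close>, of "e\<^sup>2"] by auto
    have "dist (?T m) (?T n) < e" if "m \<ge> M" "n > m" for m n
    proof -
      have "(norm (?T m - ?T n))\<^sup>2 < e\<^sup>2"
        using le[of m n] M[of m n] that by simp
      then show ?thesis
        using \<open>e > 0\<close> power_less_imp_less_base by (fastforce simp: dist_norm)
    qed
    then show "\<exists>M. \<forall>m\<ge>M. \<forall>n>m. dist (?T m) (?T n) < e"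
      by blast
  qed
  then show ?thesis
    unfolding asymptotic_op_def by (simp add: Cauchy_convergent flip: convergent_LIMSEQ_iff)
qed

lemma bounded_clinear_A: "bounded_clinear A"
proof (rule bounded_clinear_onI[where K = 1])
  fix x y c
  show "A (x + y) = A x + A y"
    using tendsto_add[OF tendsto_A[of x] tendsto_A[of y]] tendsto_A[of "x + y"] LIMSEQ_unique
    by (simp add: bounded_clinear_UNIV[OF bounded_clinear_PaP_pow])
  show "A (c *\<^sub>C x) = c *\<^sub>C A x"
    using scaleC.tendsto[OF tendsto_const tendsto_A[of x], of c] tendsto_A[of "c *\<^sub>C x"] LIMSEQ_unique
    by (simp add: bounded_clinear_UNIV[OF bounded_clinear_PaP_pow])
  show "norm (A x) \<le> 1 * norm x"
    using order_trans[OF norm_Pa_pow_le norm_P_pow_le]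
    by (intro LIMSEQ_le_const2[OF tendsto_norm[OF tendsto_A]]) auto
qed simp

lemma cinner_A: "cinner (A x) y = cinner x (A y)"
proof (rule LIMSEQ_unique)
  show "(\<lambda>k. cinner ((Pa ^^ k) ((P ^^ k) x)) y) \<longlonglongrightarrow> cinner (A x) y"
    by (intro cinner.tendsto tendsto_A tendsto_const)
  show "(\<lambda>k. cinner ((Pa ^^ k) ((P ^^ k) x)) y) \<longlonglongrightarrow> cinner x (A y)"
    using cinner.tendsto[OF tendsto_const tendsto_A[of y], of x]
    by (simp add: cinner_Pa_pow cinner_Pa_pow_left)
qed

lemma tendsto_norm_P_pow: "(\<lambda>k. (norm ((P ^^ k) x))\<^sup>2) \<longlonglongrightarrow> Re (cinner (A x) x)"
proof -
  have "(\<lambda>k. Re (cinner ((Pa ^^ k) ((P ^^ k) x)) x)) \<longlonglongrightarrow> Re (cinner (A x) x)"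
    by (intro tendsto_Re cinner.tendsto tendsto_A tendsto_const)
  then show ?thesis
    by (simp add: cinner_Pa_pow_left Re_cinner_self)
qed

lemma norm_minus_A_le: "(norm (x - A x))\<^sup>2 \<le> (norm x)\<^sup>2 - Re (cinner (A x) x)"
proof (rule LIMSEQ_le)
  show "(\<lambda>k. (norm (x - (Pa ^^ k) ((P ^^ k) x)))\<^sup>2) \<longlonglongrightarrow> (norm (x - A x))\<^sup>2"
    by (intro tendsto_intros tendsto_A)
  show "(\<lambda>k. (norm x)\<^sup>2 - (norm ((P ^^ k) x))\<^sup>2) \<longlonglongrightarrow> (norm x)\<^sup>2 - Re (cinner (A x) x)"
    by (intro tendsto_intros tendsto_norm_P_pow)
qed (use norm_minus_PaP_pow_le in blast)

lemma Re_cinner_A_nonneg: "0 \<le> Re (cinner (A x) x)"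
  by (rule LIMSEQ_le_const[OF tendsto_norm_P_pow]) auto

lemma Pa_A_P: "Pa (A (P x)) = A x"
proof (rule LIMSEQ_unique)
  show "(\<lambda>k. (Pa ^^ Suc k) ((P ^^ Suc k) x)) \<longlonglongrightarrow> A x"
    by (rule LIMSEQ_Suc[OF tendsto_A])
  have "(\<lambda>k. Pa ((Pa ^^ k) ((P ^^ k) (P x)))) \<longlonglongrightarrow> Pa (A (P x))"
    by (rule bounded_clinear_tendsto[OF bounded_clinear_Pa tendsto_A])
  then show "(\<lambda>k. (Pa ^^ Suc k) ((P ^^ Suc k) x)) \<longlonglongrightarrow> Pa (A (P x))"
    by (simp add: funpow_swap1)
qed

text \<open>The operators \<open>S i\<close> will be shown to lie here; membership carries them
  through limits, square roots and density arguments.\<close>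

definition commutant :: "('a \<Rightarrow> 'a) set" where
  "commutant = {C. bounded_clinear C \<and> (\<forall>x. C (P x) = P (C x)) \<and> (\<forall>x. C (Pa x) = Pa (C x))}"

lemma commutantD:
  assumes "C \<in> commutant"
  shows "bounded_clinear C" "C (P x) = P (C x)" "C (Pa x) = Pa (C x)"
    "C ((P ^^ k) x) = (P ^^ k) (C x)" "C ((Pa ^^ k) x) = (Pa ^^ k) (C x)"
proof -
  show *: "bounded_clinear C" "C (P x) = P (C x)" "C (Pa x) = Pa (C x)" for x
    using assms by (auto simp: commutant_def)
  show "C ((P ^^ k) x) = (P ^^ k) (C x)" "C ((Pa ^^ k) x) = (Pa ^^ k) (C x)"
    by (induction k) (simp_all add: *)
qed

lemma cinner_cadjoint: "bounded_clinear C \<Longrightarrow> cinner x (cadjoint C y) = cinner (C x) y"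
  for C :: "'a \<Rightarrow> 'a"
  by (simp add: cinner_cadjoint_on)

lemma cinner_ext: "(\<And>z. cinner z x = cinner z y) \<Longrightarrow> x = (y :: 'a)"
  using cinner_eq_imp_eq_on[of UNIV x y] by simp

lemma commutant_cadjoint:
  assumes C: "C \<in> commutant"
  shows "cadjoint C \<in> commutant"
proof -
  note Cs = commutantD[OF C]
  have "cadjoint C (P x) = P (cadjoint C x)" for x
    by (rule cinner_ext) (metis Cs(1,3) cinner_cadjoint cinner_Pa_left)
  moreover have "cadjoint C (Pa x) = Pa (cadjoint C x)" for x
    by (rule cinner_ext) (metis Cs(1,2) cinner_cadjoint cinner_Pa)
  ultimately show ?thesis
    by (simp add: commutant_def bounded_clinear_cadjoint_on' Cs(1))
qed

lemma A_commute:
  assumes C: "C \<in> commutant"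
  shows "C (A x) = A (C x)"
proof (rule LIMSEQ_unique)
  note Cs = commutantD[OF C]
  show "(\<lambda>k. C ((Pa ^^ k) ((P ^^ k) x))) \<longlonglongrightarrow> C (A x)"
    by (rule bounded_clinear_tendsto[OF Cs(1) tendsto_A])
  show "(\<lambda>k. C ((Pa ^^ k) ((P ^^ k) x))) \<longlonglongrightarrow> A (C x)"
    using tendsto_A[of "C x"] by (simp add: Cs)
qed

lemma norm_minus_A_le1: "norm (x - A x) \<le> norm x"
proof (rule power2_le_imp_le)
  show "(norm (x - A x))\<^sup>2 \<le> (norm x)\<^sup>2"
    using norm_minus_A_le[of x] Re_cinner_A_nonneg[of x] by linarith
qed simp

lemma selfadjoint_A: "selfadjoint_on UNIV A"
  by (simp add: selfadjoint_on_def cinner_A)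

lemmas A_sqrt_hyps = closed_csubspace_UNIV bounded_clinear_A selfadjoint_A norm_minus_A_le1

lemma positive_R: "positive_on UNIV R"
  by (rule positive_psqrt_on[OF A_sqrt_hyps])

lemma R_R: "R (R x) = A x"
  by (rule psqrt_on_psqrt_on[OF A_sqrt_hyps UNIV_I])

lemma R_commute: "C \<in> commutant \<Longrightarrow> C (R x) = R (C x)"
  by (rule psqrt_on_commute[OF A_sqrt_hyps _ _ UNIV_I]) (auto simp: commutantD A_commute)

lemma bounded_clinear_R: "bounded_clinear R"
  using positive_R by (simp add: positive_on_def)

lemmas R_linear = bounded_clinear_UNIV[OF bounded_clinear_R]

lemma cinner_R: "cinner (R x) y = cinner x (R y)"
  using positive_on_selfadjoint[OF _ positive_R] by (simp add: selfadjoint_on_def)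

lemma norm_R_sq: "(norm (R x))\<^sup>2 = Re (cinner (A x) x)"
  using cinner_R[of "R x" x] by (simp add: R_R Re_cinner_self)

lemma tendsto_norm_P_pow_R: "(\<lambda>k. (norm ((P ^^ k) x))\<^sup>2) \<longlonglongrightarrow> (norm (R x))\<^sup>2"
  using tendsto_norm_P_pow by (simp add: norm_R_sq)

lemma norm_R_le: "norm (R x) \<le> norm x"
proof (rule power2_le_imp_le)
  show "(norm (R x))\<^sup>2 \<le> (norm x)\<^sup>2"
    by (rule LIMSEQ_le_const2[OF tendsto_norm_P_pow_R]) (use norm_P_pow_le power_mono in auto)
qed simp

lemma norm_R_P: "norm (R (P x)) = norm (R x)"
proof -
  have "(norm (R (P x)))\<^sup>2 = Re (cinner (Pa (A (P x))) x)"
    by (simp add: norm_R_sq cinner_Pa_left)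
  then show ?thesis
    by (simp add: Pa_A_P norm_R_sq[symmetric])
qed

lemma norm_R_eq_iff: "norm (R x) = norm x \<longleftrightarrow> A x = x"
proof
  assume "norm (R x) = norm x"
  then have "Re (cinner (A x) x) = (norm x)\<^sup>2"
    by (simp flip: norm_R_sq)
  then show "A x = x"
    using norm_minus_A_le[of x] by simp
next
  assume "A x = x"
  then have "(norm (R x))\<^sup>2 = (norm x)\<^sup>2"
    by (simp add: norm_R_sq Re_cinner_self)
  then show "norm (R x) = norm x"
    by simp
qed

text \<open>\<open>R + I\<close> annihilates \<open>R x - x\<close>, and it is injective because
  \<open>R\<close> is positive.\<close>

lemma A_fixed_imp_R_fixed:
  assumes "A x = x"
  shows "R x = x"
proof -
  let ?w = "R x - x"
  have "R ?w + ?w = 0"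
    using assms by (simp add: R_linear R_R)
  then have "cinner (R ?w) ?w + cinner ?w ?w = 0"
    by (metis cinner.add_left cinner.zero_left)
  then have "Re (cinner (R ?w) ?w) + (norm ?w)\<^sup>2 = 0"
    by (metis Re_cinner_self plus_complex.simps(1) zero_complex.simps(1))
  moreover have "0 \<le> Re (cinner (R ?w) ?w)"
    using positive_R by (simp add: positive_on_def complex_nonneg_Reals_iff)
  ultimately have "(norm ?w)\<^sup>2 = 0"
    by (smt (verit) zero_le_power2)
  then show ?thesis by simp
qed

lemma norm_P_eq_imp: "norm (P x) = norm x \<Longrightarrow> Pa (P x) = x"
  using norm_minus_PaP_pow_le[of x 1] by simp

text \<open>All of \<open>norm u = norm (R u) = norm (R (P u)) \<le> norm (P u) \<le> norm u\<close>
  are equalities; each equality case identifies a fixed vector.\<close>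

lemma A_fixed_P:
  assumes "A u = u"
  shows "A (P u) = P u" "norm (P u) = norm u" "Pa (P u) = u"
proof -
  have 1: "norm (R (P u)) = norm u"
    using assms norm_R_P norm_R_eq_iff by metis
  show 2: "norm (P u) = norm u"
    using norm_R_le[of "P u"] norm_P_le[of u] 1 by simp
  show "A (P u) = P u"
    using 1 2 norm_R_eq_iff by metis
  show "Pa (P u) = u"
    using 2 by (rule norm_P_eq_imp)
qed

end

section \<open>The consequence of complete non-unitarity\<close>

locale cnu_contraction = contraction +
  assumes cnu: "cnu P"
begin

interpretation adj: contraction Pa
  by (rule contraction_Pa)

text \<open>The vectors fixed by both strong limits form a reducing subspace on which
  \<open>P\<close> is isometric and onto, so complete non-unitarity forces this subspace to be
  trivial.\<close>

lemma cnu_fixed_zero: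
  assumes "A u = u" "asymptotic_op Pa u = u"
  shows "u = 0"
proof -
  let ?B = "asymptotic_op Pa"
  define M where "M = {u. A u = u \<and> ?B u = u}"
  have P_M: "P u \<in> M" if "u \<in> M" for u
  proof -
    have u: "A u = u" "?B u = u"
      using that by (auto simp: M_def)
    \<comment> \<open>The invariance \<open>P ?B Pa = ?B\<close> of the other strong limit, read at
      \<open>P u\<close>; since \<open>Pa (P u) = u\<close>, it shows that \<open>P u\<close> is
      again fixed by \<open>?B\<close>.\<close>
    have "?B (P u) = P (?B (Pa (P u)))"
      using adj.Pa_A_P[of "P u"] by (simp add: cadjoint_Pa)
    then show ?thesis
      using A_fixed_P[OF u(1)] u by (simp add: M_def)
  qed
  have Pa_M: "Pa u \<in> M" if "u \<in> M" for u
  proof -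
    have u: "A u = u" "?B u = u"
      using that by (auto simp: M_def)
    have "A (Pa u) = Pa (A (P (Pa u)))"
      using Pa_A_P[of "Pa u"] by simp
    then show ?thesis
      using adj.A_fixed_P[OF u(2)] u by (simp add: M_def cadjoint_Pa)
  qed
  have "reducing P M"
    unfolding reducing_def
  proof (intro conjI)
    have "bounded_linear A" "bounded_linear ?B"
      by (simp_all add: bounded_clinear_imp_bounded_linear bounded_clinear_A adj.bounded_clinear_A)
    then have "closed {u. A u = u}" "closed {u. ?B u = u}"
      by (auto intro!: closed_Collect_eq linear_continuous_on continuous_intros)
    then show "closed M"
      unfolding M_def Collect_conj_eq by (rule closed_Int)
    show "complex_vector.subspace M"
      by (rule complex_vector.subspaceI)
        (auto simp: M_def bounded_clinear_UNIV[OF bounded_clinear_A]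
          bounded_clinear_UNIV[OF adj.bounded_clinear_A])
  qed (use P_M Pa_M in auto)
  moreover have "unitary_on M P"
    unfolding unitary_on_def
  proof (intro conjI ballI)
    show "norm (P x) = norm x" if "x \<in> M" for x
      using that A_fixed_P(2) by (auto simp: M_def)
    show "P ` M = M"
    proof
      show "M \<subseteq> P ` M"
      proof
        fix u assume u: "u \<in> M"
        then have "P (Pa u) = u"
          using adj.A_fixed_P(3)[of u] by (simp add: M_def cadjoint_Pa)
        then show "u \<in> P ` M"
          using Pa_M[OF u] by force
      qed
    qed (use P_M in auto)
  qed
  ultimately have "M = {0}"
    using cnu by (auto simp: cnu_def)
  then show ?thesis
    using assms by (auto simp: M_def)
qed

end

section \<open>Durszt's isometry \<open>V\<close> and the operator \<open>Q\<close>\<close>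

context contraction
begin

lemma csubspace_range_R: "complex_vector.subspace (range R)"
  by (rule csubspace_image[OF bounded_clinear_R]) simp

lemma closed_csubspace_E: "closed_csubspace E"
  unfolding asymptotic_space_def
  by (rule closed_csubspace_closure[OF csubspace_image[OF bounded_clinear_A]]) simp

text \<open>The space is defined by the range of \<open>A\<close>, whereas \<open>V\<close> is
  prescribed on the range of \<open>R\<close>. A vector orthogonal to the range of \<open>A\<close>
  satisfies \<open>cinner (A y) y = 0\<close>, hence \<open>R y = 0\<close>, and so is orthogonal to
  the range of \<open>R\<close>.\<close>

lemma closure_range_R: "closure (range R) = E"
  unfolding asymptotic_space_def
proof (rule closure_eq_if_orthogonal_zero[symmetric])
  show "closed_csubspace (closure (range R))"
    by (rule closed_csubspace_closure[OF csubspace_range_R])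
  show "complex_vector.subspace (range A)"
    by (rule csubspace_image[OF bounded_clinear_A]) simp
  have "range A \<subseteq> range R"
    using R_R by (metis image_subsetI rangeI)
  then show "range A \<subseteq> closure (range R)"
    using closure_subset by blast
  fix y assume y: "y \<in> closure (range R)" and orth: "\<And>x. x \<in> range A \<Longrightarrow> cinner x y = 0"
  have "cinner (A y) y = 0"
    using orth by blast
  then have "R y = 0"
    using norm_R_sq[of y] by simp
  then show "y = 0"
    using y by (intro orthogonal_to_dense_eq_0[of y "range R"]) (auto simp: cinner_R)
qed

lemma R_in: "R x \<in> E"
  using closure_subset[of "range R"] by (auto simp: closure_range_R)

lemma csubspace_E: "complex_vector.subspace E"
  by (rule closed_csubspaceD(1)[OF closed_csubspace_E])

lemma eq_on_E:
  assumes T: "bounded_clinear_on E F T" and S: "bounded_clinear_on E G S"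
    and "\<And>h. T (R h) = S (R h)" and "x \<in> E"
  shows "T x = S x"
  by (rule bounded_clinear_on_eq_closure[OF T S csubspace_E, of "range R"])
    (use assms R_in in \<open>auto simp: closure_range_R\<close>)

lemma bounded_clinear_on_R: "bounded_clinear_on F E R"
  by (rule bounded_clinear_on_subset[OF bounded_clinear_R]) (simp_all add: R_in)

definition V :: "'a \<Rightarrow> 'a" where "V = durszt_V P"

definition Va :: "'a \<Rightarrow> 'a" where "Va = durszt_V_adj P"

text \<open>\<open>norm_R_P\<close> makes the assignment of \<open>R (P x)\<close> to
  \<open>R x\<close> well defined and isometric; it extends from the range of \<open>R\<close> to
  its closure \<open>E\<close>.\<close>

lemma bounded_clinear_V: "bounded_clinear_on E E V" and V_R: "V (R x) = R (P x)"
proof -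
  let ?G = "range (\<lambda>x. (R x, R (P x)))"
  have "complex_vector.subspace ?G"
  proof (rule csubspace_image[where F = UNIV])
    have "bounded_clinear (\<lambda>x. R (P x))"
      by (rule bounded_clinear_on_compose[OF bounded_clinear_R bounded_clinear_P])
    then show "bounded_clinear (\<lambda>x. (R x, R (P x)))"
      using norm_R_P
      by (intro bounded_clinear_onI[where K = 2])
        (auto simp: R_linear
          bounded_clinear_UNIV[OF bounded_clinear_P] scaleC_prod_def
          intro!: order_trans[OF norm_Pair_le] add_mono[of _ "norm x" _ "norm x" for x, simplified]
            norm_R_le)
  qed simp
  moreover have "norm y \<le> 1 * norm x" if "(x, y) \<in> ?G" for x y
    using that norm_R_P by auto
  ultimately obtain g where g: "bounded_clinear_on (closure (fst ` ?G)) (closure (snd ` ?G)) g"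
    and gR: "\<forall>(x, y)\<in>?G. g x = y"
    by (rule extension_from_graph)
  have "fst ` ?G = range R"
    by (auto simp: image_iff)
  then have fst: "closure (fst ` ?G) = E"
    by (simp add: closure_range_R)
  have "snd ` ?G \<subseteq> range R"
    by auto
  then have "closure (snd ` ?G) \<subseteq> E"
    using closure_mono[of "snd ` ?G" "range R"] by (simp add: closure_range_R)
  then have "bounded_clinear_on E E g"
    using g fst bounded_clinear_onD(1) by (intro bounded_clinear_on_subset[OF g]) blast+
  then have "bounded_clinear_on E E V \<and> (\<forall>x. V (R x) = R (P x))"
    unfolding V_def durszt_V_def using gR
    by (intro someI[of "\<lambda>V. bounded_clinear_on E E V \<and> (\<forall>x. V (R x) = R (P x))" g]) auto
  then show "bounded_clinear_on E E V" "V (R x) = R (P x)"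
    by auto
qed

lemma V_in: "x \<in> E \<Longrightarrow> V x \<in> E"
  by (rule bounded_clinear_onD(1)[OF bounded_clinear_V])

lemma bounded_clinear_Va: "bounded_clinear_on E E Va"
  unfolding Va_def V_def[symmetric]
  by (rule bounded_clinear_cadjoint_on'[OF closed_csubspace_E bounded_clinear_V])

lemma Va_in: "x \<in> E \<Longrightarrow> Va x \<in> E"
  by (rule bounded_clinear_onD(1)[OF bounded_clinear_Va])

lemma cinner_Va: "x \<in> E \<Longrightarrow> y \<in> E \<Longrightarrow> cinner x (Va y) = cinner (V x) y"
  unfolding Va_def V_def[symmetric]
  by (rule cinner_cadjoint_on[OF closed_csubspace_E bounded_clinear_V])

lemma cinner_ext_E: "x \<in> E \<Longrightarrow> y \<in> E \<Longrightarrow> (\<And>z. z \<in> E \<Longrightarrow> cinner z x = cinner z y) \<Longrightarrow> x = y"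
  by (rule cinner_eq_imp_eq_on[OF csubspace_E])

lemma bounded_clinear_on_E:
  "bounded_clinear C \<Longrightarrow> (\<And>x. x \<in> E \<Longrightarrow> C x \<in> E) \<Longrightarrow> bounded_clinear_on E E C"
  by (rule bounded_clinear_on_subset) auto

lemma bounded_clinear_on_E_UNIV: "bounded_clinear C \<Longrightarrow> bounded_clinear_on E UNIV C"
  by (rule bounded_clinear_on_subset) auto

lemma bounded_clinear_V_UNIV: "bounded_clinear_on E UNIV V"
  by (rule bounded_clinear_on_subset[OF bounded_clinear_V]) auto

text \<open>On the dense set of vectors \<open>R h\<close> this is
  \<open>Pa (A (P h)) = A h\<close>.\<close>

lemma Pa_R_V:
  assumes "x \<in> E"
  shows "Pa (R (V x)) = R x"
proof (rule eq_on_E[OF _ _ _ assms])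
  show "bounded_clinear_on E UNIV (\<lambda>x. Pa (R (V x)))"
    by (intro bounded_clinear_on_compose[OF bounded_clinear_Pa]
        bounded_clinear_on_compose[OF bounded_clinear_R bounded_clinear_V_UNIV])
  show "bounded_clinear_on E UNIV R"
    by (rule bounded_clinear_on_E_UNIV[OF bounded_clinear_R])
qed (simp add: V_R R_R Pa_A_P)

lemma R_Va:
  assumes "x \<in> E"
  shows "R (Va x) = Pa (R x)"
proof (rule cinner_ext)
  fix z
  have "cinner z (R (Va x)) = cinner (V (R z)) x"
    using assms R_in by (simp add: cinner_Va flip: cinner_R)
  also have "\<dots> = cinner z (Pa (R x))"
    by (simp add: V_R cinner_Pa cinner_R)
  finally show "cinner z (R (Va x)) = cinner z (Pa (R x))" .
qed

text \<open>\<open>R (Va (V x)) = Pa (R (V x)) = R x\<close>, and \<open>R\<close> is injective on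
  the closure of its range.\<close>

lemma Va_V:
  assumes "x \<in> E"
  shows "Va (V x) = x"
proof -
  have "Va (V x) - x \<in> E"
    using assms closed_csubspaceD(5)[OF closed_csubspace_E] Va_in V_in by blast
  moreover have "R (Va (V x) - x) = 0"
    using assms by (simp add: R_Va V_in Pa_R_V R_linear)
  ultimately have "Va (V x) - x = 0"
    unfolding closure_range_R[symmetric] by (elim orthogonal_to_dense_eq_0) (auto simp: cinner_R)
  then show ?thesis by simp
qed

lemma norm_V:
  assumes "x \<in> E"
  shows "norm (V x) = norm x"
proof -
  have "cinner (V x) (V x) = cinner x x"
    using cinner_Va[OF assms V_in[OF assms]] Va_V[OF assms] by simp
  then have "(norm (V x))\<^sup>2 = (norm x)\<^sup>2"
    by (metis Re_cinner_self)
  then show ?thesis by simp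
qed

lemma commutant_E: "C \<in> commutant \<Longrightarrow> x \<in> E \<Longrightarrow> C x \<in> E"
  unfolding closure_range_R[symmetric]
  by (rule bounded_clinear_on_image_closure) (auto simp: R_commute commutantD)

lemma V_commute:
  assumes C: "C \<in> commutant" and x: "x \<in> E"
  shows "C (V x) = V (C x)"
proof (rule eq_on_E[OF _ _ _ x])
  show "bounded_clinear_on E UNIV (\<lambda>x. C (V x))"
    by (intro bounded_clinear_on_compose[OF commutantD(1)[OF C]] bounded_clinear_V_UNIV)
  show "bounded_clinear_on E E (\<lambda>x. V (C x))"
    by (intro bounded_clinear_on_compose[OF bounded_clinear_V]
        bounded_clinear_on_E commutantD(1)[OF C] commutant_E[OF C])
qed (simp add: R_commute[OF C] V_R commutantD[OF C])

text \<open>The adjoint form of \<open>V_commute\<close> for \<open>cadjoint C\<close>, which lies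
  in the commutant too.\<close>

lemma Va_commute:
  assumes C: "C \<in> commutant" and x: "x \<in> E"
  shows "C (Va x) = Va (C x)"
proof (rule cinner_ext_E)
  note C' = commutant_cadjoint[OF C]
  note cC = cinner_cadjoint[OF commutantD(1)[OF C]]
  have cC': "cinner z (C y) = cinner (cadjoint C z) y" for y z
    using cC[of y z] cinner_commute by metis
  fix z assume z: "z \<in> E"
  have "cinner z (C (Va x)) = cinner (V (cadjoint C z)) x"
    using z x commutant_E[OF C'] by (simp add: cC' cinner_Va)
  also have "\<dots> = cinner (V z) (C x)"
    using V_commute[OF C' z] by (simp add: cC')
  also have "\<dots> = cinner z (Va (C x))"
    using z x commutant_E[OF C] by (simp add: cinner_Va)
  finally show "cinner z (C (Va x)) = cinner z (Va (C x))" .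
qed (use assms Va_in commutant_E in auto)

text \<open>\<open>A P\<^sup>n h - P\<^sup>n h\<close> tends to \<open>0\<close> because \<open>\<parallel>P\<^sup>n h\<parallel>\<close> converges to \<open>\<parallel>R h\<parallel> = \<parallel>R P\<^sup>n h\<parallel>\<close>.\<close>

lemma tendsto_norm_A_P_pow: "(\<lambda>n. norm (A ((P ^^ n) h))) \<longlonglongrightarrow> norm (R h)"
proof -
  let ?p = "\<lambda>n. (P ^^ n) h"
  have RP: "norm (R (?p n)) = norm (R h)" for n
    by (induction n) (simp_all add: norm_R_P)
  have "(\<lambda>n. (norm (?p n))\<^sup>2 - (norm (R h))\<^sup>2) \<longlonglongrightarrow> (norm (R h))\<^sup>2 - (norm (R h))\<^sup>2"
    by (intro tendsto_intros tendsto_norm_P_pow_R)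
  moreover have "(norm (?p n - A (?p n)))\<^sup>2 \<le> (norm (?p n))\<^sup>2 - (norm (R h))\<^sup>2" for n
    using norm_minus_A_le[of "?p n"] by (simp add: RP flip: norm_R_sq)
  ultimately have "(\<lambda>n. (norm (?p n - A (?p n)))\<^sup>2) \<longlonglongrightarrow> 0"
    by (intro Lim_null_comparison[of "\<lambda>n. (norm (?p n - A (?p n)))\<^sup>2"]) auto
  then have "(\<lambda>n. norm (?p n - A (?p n))) \<longlonglongrightarrow> 0"
    using tendsto_real_sqrt by fastforce
  moreover have "norm (norm (A (?p n)) - norm (?p n)) \<le> norm (?p n - A (?p n))" for n
    using norm_triangle_ineq3[of "A (?p n)" "?p n"] by (simp add: norm_minus_commute)
  ultimately have "(\<lambda>n. norm (A (?p n)) - norm (?p n)) \<longlonglongrightarrow> 0"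
    by (intro Lim_null_comparison[of "\<lambda>n. norm (A (?p n)) - norm (?p n)"]) auto
  moreover have "(\<lambda>n. norm (?p n)) \<longlonglongrightarrow> norm (R h)"
    using tendsto_real_sqrt[OF tendsto_norm_P_pow_R[of h]] by simp
  ultimately have "(\<lambda>n. norm (A (?p n)) - norm (?p n) + norm (?p n)) \<longlonglongrightarrow> 0 + norm (R h)"
    by (rule tendsto_add)
  then show ?thesis
    by simp
qed

lemma V_pow_in: "x \<in> E \<Longrightarrow> (V ^^ n) x \<in> E"
  by (induction n) (auto simp: V_in)

lemma Va_pow_in: "x \<in> E \<Longrightarrow> (Va ^^ n) x \<in> E"
  by (induction n) (auto simp: Va_in)

lemma V_pow_R: "(V ^^ n) (R h) = R ((P ^^ n) h)"
  by (induction n) (simp_all add: V_R)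

lemma norm_V_pow: "x \<in> E \<Longrightarrow> norm ((V ^^ n) x) = norm x"
  by (induction n) (simp_all add: V_pow_in norm_V)

lemma R_Va_pow: "x \<in> E \<Longrightarrow> R ((Va ^^ n) x) = (Pa ^^ n) (R x)"
  by (induction n) (simp_all add: R_Va Va_pow_in)

text \<open>For \<open>u = R h\<close> the terms are the norms of \<open>A ((P ^^ n) h)\<close>.
  Since \<open>R\<close> is a contraction and \<open>V\<close> an isometry, the limit extends to
  \<open>E\<close> by approximation. It is the limit of the orbit norms at plus infinity.\<close>

lemma tendsto_norm_R_V_pow:
  assumes u: "u \<in> E"
  shows "(\<lambda>n. norm (R ((V ^^ n) u))) \<longlonglongrightarrow> norm u"
proof (rule LIMSEQ_I)
  fix e :: real assume e: "e > 0"
  have "u \<in> closure (range R)"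
    using u closure_range_R by simp
  then have "\<exists>w\<in>range R. dist w u < e / 3"
    using e by (simp only: closure_approachable)
  then obtain h where h: "norm (R h - u) < e / 3"
    by (auto simp: dist_norm)
  obtain N where N: "\<And>n. n \<ge> N \<Longrightarrow> \<bar>norm (R ((V ^^ n) (R h))) - norm (R h)\<bar> < e / 3"
    using LIMSEQ_D[OF tendsto_norm_A_P_pow[of h], of "e / 3"] e by (auto simp: V_pow_R R_R)
  have "\<bar>norm (R ((V ^^ n) u)) - norm u\<bar> < e" if "n \<ge> N" for n
  proof -
    have "norm (R ((V ^^ n) (R h)) - R ((V ^^ n) u)) = norm (R ((V ^^ n) (R h - u)))"
      using bounded_clinear_on_diff[OF bounded_clinear_funpow[OF bounded_clinear_V] csubspace_E R_in u]
      by (simp add: R_linear)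
    also have "\<dots> \<le> norm ((V ^^ n) (R h - u))"
      by (rule norm_R_le)
    also have "\<dots> = norm (R h - u)"
      using u R_in closed_csubspaceD(5)[OF closed_csubspace_E] by (intro norm_V_pow) blast
    finally have "norm (R ((V ^^ n) (R h)) - R ((V ^^ n) u)) < e / 3"
      using h by simp
    then show ?thesis
      using N[OF that] h norm_triangle_ineq3[of "R ((V ^^ n) (R h))" "R ((V ^^ n) u)"]
        norm_triangle_ineq3[of "R h" u] by linarith
  qed
  then show "\<exists>N. \<forall>n\<ge>N. norm (norm (R ((V ^^ n) u)) - norm u) < e"
    by auto
qed

abbreviation "Aa \<equiv> asymptotic_op Pa"

section \<open>The operator \<open>Q\<close> and what commutes with it\<close>

definition Q :: "'a \<Rightarrow> 'a" where "Q = durszt_Q P"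

interpretation adj: contraction Pa
  by (rule contraction_Pa)

lemma norm_Aa_le: "norm (Aa x) \<le> norm x"
  using adj.norm_R_le[of "adj.R x"] adj.norm_R_le[of x] by (simp add: adj.R_R)

lemma P_Aa_Pa: "P (Aa (Pa x)) = Aa x"
  using adj.Pa_A_P by (simp add: cadjoint_Pa)

lemma bounded_clinear_R_Aa_R: "bounded_clinear_on E E (\<lambda>x. R (Aa (R x)))"
  by (rule bounded_clinear_on_compose[OF bounded_clinear_on_R[of UNIV]
        bounded_clinear_on_compose[OF adj.bounded_clinear_A
          bounded_clinear_on_E_UNIV[OF bounded_clinear_R]]])

lemma
  shows positive_Q: "positive_on E Q"
    and Q_Q: "x \<in> E \<Longrightarrow> Q (Q x) = x - R (Aa (R x))"
    and Q_commute: "bounded_clinear_on E E C \<Longrightarrow>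
      (\<And>x. x \<in> E \<Longrightarrow> C (R (Aa (R x))) = R (Aa (R (C x)))) \<Longrightarrow> x \<in> E \<Longrightarrow> C (Q x) = Q (C x)"
proof -
  let ?T = "\<lambda>x. x - R (Aa (R x))"
  have bT: "bounded_clinear_on E E ?T"
    by (intro bounded_clinear_on_minus bounded_clinear_on_ident csubspace_E
        bounded_clinear_R_Aa_R order_refl)
  have sT: "selfadjoint_on E ?T"
    by (simp add: selfadjoint_on_def cinner.diff_left cinner.diff_right cinner_R adj.cinner_A)
  have cT: "norm (x - ?T x) \<le> norm x" for x
    using order_trans[OF norm_R_le order_trans[OF norm_Aa_le norm_R_le]] by simp
  note * = closed_csubspace_E bT sT cT
  show "positive_on E Q"
    unfolding Q_def durszt_Q_def by (rule positive_psqrt_on[OF *])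
  show "Q (Q x) = x - R (Aa (R x))" if "x \<in> E"
    unfolding Q_def durszt_Q_def by (rule psqrt_on_psqrt_on[OF * that])
  show "C (Q x) = Q (C x)" if C: "bounded_clinear_on E E C"
    "\<And>x. x \<in> E \<Longrightarrow> C (R (Aa (R x))) = R (Aa (R (C x)))" and x: "x \<in> E"
    unfolding Q_def durszt_Q_def
  proof (rule psqrt_on_commute[OF * C(1) _ x])
    fix y assume y: "y \<in> E"
    then show "C (y - R (Aa (R y))) = C y - R (Aa (R (C y)))"
      using bounded_clinear_on_diff[OF C(1) csubspace_E y R_in] C(2) by simp
  qed
qed

lemma bounded_clinear_Q: "bounded_clinear_on E E Q"
  using positive_Q by (simp add: positive_on_def)

lemma Q_in: "x \<in> E \<Longrightarrow> Q x \<in> E"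
  by (rule bounded_clinear_onD(1)[OF bounded_clinear_Q])

text \<open>The two terms on the right will be the limits of the squared orbit norms at plus and
  minus infinity.\<close>

lemma norm_Q_sq:
  assumes "x \<in> E"
  shows "(norm (Q x))\<^sup>2 = (norm x)\<^sup>2 - (norm (adj.R (R x)))\<^sup>2"
proof -
  have "cinner (Q (Q x)) x = cinner (Q x) (Q x)"
    using positive_on_selfadjoint[OF csubspace_E positive_Q] assms Q_in
    unfolding selfadjoint_on_def by blast
  then have "(norm (Q x))\<^sup>2 = Re (cinner (Q (Q x)) x)"
    by (simp add: Re_cinner_self)
  also have "\<dots> = (norm x)\<^sup>2 - Re (cinner (R (Aa (R x))) x)"
    using assms by (simp add: Q_Q cinner.diff_left Re_cinner_self)
  also have "Re (cinner (R (Aa (R x))) x) = (norm (adj.R (R x)))\<^sup>2"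
    by (simp add: cinner_R adj.norm_R_sq)
  finally show ?thesis .
qed

text \<open>On vectors \<open>R h\<close> this comes down to
  \<open>P (Aa (A h)) = Aa (A (P h))\<close>, obtained by writing \<open>A h = Pa (A (P h))\<close>
  and absorbing \<open>P\<close> and \<open>Pa\<close> into \<open>Aa\<close>.\<close>

lemma V_R_Aa_R:
  assumes "x \<in> E"
  shows "V (R (Aa (R x))) = R (Aa (R (V x)))"
proof (rule eq_on_E[OF _ _ _ assms])
  note RAR = bounded_clinear_R_Aa_R
  show "bounded_clinear_on E E (\<lambda>x. V (R (Aa (R x))))"
    by (rule bounded_clinear_on_compose[OF bounded_clinear_V RAR])
  show "bounded_clinear_on E E (\<lambda>x. R (Aa (R (V x))))"
    by (rule bounded_clinear_on_compose[OF RAR bounded_clinear_V])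
  fix h
  have "P (Aa (A h)) = Aa (A (P h))"
    using P_Aa_Pa[of "A (P h)"] by (simp add: Pa_A_P)
  then show "V (R (Aa (R (R h)))) = R (Aa (R (V (R h))))"
    by (simp add: V_R R_R)
qed

lemma V_Q: "x \<in> E \<Longrightarrow> V (Q x) = Q (V x)"
  by (rule Q_commute[OF bounded_clinear_V]) (rule V_R_Aa_R)

lemma Va_Q:
  assumes "x \<in> E"
  shows "Va (Q x) = Q (Va x)"
proof (rule cinner_ext_E)
  have sQ: "cinner (Q x) y = cinner x (Q y)" if "x \<in> E" "y \<in> E" for x y
    using positive_on_selfadjoint[OF csubspace_E positive_Q] that by (simp add: selfadjoint_on_def)
  fix z assume z: "z \<in> E"
  have "cinner z (Va (Q x)) = cinner (Q (V z)) x"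
    using z assms by (simp add: cinner_Va Q_in V_in sQ)
  also have "\<dots> = cinner (Q z) (Va x)"
    using z assms by (simp add: cinner_Va Q_in flip: V_Q)
  also have "\<dots> = cinner z (Q (Va x))"
    using z assms by (simp add: sQ Va_in)
  finally show "cinner z (Va (Q x)) = cinner z (Q (Va x))" .
qed (use assms Va_in Q_in in auto)

lemma commutant_adj: "C \<in> commutant \<Longrightarrow> C \<in> adj.commutant"
  by (simp add: commutant_def adj.commutant_def cadjoint_Pa)

lemma commutant_Q:
  assumes C: "C \<in> commutant" and x: "x \<in> E"
  shows "C (Q x) = Q (C x)"
  by (rule Q_commute[OF bounded_clinear_on_E[OF commutantD(1)[OF C] commutant_E[OF C]] _ x])
    (simp_all add: R_commute[OF C] adj.A_commute[OF commutant_adj[OF C]])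

end

section \<open>The domain and the coefficients of the second component of \<open>W\<close>\<close>

context cnu_contraction
begin

interpretation adj: contraction Pa
  by (rule contraction_Pa)

text \<open>If \<open>Q u = 0\<close>, the contractions \<open>R\<close> and \<open>adj.R\<close>
  preserve the norm in succession. The first equality makes \<open>u\<close> fixed by
  \<open>A\<close> and \<open>R\<close>, the second by \<open>Aa\<close>.\<close>

lemma Q_eq_0:
  assumes u: "u \<in> E" and 0: "Q u = 0"
  shows "u = 0"
proof -
  have 1: "norm u = norm (adj.R (R u))"
    using norm_Q_sq[OF u] 0 by simp
  have "norm (R u) = norm u"
    using adj.norm_R_le[of "R u"] norm_R_le[of u] 1 by linarith
  then have A: "A u = u"
    by (simp add: norm_R_eq_iff)
  then have "R u = u"
    by (rule A_fixed_imp_R_fixed)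
  then have "Aa u = u"
    using 1 by (simp flip: adj.norm_R_eq_iff)
  then show ?thesis
    using A cnu_fixed_zero by blast
qed

lemma inj_on_Q: "inj_on Q E"
proof (rule inj_onI)
  fix x y assume "x \<in> E" "y \<in> E" "Q x = Q y"
  then have "Q (x - y) = 0" "x - y \<in> E"
    using bounded_clinear_on_diff[OF bounded_clinear_Q csubspace_E]
      closed_csubspaceD(5)[OF closed_csubspace_E] by auto
  then show "x = y"
    using Q_eq_0 by fastforce
qed

abbreviation "H0 \<equiv> durszt_dom P"

definition qinv_R :: "'a \<Rightarrow> 'a" where "qinv_R x = durszt_Q_inv P (R x)"

lemma H0_iff: "x \<in> H0 \<longleftrightarrow> (\<exists>v\<in>E. R x = Q v)"
  by (auto simp: durszt_dom_def Q_def)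

lemma qinv_R_eq: "v \<in> E \<Longrightarrow> R x = Q v \<Longrightarrow> qinv_R x = v"
  unfolding qinv_R_def using inj_on_Q by (simp add: Q_def)

text \<open>As \<open>Q\<close> is injective, a witness of membership is the value of
  \<open>qinv_R\<close>; the closure properties of \<open>H0\<close> below only have to exhibit
  one.\<close>

lemma H0_I: "v \<in> E \<Longrightarrow> R x = Q v \<Longrightarrow> x \<in> H0 \<and> qinv_R x = v"
  using qinv_R_eq H0_iff by blast

lemma qinv_R_in: "x \<in> H0 \<Longrightarrow> qinv_R x \<in> E" and Q_qinv_R: "x \<in> H0 \<Longrightarrow> Q (qinv_R x) = R x"
  using qinv_R_eq by (auto simp: H0_iff)

lemma H0_add: "x \<in> H0 \<Longrightarrow> y \<in> H0 \<Longrightarrow> x + y \<in> H0 \<and> qinv_R (x + y) = qinv_R x + qinv_R y"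
  by (rule H0_I) (simp_all add: R_linear qinv_R_in Q_qinv_R closed_csubspaceD(4)[OF closed_csubspace_E]
      bounded_clinear_onD(2)[OF bounded_clinear_Q])

lemma H0_scaleC: "x \<in> H0 \<Longrightarrow> c *\<^sub>C x \<in> H0 \<and> qinv_R (c *\<^sub>C x) = c *\<^sub>C qinv_R x"
  by (rule H0_I) (simp_all add: R_linear qinv_R_in Q_qinv_R closed_csubspaceD(6)[OF closed_csubspace_E]
      bounded_clinear_onD(3)[OF bounded_clinear_Q])

lemma csubspace_H0: "complex_vector.subspace H0"
proof (rule complex_vector.subspaceI)
  show "0 \<in> H0"
    using H0_I[of 0 0] closed_csubspaceD(3)[OF closed_csubspace_E]
    by (simp add: R_linear bounded_clinear_on_0[OF bounded_clinear_Q csubspace_E])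
qed (use H0_add H0_scaleC in auto)

lemma H0_P: "x \<in> H0 \<Longrightarrow> P x \<in> H0 \<and> qinv_R (P x) = V (qinv_R x)"
  by (rule H0_I) (simp_all add: V_in qinv_R_in Q_qinv_R flip: V_R V_Q)

lemma H0_commutant:
  "C \<in> commutant \<Longrightarrow> x \<in> H0 \<Longrightarrow> C x \<in> H0 \<and> qinv_R (C x) = C (qinv_R x)"
  by (rule H0_I) (simp_all add: commutant_E qinv_R_in Q_qinv_R flip: R_commute commutant_Q)

text \<open>\<open>H0\<close> contains the range of \<open>I - Aa A\<close> because \<open>R (I - Aa A) = Q\<^sup>2 R\<close>.\<close>

lemma dense_H0: "closure H0 = UNIV"
proof -
  let ?D = "range (\<lambda>h. h - Aa (A h))"
  have b: "bounded_clinear (\<lambda>h. h - Aa (A h))"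
    by (intro bounded_clinear_on_minus bounded_clinear_on_ident
        bounded_clinear_on_compose[OF adj.bounded_clinear_A bounded_clinear_A]) auto
  have "closure ?D = UNIV"
  proof (rule closure_eq_if_orthogonal_zero[OF closed_csubspace_UNIV])
    show "complex_vector.subspace ?D"
      by (rule csubspace_image[OF b]) simp
    fix y assume orth: "\<And>x. x \<in> ?D \<Longrightarrow> cinner x y = 0"
    have "y = A (Aa y)"
    proof (rule cinner_ext)
      show "cinner h y = cinner h (A (Aa y))" for h
        using orth[of "h - Aa (A h)"] by (simp add: cinner.diff_left adj.cinner_A cinner_A)
    qed
    \<comment> \<open>Squeezing: \<open>norm y = norm (A (Aa y)) \<le> norm (Aa y) \<le> norm (adj.R
      y) \<le> norm y\<close>. Equality at the end gives \<open>Aa y = y\<close>, and then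
      \<open>A y = y\<close>.\<close>
    then have "norm y \<le> norm (Aa y)"
      using norm_R_le[of "R (Aa y)"] norm_R_le[of "Aa y"] by (simp add: R_R)
    moreover have "norm (Aa y) \<le> norm (adj.R y)"
      using adj.norm_R_le[of "adj.R y"] by (simp add: adj.R_R)
    ultimately have "norm (adj.R y) = norm y"
      using adj.norm_R_le[of y] by linarith
    then have "Aa y = y"
      by (simp add: adj.norm_R_eq_iff)
    then show "y = 0"
      using cnu_fixed_zero \<open>y = A (Aa y)\<close> by simp
  qed simp
  moreover have "?D \<subseteq> H0"
  proof clarify
    fix h
    have "R (h - Aa (A h)) = Q (Q (R h))"
      by (simp add: Q_Q R_in R_R R_linear)
    then show "h - Aa (A h) \<in> H0"
      using Q_in R_in H0_iff by blast
  qed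
  ultimately show ?thesis
    using closure_mono by blast
qed

text \<open>In the paper, \<open>orbit k x\<close> is \<open>\<A>\<^sup>1\<^sup>/\<^sup>2 Q\<^sup>-\<^sup>1 V\<^sup>k \<A>\<^sup>1\<^sup>/\<^sup>2 x\<close>, with \<open>V\<^sup>*\<^sup>-\<^sup>k\<close> in place of \<open>V\<^sup>k\<close> for
  \<open>k < 0\<close>. The identity \<open>P\<^sup>* (orbit (k + 1) x) = orbit k x\<close> makes the norm of \<open>W\<^sub>2 x\<close> a telescoping sum.\<close>

definition orbit :: "int \<Rightarrow> 'a \<Rightarrow> 'a" where
  "orbit k x = R (if k < 0 then (Va ^^ nat (- k)) (qinv_R x) else (V ^^ nat k) (qinv_R x))"

lemma orbit_add: "x \<in> H0 \<Longrightarrow> x' \<in> H0 \<Longrightarrow> orbit k (x + x') = orbit k x + orbit k x'"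
  by (simp add: orbit_def H0_add qinv_R_in bounded_clinear_onD(2)[OF bounded_clinear_funpow[OF bounded_clinear_V]]
      bounded_clinear_onD(2)[OF bounded_clinear_funpow[OF bounded_clinear_Va]]
      R_linear)

lemma orbit_scaleC: "x \<in> H0 \<Longrightarrow> orbit k (c *\<^sub>C x) = c *\<^sub>C orbit k x"
  by (simp add: orbit_def H0_scaleC qinv_R_in bounded_clinear_onD(3)[OF bounded_clinear_funpow[OF bounded_clinear_V]]
      bounded_clinear_onD(3)[OF bounded_clinear_funpow[OF bounded_clinear_Va]]
      R_linear)

text \<open>For nonnegative \<open>k\<close> this is \<open>Pa R V = R\<close>, for negative
  \<open>k\<close> it is \<open>R Va = Pa R\<close>. The borderline \<open>k = -1\<close> joins the
  two branches of the definition, as both begin with \<open>qinv_R x\<close>.\<close>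

lemma Pa_orbit:
  assumes x: "x \<in> H0"
  shows "Pa (orbit (k + 1) x) = orbit k x"
proof -
  consider "k \<ge> 0" | "k = -1" | "k < -1"
    by linarith
  then show ?thesis
  proof cases
    case 1
    then have "nat (k + 1) = Suc (nat k)"
      by simp
    then show ?thesis
      using 1 x by (simp add: orbit_def Pa_R_V V_pow_in qinv_R_in)
  next
    case 2
    then show ?thesis
      using x by (simp add: orbit_def R_Va qinv_R_in)
  next
    case 3
    then have "nat (- k) = Suc (nat (- (k + 1)))"
      by simp
    then show ?thesis
      using 3 x by (simp add: orbit_def R_Va Va_pow_in qinv_R_in)
  qed
qed

text \<open>\<open>P\<close> becomes a factor \<open>V\<close> on \<open>qinv_R x\<close>. For
  negative \<open>k\<close> this factor cancels one \<open>Va\<close>, by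
  \<open>Va_V\<close>.\<close>

lemma orbit_P:
  assumes x: "x \<in> H0"
  shows "orbit k (P x) = orbit (k + 1) x"
proof -
  consider "k \<ge> 0" | "k = -1" | "k < -1"
    by linarith
  then show ?thesis
  proof cases
    case 1
    then have "nat (k + 1) = Suc (nat k)"
      by simp
    then show ?thesis
      using 1 x by (simp add: orbit_def H0_P funpow_swap1)
  next
    case 2
    then show ?thesis
      using x by (simp add: orbit_def H0_P Va_V qinv_R_in)
  next
    case 3
    then have "nat (- k) = Suc (nat (- (k + 1)))"
      by simp
    then show ?thesis
      using 3 x by (simp add: orbit_def H0_P Va_V qinv_R_in funpow_swap1)
  qed
qed

lemma orbit_commutant:
  assumes C: "C \<in> commutant" and x: "x \<in> H0"
  shows "orbit k (C x) = C (orbit k x)"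
proof -
  have "C ((V ^^ n) v) = (V ^^ n) (C v)" if "v \<in> E" for n v
    using that by (induction n) (simp_all add: V_commute[OF C] V_pow_in)
  moreover have "C ((Va ^^ n) v) = (Va ^^ n) (C v)" if "v \<in> E" for n v
    using that by (induction n) (simp_all add: Va_commute[OF C] Va_pow_in)
  ultimately show ?thesis
    using H0_commutant[OF C x] qinv_R_in[OF x] by (simp add: orbit_def R_commute[OF C])
qed

text \<open>The definition of \<open>W\<close> inverts \<open>Q\<close> after the powers of
  \<open>V\<close> or its adjoint. Since \<open>Q\<close> commutes with both, it may be inverted on
  \<open>R x\<close> beforehand.\<close>

lemma orbit_eq_durszt:
  assumes x: "x \<in> H0"
  shows "k < 0 \<Longrightarrow> R (durszt_Q_inv P ((durszt_V_adj P ^^ nat (- k)) (R x))) = orbit k x"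
    and "k \<ge> 0 \<Longrightarrow> R (durszt_Q_inv P ((durszt_V P ^^ nat k) (R x))) = orbit k x"
proof -
  have V: "(V ^^ n) (Q v) = Q ((V ^^ n) v)" if "v \<in> E" for n v
    using that by (induction n) (simp_all add: V_Q V_pow_in)
  have Va: "(Va ^^ n) (Q v) = Q ((Va ^^ n) v)" if "v \<in> E" for n v
    using that by (induction n) (simp_all add: Va_Q Va_pow_in)
  have inv: "durszt_Q_inv P (Q v) = v" if "v \<in> E" for v
    using inj_on_Q that by (simp add: Q_def)
  have "durszt_Q_inv P ((V ^^ n) (R x)) = (V ^^ n) (qinv_R x)"
    "durszt_Q_inv P ((Va ^^ n) (R x)) = (Va ^^ n) (qinv_R x)" for n
    using x by (simp_all add: V Va inv qinv_R_in V_pow_in Va_pow_in flip: Q_qinv_R)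
  then show "k < 0 \<Longrightarrow> R (durszt_Q_inv P ((durszt_V_adj P ^^ nat (- k)) (R x))) = orbit k x"
    "k \<ge> 0 \<Longrightarrow> R (durszt_Q_inv P ((durszt_V P ^^ nat k) (R x))) = orbit k x"
    by (simp_all add: orbit_def V_def Va_def)
qed

text \<open>For \<open>v = qinv_R x\<close>, the squared norms \<open>g k\<close> tend to
  \<open>(norm v)\<^sup>2\<close> at plus infinity. At minus infinity they tend to
  \<open>(norm (adj.R (R v)))\<^sup>2\<close>, since the orbit there consists of the powers of
  \<open>Pa\<close> on \<open>R v\<close>. The difference of the limits is
  \<open>(norm (Q v))\<^sup>2\<close>.\<close>

lemma has_sum_D_orbit:
  assumes x: "x \<in> H0"
  shows "((\<lambda>k. (norm (adj.D (orbit k x)))\<^sup>2) has_sum (norm (R x))\<^sup>2) UNIV"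
proof -
  define f where "f k = (norm (adj.D (orbit k x)))\<^sup>2" for k
  define g where "g k = (norm (orbit k x))\<^sup>2" for k
  have f: "f k = g k - g (k - 1)" for k
    using Pa_orbit[OF x, of "k - 1"] by (simp add: f_def g_def adj.norm_D_sq)
  have "(\<lambda>n. (norm (R ((V ^^ n) (qinv_R x))))\<^sup>2) \<longlonglongrightarrow> (norm (qinv_R x))\<^sup>2"
    by (intro tendsto_intros tendsto_norm_R_V_pow qinv_R_in x)
  then have lim1: "(\<lambda>n. g (int n)) \<longlonglongrightarrow> (norm (qinv_R x))\<^sup>2"
    by (simp add: g_def orbit_def)
  have "g (- int n) = (norm ((Pa ^^ n) (R (qinv_R x))))\<^sup>2" for n
    using x by (cases n) (simp_all add: g_def orbit_def R_Va R_Va_pow qinv_R_in Va_pow_in nat_add_distrib)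
  then have lim2: "(\<lambda>n. g (- int n)) \<longlonglongrightarrow> (norm (adj.R (R (qinv_R x))))\<^sup>2"
    using adj.tendsto_norm_P_pow_R[of "R (qinv_R x)"] by simp
  \<comment> \<open>The sum is cut between -1 and 0; the boundary term \<open>g (-1)\<close> cancels
    when the halves are joined.\<close>
  have "(\<lambda>n. f (int n)) sums ((norm (qinv_R x))\<^sup>2 - g (-1))"
  proof -
    have "(\<Sum>i<n. f (int i)) = g (int n - 1) - g (-1)" for n
      by (induction n) (simp_all add: f)
    moreover have "(\<lambda>n. g (int n - 1)) \<longlonglongrightarrow> (norm (qinv_R x))\<^sup>2"
      by (rule LIMSEQ_imp_Suc) (simp add: lim1)
    then have "(\<lambda>n. g (int n - 1) - g (-1)) \<longlonglongrightarrow> (norm (qinv_R x))\<^sup>2 - g (-1)"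
      by (intro tendsto_intros)
    ultimately show ?thesis
      by (simp add: sums_def)
  qed
  then have "((\<lambda>n. f (int n)) has_sum ((norm (qinv_R x))\<^sup>2 - g (-1))) UNIV"
    by (intro sums_nonneg_imp_has_sum) (simp_all add: f_def)
  moreover have "range int = {0..}"
    by (auto simp: image_iff intro: zero_le_imp_eq_int)
  ultimately have pos: "(f has_sum ((norm (qinv_R x))\<^sup>2 - g (-1))) {0..}"
    using has_sum_reindex[of int UNIV f] by (simp add: o_def)
  have "(\<lambda>n. f (- int n - 1)) sums (g (-1) - (norm (adj.R (R (qinv_R x))))\<^sup>2)"
  proof -
    have "(\<Sum>i<n. f (- int i - 1)) = g (-1) - g (- int n - 1)" for n
    proof (induction n)
      case (Suc n)
      have "- int (Suc n) - 1 = - int n - 1 - 1"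
        by simp
      then have "g (- int (Suc n) - 1) = g (- int n - 1 - 1)"
        by (rule arg_cong)
      then show ?case
        unfolding sum.lessThan_Suc Suc using f[of "- int n - 1"] by linarith
    qed simp
    moreover have "- int n - 1 = - int (Suc n)" for n
      by simp
    ultimately have "(\<Sum>i<n. f (- int i - 1)) = g (-1) - g (- int (Suc n))" for n
      by (simp only:)
    moreover have "(\<lambda>n. g (-1) - g (- int (Suc n))) \<longlonglongrightarrow> g (-1) - (norm (adj.R (R (qinv_R x))))\<^sup>2"
      using LIMSEQ_Suc[OF lim2] by (intro tendsto_intros)
    ultimately show ?thesis
      by (simp add: sums_def)
  qed
  then have "((\<lambda>n. f (- int n - 1)) has_sum (g (-1) - (norm (adj.R (R (qinv_R x))))\<^sup>2)) UNIV"
    by (intro sums_nonneg_imp_has_sum) (simp_all add: f_def)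
  moreover have "range (\<lambda>n. - int n - 1) = {..-1}"
  proof -
    have "k \<in> range (\<lambda>n. - int n - 1)" if "k \<le> -1" for k
      using that by (intro image_eqI[of _ _ "nat (- k - 1)"]) auto
    then show ?thesis by auto
  qed
  ultimately have neg: "(f has_sum (g (-1) - (norm (adj.R (R (qinv_R x))))\<^sup>2)) {..-1}"
    using has_sum_reindex[of "\<lambda>n. - int n - 1" UNIV f] by (simp add: inj_on_def o_def)
  have "(f has_sum ((norm (qinv_R x))\<^sup>2 - g (-1) + (g (-1) - (norm (adj.R (R (qinv_R x))))\<^sup>2))) ({0..} \<union> {..-1})"
    using pos neg by (rule has_sum_Un_disjoint) auto
  moreover have "{0..} \<union> {..-1} = (UNIV :: int set)"
    by auto
  moreover have "(norm (qinv_R x))\<^sup>2 - g (-1) + (g (-1) - (norm (adj.R (R (qinv_R x))))\<^sup>2) = (norm (R x))\<^sup>2"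
    using norm_Q_sq[OF qinv_R_in[OF x]] by (simp add: Q_qinv_R x)
  ultimately show ?thesis
    by (simp add: f_def[abs_def])
qed

end

context contraction
begin

text \<open>The deficit \<open>(norm (R x))\<^sup>2\<close> is exactly what the second component of
  \<open>W\<close> contributes.\<close>

lemma has_sum_D_P_pow: "((\<lambda>k. (norm (D ((P ^^ k) x)))\<^sup>2) has_sum ((norm x)\<^sup>2 - (norm (R x))\<^sup>2)) UNIV"
proof (rule sums_nonneg_imp_has_sum)
  have "(\<Sum>i<n. (norm (D ((P ^^ i) x)))\<^sup>2) = (norm x)\<^sup>2 - (norm ((P ^^ n) x))\<^sup>2" for n
    by (induction n) (simp_all add: norm_D_sq)
  then show "(\<lambda>k. (norm (D ((P ^^ k) x)))\<^sup>2) sums ((norm x)\<^sup>2 - (norm (R x))\<^sup>2)"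
    unfolding sums_def by (simp add: tendsto_diff tendsto_norm_P_pow_R)
qed simp

end

section \<open>Orthogonal series and Hilbert tensor products\<close>

lemma norm_sum_orthogonal_sq:
  fixes f :: "'i \<Rightarrow> 'a::complex_inner"
  assumes "finite F" "\<And>i j. i \<in> F \<Longrightarrow> j \<in> F \<Longrightarrow> i \<noteq> j \<Longrightarrow> cinner (f i) (f j) = 0"
  shows "(norm (sum f F))\<^sup>2 = (\<Sum>i\<in>F. (norm (f i))\<^sup>2)"
  using assms
proof (induction F rule: finite_induct)
  case (insert i F)
  have "cinner (f i) (sum f F) = (\<Sum>j\<in>F. cinner (f i) (f j))"
    by (rule cinner.sum_right)
  also have "\<dots> = 0"
    using insert by (intro sum.neutral) auto
  finally have "inner (f i) (sum f F) = 0"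
    by (metis Re_cinner zero_complex.simps(1))
  then have "(norm (f i + sum f F))\<^sup>2 = (norm (f i))\<^sup>2 + (norm (sum f F))\<^sup>2"
    by (simp add: power2_norm_eq_inner inner_add_left inner_add_right inner_commute)
  then show ?case
    using insert by simp
qed simp

text \<open>By Pythagoras, the squared distance between partial sums over nested finite sets is a
  difference of partial sums of the squared norms, so the net of partial sums is Cauchy.\<close>

lemma
  fixes f :: "'i \<Rightarrow> 'a::chilbert_space"
  assumes orth: "\<And>i j. i \<in> I \<Longrightarrow> j \<in> I \<Longrightarrow> i \<noteq> j \<Longrightarrow> cinner (f i) (f j) = 0"
    and s: "((\<lambda>i. (norm (f i))\<^sup>2) has_sum s) I"
  shows orthogonal_summable_on: "f summable_on I"
    and norm_infsum_orthogonal_sq: "(norm (infsum f I))\<^sup>2 = s"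
proof -
  let ?N = "sum (\<lambda>i. (norm (f i))\<^sup>2)" and ?G = "finite_subsets_at_top I"
  have N: "(norm (sum f F))\<^sup>2 = ?N F" if F: "finite F" "F \<subseteq> I" for F
    by (rule norm_sum_orthogonal_sq[OF F(1) orth[OF subsetD[OF F(2)] subsetD[OF F(2)]]])
  have lim: "(?N \<longlongrightarrow> s) ?G"
    using s by (simp add: has_sum_def)
  have "\<exists>X. eventually X ?G \<and> (\<forall>F F'. X F \<and> X F' \<longrightarrow> dist (sum f F) (sum f F') < e)" if e: "e > 0" for e
  proof -
    \<comment> \<open>Two scalar partial sums this close to \<open>s\<close> differ by less than
      \<open>(e/2)\<^sup>2\<close>; each vector sum is then within \<open>e/2\<close> of the one
      over \<open>F0\<close>.\<close>
    have "eventually (\<lambda>F. dist (?N F) s < (e/2)\<^sup>2 / 2) ?G"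
      using e by (intro tendstoD[OF lim]) simp
    then obtain F0 where F0: "finite F0" "F0 \<subseteq> I"
      and "\<forall>F. finite F \<and> F0 \<subseteq> F \<and> F \<subseteq> I \<longrightarrow> dist (?N F) s < (e/2)\<^sup>2 / 2"
      unfolding eventually_finite_subsets_at_top by (elim exE conjE)
    then have close: "dist (?N F) s < (e/2)\<^sup>2 / 2" if "finite F" "F0 \<subseteq> F" "F \<subseteq> I" for F
      using that by simp
    define X where "X F \<longleftrightarrow> finite F \<and> F0 \<subseteq> F \<and> F \<subseteq> I" for F
    have evX: "eventually X ?G"
      unfolding eventually_finite_subsets_at_top X_def using F0 by blast
    have half: "dist (sum f F) (sum f F0) < e / 2" if "X F" for F
    proof -
      have F: "finite F" "F0 \<subseteq> F" "F \<subseteq> I"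
        using that by (auto simp: X_def)
      have "(norm (sum f F - sum f F0))\<^sup>2 = (norm (sum f (F - F0)))\<^sup>2"
        using F by (simp add: sum_diff)
      also have "\<dots> = ?N (F - F0)"
        using F by (intro N) auto
      also have "\<dots> = ?N F - ?N F0"
        using F F0 by (simp add: sum_diff)
      also have "\<dots> < (e/2)\<^sup>2"
        using close[OF F] close[OF F0(1) order_refl F0(2)] unfolding dist_real_def by linarith
      finally show ?thesis
        using e power_less_imp_less_base[of "dist (sum f F) (sum f F0)" 2 "e/2"]
        by (simp add: dist_norm)
    qed
    have "dist (sum f F) (sum f F') < e" if "X F" "X F'" for F F'
      by (rule dist_triangle_half_l[OF half[OF that(1)] half[OF that(2)]])
    with evX show ?thesis
      by blast
  qed
  then have "cauchy_filter (filtermap (sum f) ?G)"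
    by (simp add: cauchy_filter_metric_filtermap)
  moreover have "complete (UNIV :: 'a set)"
    by (meson Cauchy_convergent UNIV_I complete_def convergent_def)
  ultimately obtain L where L: "(sum f \<longlongrightarrow> L) ?G"
    using complete_uniform[where S = "UNIV :: 'a set"] by (force simp add: filterlim_def)
  then show "f summable_on I"
    using summable_on_def has_sum_def by blast
  have "infsum f I = L"
    using L by (simp add: infsumI has_sum_def)
  moreover have "((\<lambda>F. (norm (sum f F))\<^sup>2) \<longlongrightarrow> (norm L)\<^sup>2) ?G"
    by (intro tendsto_intros L)
  moreover have "((\<lambda>F. (norm (sum f F))\<^sup>2) \<longlongrightarrow> s) ?G"
    using lim by (rule Lim_transform_eventually)
      (auto simp: N intro: eventually_finite_subsets_at_top_weakI)
  ultimately show "(norm (infsum f I))\<^sup>2 = s"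
    using tendsto_unique finite_subsets_at_top_neq_bot by blast
qed

lemma sum_in_closed_csubspace: "closed_csubspace E \<Longrightarrow> (\<And>i. i \<in> I \<Longrightarrow> f i \<in> E) \<Longrightarrow> sum f I \<in> E"
  by (simp add: closed_csubspace_def complex_vector.subspace_sum)

lemma has_sum_in_closed_csubspace:
  assumes E: "closed_csubspace E" and f: "\<And>i. i \<in> I \<Longrightarrow> f i \<in> E" and s: "(f has_sum s) I"
  shows "s \<in> E"
proof (rule Lim_in_closed_set[OF closed_csubspaceD(2)[OF E]])
  show "eventually (\<lambda>F. sum f F \<in> E) (finite_subsets_at_top I)"
    by (intro eventually_finite_subsets_at_top_weakI sum_in_closed_csubspace[OF E]) (use f in auto)
qed (use s in \<open>auto simp: has_sum_def\<close>)

lemma bounded_clinear_on_has_sum: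
  assumes T: "bounded_clinear_on E F T" and E: "closed_csubspace E"
    and f: "\<And>i. i \<in> I \<Longrightarrow> f i \<in> E" and s: "(f has_sum s) I"
  shows "((\<lambda>i. T (f i)) has_sum T s) I"
proof -
  have "((\<lambda>X. T (sum f X)) \<longlongrightarrow> T s) (finite_subsets_at_top I)"
  proof (rule bounded_clinear_on_tendsto[OF T closed_csubspaceD(1)[OF E]])
    show "eventually (\<lambda>F. sum f F \<in> E) (finite_subsets_at_top I)"
      by (intro eventually_finite_subsets_at_top_weakI sum_in_closed_csubspace[OF E]) (use f in auto)
    show "s \<in> E"
      by (rule has_sum_in_closed_csubspace[OF E f s])
  qed (use s in \<open>auto simp: has_sum_def\<close>)
  then show ?thesis
    unfolding has_sum_def
  proof (rule Lim_transform_eventually)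
    show "\<forall>\<^sub>F X in finite_subsets_at_top I. T (sum f X) = (\<Sum>i\<in>X. T (f i))"
      by (intro eventually_finite_subsets_at_top_weakI
          bounded_clinear_on_sum[OF T closed_csubspaceD(1)[OF E]]) (use f in auto)
  qed
qed

lemma has_sum_scaleC:
  fixes f :: "'i \<Rightarrow> 'b::complex_inner"
  assumes "(f has_sum s) I"
  shows "((\<lambda>i. c *\<^sub>C f i) has_sum c *\<^sub>C s) I"
proof -
  have "((\<lambda>F. c *\<^sub>C sum f F) \<longlongrightarrow> c *\<^sub>C s) (finite_subsets_at_top I)"
    using assms by (intro scaleC.tendsto tendsto_const) (simp add: has_sum_def)
  then show ?thesis
    by (simp add: has_sum_def scaleC.sum_right)
qed

section \<open>Gram matrices and operators on Hilbert tensor products\<close>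

lemma cinner_sum_list_left: "cinner (\<Sum>p\<leftarrow>xs. a p) z = (\<Sum>p\<leftarrow>xs. cinner (a p) z)"
  by (induction xs) (simp_all add: cinner.add_left)

lemma cinner_sum_list_right: "cinner z (\<Sum>p\<leftarrow>xs. a p) = (\<Sum>p\<leftarrow>xs. cinner z (a p))"
  by (induction xs) (simp_all add: cinner.add_right)

lemma norm_sum_list_eq_of_gram:
  assumes "\<And>p q. p \<in> set xs \<Longrightarrow> q \<in> set xs \<Longrightarrow> cinner (a p) (a q) = cinner (b p) (b q)"
  shows "norm (\<Sum>p\<leftarrow>xs. a p) = norm (\<Sum>p\<leftarrow>xs. b p)"
proof -
  have "cinner (\<Sum>p\<leftarrow>xs. a p) (\<Sum>p\<leftarrow>xs. a p) = cinner (\<Sum>p\<leftarrow>xs. b p) (\<Sum>p\<leftarrow>xs. b p)"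
    unfolding cinner_sum_list_left cinner_sum_list_right
    by (intro arg_cong[where f = sum_list] map_cong refl assms)
  then have "(norm (\<Sum>p\<leftarrow>xs. a p))\<^sup>2 = (norm (\<Sum>p\<leftarrow>xs. b p))\<^sup>2"
    by (metis Re_cinner_self)
  then show ?thesis
    by simp
qed

lemma fst_sum_list: "fst (\<Sum>p\<leftarrow>xs. (a p, b p)) = (\<Sum>p\<leftarrow>xs. a p)"
  by (induction xs) simp_all

text \<open>The pairs \<open>(a p, d p)\<close> have the Gram matrix of \<open>b\<close>, and a
  first component is no longer than its pair. The vectors \<open>d p\<close> may live in a space of
  their own.\<close>

lemma norm_sum_list_le_of_gram:
  assumes "\<And>p q. p \<in> set xs \<Longrightarrow> q \<in> set xs \<Longrightarrow>
    cinner (a p) (a q) + cinner (d p) (d q) = cinner (b p) (b q)"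
  shows "norm (\<Sum>p\<leftarrow>xs. a p) \<le> norm (\<Sum>p\<leftarrow>xs. b p)"
proof -
  have "norm (\<Sum>p\<leftarrow>xs. a p) = norm (fst (\<Sum>p\<leftarrow>xs. (a p, d p)))"
    by (simp add: fst_sum_list)
  also have "\<dots> \<le> norm (\<Sum>p\<leftarrow>xs. (a p, d p))"
    by (metis norm_fst_le prod.collapse)
  also have "\<dots> = norm (\<Sum>p\<leftarrow>xs. b p)"
    by (intro norm_sum_list_eq_of_gram) (simp add: cinner_prod_def assms)
  finally show ?thesis .
qed

locale tensor =
  fixes F :: "'f set" and ip :: "'f \<Rightarrow> 'f \<Rightarrow> complex" and E :: "'a::chilbert_space set"
    and tns :: "'f \<Rightarrow> 'a \<Rightarrow> 't::chilbert_space"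
  assumes tns: "hilbert_tensor F ip E tns" and E: "closed_csubspace E"
begin

abbreviation "TS \<equiv> tensor_space F E tns"

lemmas Es = closed_csubspaceD[OF E]

lemma cinner_tns:
  "f \<in> F \<Longrightarrow> g \<in> F \<Longrightarrow> v \<in> E \<Longrightarrow> w \<in> E \<Longrightarrow> cinner (tns f v) (tns g w) = ip f g * cinner v w"
  using tns unfolding hilbert_tensor_def by blast

lemma closed_csubspace_TS: "closed_csubspace TS"
  unfolding tensor_space_def
  by (intro closed_csubspace_closure complex_vector.subspace_span)

lemma tns_in: "f \<in> F \<Longrightarrow> v \<in> E \<Longrightarrow> tns f v \<in> TS"
  unfolding tensor_space_def
  by (rule subsetD[OF closure_subset]) (rule complex_vector.span_base, blast)

lemma tns_add:
  assumes "f \<in> F" "v \<in> E" "w \<in> E"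
  shows "tns f (v + w) = tns f v + tns f w"
proof -
  have "cinner (tns f (v + w) - tns f v - tns f w) (tns f (v + w) - tns f v - tns f w) = 0"
    using assms Es by (simp add: cinner.diff_left cinner.diff_right cinner_tns cinner.add_left
        cinner.add_right algebra_simps)
  then show ?thesis
    by (simp add: algebra_simps)
qed

lemma tns_scaleC:
  assumes "f \<in> F" "v \<in> E"
  shows "tns f (c *\<^sub>C v) = c *\<^sub>C tns f v"
proof -
  have "cinner (tns f (c *\<^sub>C v) - c *\<^sub>C tns f v) (tns f (c *\<^sub>C v) - c *\<^sub>C tns f v) = 0"
    using assms Es by (simp add: cinner.diff_left cinner.diff_right cinner_tns cinner_scaleC_left
        cinner_scaleC_right algebra_simps)
  then show ?thesis
    by simp
qed

text \<open>The hypotheses say that \<open>f - g\<close> has norm zero, expressed through inner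
  products only. This identifies tensors whose first factor is an adjoint known only up to null
  functions.\<close>

lemma tns_cong:
  assumes "f \<in> F" "g \<in> F" "v \<in> E" "ip f f = c" "ip f g = c" "ip g f = c" "ip g g = c"
  shows "tns f v = tns g v"
proof -
  have "cinner (tns f v - tns g v) (tns f v - tns g v) = 0"
    using assms by (simp add: cinner.diff_left cinner.diff_right cinner_tns)
  then show ?thesis
    by simp
qed

lemma tns_null:
  assumes "f \<in> F" "v \<in> E" "ip f f = 0"
  shows "tns f v = 0"
  using cinner_tns[of f f v v] assms by simp

text \<open>For a contraction \<open>C\<close> and \<open>S = (1 - C\<^sup>*C)\<^sup>1\<^sup>/\<^sup>2\<close>, comparing Gram matrices gives
  \<open>\<parallel>\<Sum> f \<otimes> C v\<parallel>\<^sup>2 + \<parallel>\<Sum> f \<otimes> S v\<parallel>\<^sup>2 = \<parallel>\<Sum> f \<otimes> v\<parallel>\<^sup>2\<close>.\<close>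

lemma norm_sum_tns_op_le:
  assumes A: "bounded_clinear_on E E A" and K: "K > 0" "\<And>x. x \<in> E \<Longrightarrow> norm (A x) \<le> K * norm x"
    and xs: "\<And>f v. (f, v) \<in> set xs \<Longrightarrow> f \<in> F \<and> v \<in> E"
  shows "norm (\<Sum>(f, v)\<leftarrow>xs. tns f (A v)) \<le> K * norm (\<Sum>(f, v)\<leftarrow>xs. tns f v)"
proof -
  \<comment> \<open>Rescaled to a contraction, so that \<open>I - C\<^sup>* C\<close> has a positive
    square root.\<close>
  define C where "C v = complex_of_real (1 / K) *\<^sub>C A v" for v
  have C: "bounded_clinear_on E E C"
    unfolding C_def by (rule bounded_clinear_on_scaleC[OF A Es(1)])
  have C_le: "norm (C v) \<le> 1 * norm v" if "v \<in> E" for v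
    using K(2)[OF that] K(1) by (simp add: C_def norm_scaleC norm_divide field_simps)
  let ?C' = "cadjoint_on E C"
  have C': "bounded_clinear_on E E ?C'"
    by (rule bounded_clinear_cadjoint_on'[OF E C])
  have C'_le: "norm (?C' v) \<le> 1 * norm v" if "v \<in> E" for v
    using bounded_clinear_cadjoint_on(2)[OF E C, of 1] C_le that by auto
  note Cs = bounded_clinear_onD(1)[OF C] bounded_clinear_onD(1)[OF C']
  have C'C: "bounded_clinear_on E E (\<lambda>v. ?C' (C v))"
    by (rule bounded_clinear_on_compose[OF C' C])
  define S where "S = psqrt_on E (\<lambda>v. v - ?C' (C v))"
  have T: "bounded_clinear_on E E (\<lambda>v. v - ?C' (C v))"
    by (intro bounded_clinear_on_minus bounded_clinear_on_ident C'C Es order_refl)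
  have sT: "selfadjoint_on E (\<lambda>v. v - ?C' (C v))"
    using Cs by (simp add: selfadjoint_on_def cinner.diff_left cinner.diff_right
        cinner_cadjoint_on_left[OF E C] cinner_cadjoint_on[OF E C])
  have le: "norm (v - (v - ?C' (C v))) \<le> norm v" if "v \<in> E" for v
    using C'_le[OF Cs(1)[OF that]] C_le[OF that] by simp
  have S: "positive_on E S" and SS: "\<And>v. v \<in> E \<Longrightarrow> S (S v) = v - ?C' (C v)"
    using positive_psqrt_on[OF E T sT] psqrt_on_psqrt_on[OF E T sT] le unfolding S_def by auto
  have S_in: "S v \<in> E" if "v \<in> E" for v
    using S that bounded_clinear_onD(1) unfolding positive_on_def by blast
  have gram: "cinner (C v) (C w) + cinner (S v) (S w) = cinner v w" if "v \<in> E" "w \<in> E" for v w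
  proof -
    have "cinner (S v) (S w) = cinner (S (S v)) w"
      using positive_on_selfadjoint[OF Es(1) S] S_in that by (simp add: selfadjoint_on_def)
    then show ?thesis
      using that Cs by (simp add: SS cinner.diff_left cinner_cadjoint_on_left[OF E C])
  qed
  have "norm (\<Sum>p\<leftarrow>xs. tns (fst p) (C (snd p))) \<le> norm (\<Sum>p\<leftarrow>xs. tns (fst p) (snd p))"
  proof (rule norm_sum_list_le_of_gram[where d = "\<lambda>p. tns (fst p) (S (snd p))"])
    fix p q assume "p \<in> set xs" "q \<in> set xs"
    then have "fst p \<in> F" "snd p \<in> E" "fst q \<in> F" "snd q \<in> E"
      using xs[of "fst p" "snd p"] xs[of "fst q" "snd q"] by auto
    then show "cinner (tns (fst p) (C (snd p))) (tns (fst q) (C (snd q))) +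
        cinner (tns (fst p) (S (snd p))) (tns (fst q) (S (snd q))) =
        cinner (tns (fst p) (snd p)) (tns (fst q) (snd q))"
      using Cs S_in by (simp add: cinner_tns gram flip: distrib_left)
  qed
  moreover have "(\<Sum>(f, v)\<leftarrow>xs. tns f (A v)) = complex_of_real K *\<^sub>C (\<Sum>p\<leftarrow>xs. tns (fst p) (C (snd p)))"
    using xs
  proof (induction xs)
    case (Cons p xs)
    obtain f v where p: "p = (f, v)" by fastforce
    have fv: "f \<in> F" "v \<in> E"
      using Cons.prems[of f v] p by auto
    have "A v = complex_of_real K *\<^sub>C C v"
      using K by (simp add: C_def scaleC_scaleC)
    then have "tns f (A v) = complex_of_real K *\<^sub>C tns f (C v)"
      using fv Cs by (simp add: tns_scaleC)
    moreover have "(\<Sum>(f, v)\<leftarrow>xs. tns f (A v)) = complex_of_real K *\<^sub>C (\<Sum>p\<leftarrow>xs. tns (fst p) (C (snd p)))"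
      using Cons.prems by (intro Cons.IH) auto
    ultimately show ?case
      by (simp add: p scaleC_add_right)
  qed simp
  ultimately show ?thesis
    using K by (simp add: norm_scaleC case_prod_unfold)
qed

text \<open>The condition on \<open>M\<close> says that \<open>\<parallel>f\<parallel>\<^sup>2 - \<parallel>M f\<parallel>\<^sup>2\<close> is \<open>\<bar>b f\<bar>\<^sup>2\<close> for a functional \<open>b\<close>. Unitary operators
  satisfy it with \<open>b = 0\<close>, the backward shift with \<open>b f = f 0\<close>.\<close>

lemma tensor_op_exists:
  assumes M: "\<And>f. f \<in> F \<Longrightarrow> M f \<in> F"
    and b: "\<And>f g. f \<in> F \<Longrightarrow> g \<in> F \<Longrightarrow> ip (M f) (M g) + b f * cnj (b g) = ip f g"
    and A: "bounded_clinear_on E E A"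
  shows "\<exists>R. bounded_clinear_on TS TS R \<and> (\<forall>f\<in>F. \<forall>v\<in>E. R (tns f v) = tns (M f) (A v))"
proof -
  obtain K where K: "K > 0" "\<And>x. x \<in> E \<Longrightarrow> norm (A x) \<le> K * norm x"
    using bounded_clinear_on_bound[OF A] by blast
  note As = bounded_clinear_onD[OF A]
  define X where "X xs = (\<Sum>(f, v)\<leftarrow>xs. tns f v)" for xs
  define Y where "Y xs = (\<Sum>(f, v)\<leftarrow>xs. tns (M f) (A v))" for xs
  \<comment> \<open>That \<open>X xs\<close> determines \<open>Y xs\<close> is not visible from the
    sums; it follows from the bound below, so the operator starts as a relation.\<close>
  define \<Gamma> where "\<Gamma> = {(X xs, Y xs) | xs. set xs \<subseteq> F \<times> E}"
  have sub: "complex_vector.subspace \<Gamma>"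
  proof (rule complex_vector.subspaceI)
    have "(0, 0) \<in> \<Gamma>"
      unfolding \<Gamma>_def by (rule CollectI, rule exI[of _ "[]"]) (simp add: X_def Y_def)
    then show "0 \<in> \<Gamma>"
      by (simp add: zero_prod_def)
  next
    fix p q assume "p \<in> \<Gamma>" "q \<in> \<Gamma>"
    then obtain xs ys where xs: "set xs \<subseteq> F \<times> E" "p = (X xs, Y xs)"
      and ys: "set ys \<subseteq> F \<times> E" "q = (X ys, Y ys)"
      unfolding \<Gamma>_def by blast
    then show "p + q \<in> \<Gamma>"
      unfolding \<Gamma>_def by (intro CollectI exI[of _ "xs @ ys"]) (simp add: X_def Y_def)
  next
    fix c p assume "p \<in> \<Gamma>"
    then obtain xs where xs: "set xs \<subseteq> F \<times> E" "p = (X xs, Y xs)"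
      unfolding \<Gamma>_def by blast
    let ?ys = "map (\<lambda>(f, v). (f, c *\<^sub>C v)) xs"
    have "set ?ys \<subseteq> F \<times> E"
      using xs(1) Es by auto
    moreover have "X ?ys = c *\<^sub>C X xs"
      using xs(1) by (induction xs) (auto simp: X_def tns_scaleC scaleC_add_right)
    moreover have "Y ?ys = c *\<^sub>C Y xs"
      using xs(1) by (induction xs) (auto simp: Y_def tns_scaleC scaleC_add_right M As)
    ultimately show "c *\<^sub>C p \<in> \<Gamma>"
      unfolding \<Gamma>_def xs(2) scaleC_prod_def by (intro CollectI exI[of _ ?ys]) simp
  qed
  have bound: "norm y \<le> K * norm x" if xy: "(x, y) \<in> \<Gamma>" for x y
  proof -
    obtain xs where xs: "set xs \<subseteq> F \<times> E" "x = X xs"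
      "y = Y xs"
      using xy unfolding \<Gamma>_def by blast
    \<comment> \<open>The operator is treated as \<open>I \<otimes> A\<close> after
      \<open>M \<otimes> I\<close>: first \<open>A\<close> is estimated on the tensors with factors
      \<open>M f\<close>, then \<open>M\<close> is removed.\<close>
    have "y = (\<Sum>(f, v)\<leftarrow>map (\<lambda>(f, v). (M f, v)) xs. tns f (A v))"
      by (simp add: xs(3) Y_def case_prod_unfold o_def)
    then have "norm y \<le> K * norm (\<Sum>(f, v)\<leftarrow>map (\<lambda>(f, v). (M f, v)) xs. tns f v)"
      using norm_sum_tns_op_le[OF A K, of "map (\<lambda>(f, v). (M f, v)) xs"] xs(1) M by force
    also have "(\<Sum>(f, v)\<leftarrow>map (\<lambda>(f, v). (M f, v)) xs. tns f v) = (\<Sum>p\<leftarrow>xs. tns (M (fst p)) (snd p))"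
      by (simp add: case_prod_unfold o_def)
    \<comment> \<open>The vectors \<open>b f *\<^sub>C v\<close> supply the part of the Gram matrix
      that \<open>M\<close> loses.\<close>
    also have "norm \<dots> \<le> norm (\<Sum>p\<leftarrow>xs. tns (fst p) (snd p))"
    proof (rule norm_sum_list_le_of_gram[where d = "\<lambda>p. b (fst p) *\<^sub>C snd p"])
      fix p q assume "p \<in> set xs" "q \<in> set xs"
      then have *: "fst p \<in> F" "snd p \<in> E" "fst q \<in> F" "snd q \<in> E"
        using xs(1) by auto
      have "cinner (tns (M (fst p)) (snd p)) (tns (M (fst q)) (snd q)) +
          cinner (b (fst p) *\<^sub>C snd p) (b (fst q) *\<^sub>C snd q)
        = (ip (M (fst p)) (M (fst q)) + b (fst p) * cnj (b (fst q))) * cinner (snd p) (snd q)" (is "?l = _")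
        using * M by (simp add: cinner_tns cinner_scaleC_left cinner_scaleC_right algebra_simps)
      also have "\<dots> = cinner (tns (fst p) (snd p)) (tns (fst q) (snd q))"
        using * by (simp add: b cinner_tns)
      finally show "?l = cinner (tns (fst p) (snd p)) (tns (fst q) (snd q))" .
    qed
    also have "(\<Sum>p\<leftarrow>xs. tns (fst p) (snd p)) = x"
      by (simp add: xs(2) X_def case_prod_unfold)
    finally show ?thesis
      using K(1) by simp
  qed
  obtain R where R: "bounded_clinear_on (closure (fst ` \<Gamma>)) (closure (snd ` \<Gamma>)) R"
    and eq: "\<forall>(x, y)\<in>\<Gamma>. R x = y"
    using extension_from_graph[OF sub bound] by blast
  have gen: "(tns f v, tns (M f) (A v)) \<in> \<Gamma>" if "f \<in> F" "v \<in> E" for f v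
    unfolding \<Gamma>_def using that by (intro CollectI exI[of _ "[(f, v)]"]) (simp add: X_def Y_def)
  have "TS \<subseteq> closure (fst ` \<Gamma>)"
    unfolding tensor_space_def
  proof (intro closure_mono complex_vector.span_minimal)
    show "{tns f v |f v. f \<in> F \<and> v \<in> E} \<subseteq> fst ` \<Gamma>"
      using gen by force
    have "bounded_clinear_on \<Gamma> UNIV fst"
      by (rule bounded_clinear_onI[where K = 1]) (auto simp: scaleC_prod_def norm_fst_le)
    then show "complex_vector.subspace (fst ` \<Gamma>)"
      using sub by (rule csubspace_image)
  qed
  moreover have "closure (snd ` \<Gamma>) \<subseteq> TS"
  proof (rule closure_minimal)
    have "Y xs \<in> TS" if "set xs \<subseteq> F \<times> E" for xs
      using that
      by (induction xs) (auto simp: Y_def closed_csubspaceD[OF closed_csubspace_TS] tns_in M As)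
    then show "snd ` \<Gamma> \<subseteq> TS"
      unfolding \<Gamma>_def by auto
  qed (rule closed_csubspaceD(2)[OF closed_csubspace_TS])
  ultimately have "bounded_clinear_on TS TS R"
    using bounded_clinear_onD(1)[OF R] by (intro bounded_clinear_on_subset[OF R]) blast+
  then show ?thesis
    using eq gen by fast
qed

lemma
  assumes M: "\<And>f. f \<in> F \<Longrightarrow> M f \<in> F"
    and b: "\<And>f g. f \<in> F \<Longrightarrow> g \<in> F \<Longrightarrow> ip (M f) (M g) + b f * cnj (b g) = ip f g"
    and A: "bounded_clinear_on E E A"
  shows bounded_clinear_tensor_op: "bounded_clinear_on TS TS (tensor_op F E tns M A)"
    and tensor_op_tns: "f \<in> F \<Longrightarrow> v \<in> E \<Longrightarrow> tensor_op F E tns M A (tns f v) = tns (M f) (A v)"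
  using someI_ex[OF tensor_op_exists[OF assms]] unfolding tensor_op_def by auto

end

locale orthonormal_tensor = tensor F ip E tns
  for F :: "'f set" and ip :: "'f \<Rightarrow> 'f \<Rightarrow> complex" and E :: "'a::chilbert_space set"
    and tns :: "'f \<Rightarrow> 'a \<Rightarrow> 't::chilbert_space" +
  fixes e :: "'i \<Rightarrow> 'f"
  assumes e_in: "e i \<in> F" and ip_e: "ip (e i) (e j) = (if i = j then 1 else 0)"
begin

lemma
  assumes c: "\<And>i. c i \<in> E" and s: "((\<lambda>i. (norm (c i))\<^sup>2) has_sum s) UNIV"
  shows tns_summable: "(\<lambda>i. tns (e i) (c i)) summable_on I"
    and norm_infsum_tns_sq: "(norm (\<Sum>\<^sub>\<infinity>i. tns (e i) (c i)))\<^sup>2 = s"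
    and infsum_tns_in: "(\<Sum>\<^sub>\<infinity>i. tns (e i) (c i)) \<in> TS"
proof -
  have orth: "cinner (tns (e i) (c i)) (tns (e j) (c j)) = 0" if "i \<noteq> j" for i j
    using that c by (simp add: cinner_tns e_in ip_e)
  have "cinner (tns (e i) (c i)) (tns (e i) (c i)) = cinner (c i) (c i)" for i
    using c by (simp add: cinner_tns e_in ip_e)
  then have "norm (tns (e i) (c i)) = norm (c i)" for i
    by (metis Re_cinner_self norm_ge_zero power2_eq_imp_eq)
  then have s': "((\<lambda>i. (norm (tns (e i) (c i)))\<^sup>2) has_sum s) UNIV"
    using s by simp
  have sum: "(\<lambda>i. tns (e i) (c i)) summable_on UNIV"
    by (rule orthogonal_summable_on[OF orth s'])
  then show "(\<lambda>i. tns (e i) (c i)) summable_on I"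
    by (rule summable_on_subset_banach) simp
  show "(norm (\<Sum>\<^sub>\<infinity>i. tns (e i) (c i)))\<^sup>2 = s"
    by (rule norm_infsum_orthogonal_sq[OF orth s'])
  show "(\<Sum>\<^sub>\<infinity>i. tns (e i) (c i)) \<in> TS"
    by (rule has_sum_in_closed_csubspace[OF closed_csubspace_TS _ has_sum_infsum[OF sum]])
      (simp add: tns_in e_in c)
qed

lemma bounded_clinear_on_infsum_tns:
  assumes T: "bounded_clinear_on TS TS T"
    and c: "\<And>i. c i \<in> E" and s: "((\<lambda>i. (norm (c i))\<^sup>2) has_sum s) UNIV"
  shows "((\<lambda>i. T (tns (e i) (c i))) has_sum T (\<Sum>\<^sub>\<infinity>i. tns (e i) (c i))) UNIV"
  by (rule bounded_clinear_on_has_sum[OF T closed_csubspace_TS _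
        has_sum_infsum[OF tns_summable[OF c s]]]) (simp add: tns_in e_in c)

end

section \<open>The Hardy space and the circle\<close>

text \<open>\<open>T'\<close> only certifies that a choice exists. With a degenerate form, the
  chosen adjoint may differ from it by null functions, so later arguments use these two
  properties.\<close>

lemma adjoint_wrt_exists:
  assumes "\<And>g. g \<in> X \<Longrightarrow> T' g \<in> X" "\<And>f g. f \<in> X \<Longrightarrow> g \<in> X \<Longrightarrow> ip (T f) g = ip f (T' g)"
  shows "g \<in> X \<Longrightarrow> adjoint_wrt X ip T g \<in> X"
    and "f \<in> X \<Longrightarrow> g \<in> X \<Longrightarrow> ip f (adjoint_wrt X ip T g) = ip (T f) g"
proof -
  let ?P = "\<lambda>T'. (\<forall>x\<in>X. T' x \<in> X) \<and> (\<forall>x\<in>X. \<forall>y\<in>X. ip (T x) y = ip x (T' y))"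
  have "?P (SOME T'. ?P T')"
    by (rule someI[of ?P T']) (use assms in auto)
  then show "g \<in> X \<Longrightarrow> adjoint_wrt X ip T g \<in> X"
    "f \<in> X \<Longrightarrow> g \<in> X \<Longrightarrow> ip f (adjoint_wrt X ip T g) = ip (T f) g"
    unfolding adjoint_wrt_def by auto
qed

section \<open>Taylor coefficients, monomials and the backward shift\<close>

lemma taylor_coeff_eqI: "f has_fps_expansion F \<Longrightarrow> taylor_coeff f k = fps_nth F k"
  by (simp add: taylor_coeff_def fps_nth_fps_expansion)

lemma hardy2_fps:
  assumes "f \<in> hardy2"
  shows "f has_fps_expansion fps_expansion f 0" "fps_conv_radius (fps_expansion f 0) \<ge> 1"
    "fps_nth (fps_expansion f 0) k = taylor_coeff f k"
proof -
  have hol: "f holomorphic_on ball 0 1"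
    using assms by (simp add: hardy2_def)
  then show 1: "f has_fps_expansion fps_expansion f 0"
    by (intro has_fps_expansion_fps_expansion[of "ball 0 1"]) auto
  have "f holomorphic_on eball 0 (ereal 1)"
    using hol by simp
  from conv_radius_fps_expansion[OF this] show "fps_conv_radius (fps_expansion f 0) \<ge> 1"
    by (simp add: one_ereal_def)
  show "fps_nth (fps_expansion f 0) k = taylor_coeff f k"
    using taylor_coeff_eqI[OF 1] by simp
qed

lemma summable_hardy2:
  assumes "f \<in> hardy2" "g \<in> hardy2"
  shows "summable (\<lambda>k. taylor_coeff f k * cnj (taylor_coeff g k))"
proof (rule summable_comparison_test'[where N = 0])
  show "summable (\<lambda>k. (cmod (taylor_coeff f k))\<^sup>2 + (cmod (taylor_coeff g k))\<^sup>2)"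
    using assms by (intro summable_add) (auto simp: hardy2_def)
  show "norm (taylor_coeff f k * cnj (taylor_coeff g k))
      \<le> (cmod (taylor_coeff f k))\<^sup>2 + (cmod (taylor_coeff g k))\<^sup>2" for k
  proof -
    have "2 * norm (taylor_coeff f k * cnj (taylor_coeff g k))
        \<le> (cmod (taylor_coeff f k))\<^sup>2 + (cmod (taylor_coeff g k))\<^sup>2"
      using sum_squares_bound[of "cmod (taylor_coeff f k)" "cmod (taylor_coeff g k)"]
      by (simp add: norm_mult)
    then show ?thesis
      using norm_ge_zero[of "taylor_coeff f k * cnj (taylor_coeff g k)"] by linarith
  qed
qed

lemma taylor_coeff_mult_z:
  assumes "f \<in> hardy2"
  shows "taylor_coeff (mult_z f) k = (if k = 0 then 0 else taylor_coeff f (k - 1))"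
proof -
  have "mult_z f has_fps_expansion fps_X * fps_expansion f 0"
    unfolding mult_z_def by (intro has_fps_expansion_mult has_fps_expansion_fps_X hardy2_fps(1) assms)
  then show ?thesis
    using taylor_coeff_eqI hardy2_fps(3)[OF assms] by simp
qed

lemma
  shows taylor_coeff_monomial: "taylor_coeff (\<lambda>z. z ^ n) k = (if k = n then 1 else 0)"
    and monomial_in_hardy2: "(\<lambda>z. z ^ n) \<in> hardy2"
proof -
  have "(\<lambda>z. z ^ n) has_fps_expansion (fps_X ^ n :: complex fps)"
    by (rule has_fps_expansion_fps_X_power)
  from taylor_coeff_eqI[OF this] show 1: "taylor_coeff (\<lambda>z. z ^ n) k = (if k = n then 1 else 0)" for k
    by (simp add: fps_X_power_nth)
  have "summable (\<lambda>k. (cmod (taylor_coeff (\<lambda>z. z ^ n) k))\<^sup>2)"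
    by (rule summable_finite[of "{n}"]) (auto simp: 1)
  then show "(\<lambda>z. z ^ n) \<in> hardy2"
    by (simp add: hardy2_def holomorphic_intros)
qed

lemma hardy2_inner_cong:
  assumes "\<And>k. taylor_coeff f k = taylor_coeff f' k" "\<And>k. taylor_coeff g k = taylor_coeff g' k"
  shows "hardy2_inner f g = hardy2_inner f' g'"
  by (simp add: hardy2_inner_def assms)

lemma hardy2_inner_monomial: "hardy2_inner (\<lambda>z. z ^ n) g = cnj (taylor_coeff g n)"
proof -
  have "suminf (\<lambda>k. (if k = n then 1 else 0) * cnj (taylor_coeff g k))
      = (\<Sum>k\<in>{n}. (if k = n then 1 else 0) * cnj (taylor_coeff g k))"
    by (rule suminf_finite) auto
  then show ?thesis
    by (simp add: hardy2_inner_def taylor_coeff_monomial)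
qed

abbreviation "hardy_Mz_adj \<equiv> adjoint_wrt hardy2 hardy2_inner mult_z"

text \<open>The map from \<open>f\<close> to \<open>(f z - f 0) / z\<close>, which certifies the
  adjoint of multiplication by \<open>z\<close>. As a power series it needs no treatment of the
  removable singularity.\<close>

definition backward_shift :: "(complex \<Rightarrow> complex) \<Rightarrow> complex \<Rightarrow> complex" where
  "backward_shift f = eval_fps (fps_shift 1 (fps_expansion f 0))"

lemma
  assumes f: "f \<in> hardy2"
  shows taylor_coeff_backward_shift: "taylor_coeff (backward_shift f) k = taylor_coeff f (Suc k)"
    and backward_shift_in_hardy2: "backward_shift f \<in> hardy2"
proof -
  let ?F = "fps_shift 1 (fps_expansion f 0)"
  have r: "fps_conv_radius ?F \<ge> 1"
    using hardy2_fps(2)[OF f] by simp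
  then have "fps_conv_radius ?F > 0"
    by (rule less_le_trans[rotated]) simp
  then have "backward_shift f has_fps_expansion ?F"
    unfolding backward_shift_def by (rule eval_fps_has_fps_expansion)
  then show 1: "taylor_coeff (backward_shift f) k = taylor_coeff f (Suc k)" for k
    using taylor_coeff_eqI hardy2_fps(3)[OF f] by simp
  have "ball 0 1 \<subseteq> eball 0 (fps_conv_radius ?F)"
    using r by (intro ball_eball_mono) (simp add: one_ereal_def)
  then have "backward_shift f holomorphic_on ball 0 1"
    unfolding backward_shift_def by (rule holomorphic_on_eval_fps)
  moreover have "summable (\<lambda>k. (cmod (taylor_coeff f (Suc k)))\<^sup>2)"
    using f by (subst summable_Suc_iff) (simp add: hardy2_def)
  ultimately show "backward_shift f \<in> hardy2"
    by (simp add: hardy2_def 1)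
qed

lemma mult_z_in_hardy2:
  assumes f: "f \<in> hardy2"
  shows "mult_z f \<in> hardy2"
proof -
  have "summable (\<lambda>k. (cmod (taylor_coeff (mult_z f) (Suc k)))\<^sup>2)"
    using f by (simp add: taylor_coeff_mult_z) (simp add: hardy2_def)
  then have "summable (\<lambda>k. (cmod (taylor_coeff (mult_z f) k))\<^sup>2)"
    by (subst (asm) summable_Suc_iff)
  moreover have "mult_z f holomorphic_on ball 0 1"
    using f unfolding mult_z_def by (auto simp: hardy2_def intro!: holomorphic_intros)
  ultimately show ?thesis
    by (simp add: hardy2_def)
qed

lemma hardy2_inner_backward_shift:
  assumes f: "f \<in> hardy2" and g: "g \<in> hardy2"
  shows "hardy2_inner (mult_z f) g = hardy2_inner f (backward_shift g)"
  using suminf_split_head[OF summable_hardy2[OF mult_z_in_hardy2[OF f] g]]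
  by (simp add: hardy2_inner_def taylor_coeff_mult_z[OF f] taylor_coeff_backward_shift[OF g])

lemma Mz_adj_in: "g \<in> hardy2 \<Longrightarrow> hardy_Mz_adj g \<in> hardy2"
  by (rule adjoint_wrt_exists(1)[where X = hardy2 and ip = hardy2_inner
        and T = mult_z and T' = backward_shift])
    (simp_all only: backward_shift_in_hardy2 hardy2_inner_backward_shift)

lemma hardy2_inner_Mz_adj_right:
  "f \<in> hardy2 \<Longrightarrow> g \<in> hardy2 \<Longrightarrow> hardy2_inner f (hardy_Mz_adj g) = hardy2_inner (mult_z f) g"
  by (rule adjoint_wrt_exists(2)[where X = hardy2 and ip = hardy2_inner
        and T = mult_z and T' = backward_shift])
    (simp_all only: backward_shift_in_hardy2 hardy2_inner_backward_shift)

text \<open>Testing the chosen adjoint against the monomials recovers its coefficients.\<close>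

lemma taylor_coeff_Mz_adj:
  assumes g: "g \<in> hardy2"
  shows "taylor_coeff (hardy_Mz_adj g) k = taylor_coeff g (Suc k)"
proof -
  have "hardy2_inner (\<lambda>z. z ^ k) (hardy_Mz_adj g) = hardy2_inner (mult_z (\<lambda>z. z ^ k)) g"
    by (rule hardy2_inner_Mz_adj_right[OF monomial_in_hardy2 g])
  also have "mult_z (\<lambda>z. z ^ k) = (\<lambda>z. z ^ Suc k)"
    by (simp add: mult_z_def)
  finally show ?thesis
    unfolding hardy2_inner_monomial by simp
qed

text \<open>The constant coefficient, lost under the shift, gives the rank one correction that
  \<open>tensor_op_exists\<close> asks for.\<close>

lemma hardy2_inner_Mz_adj:
  assumes "f \<in> hardy2" "g \<in> hardy2"
  shows "hardy2_inner (hardy_Mz_adj f) (hardy_Mz_adj g) + taylor_coeff f 0 * cnj (taylor_coeff g 0) = hardy2_inner f g"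
  using suminf_split_head[OF summable_hardy2[OF assms]]
  by (simp add: hardy2_inner_def taylor_coeff_Mz_adj assms)

lemma hardy2_inner_monomials:
  "hardy2_inner (\<lambda>z. z ^ i) (\<lambda>z. z ^ j) = (if i = j then 1 else 0)"
  by (simp add: hardy2_inner_monomial taylor_coeff_monomial)

locale hardy_tensor = tensor hardy2 hardy2_inner E tns
  for E :: "'a::chilbert_space set" and tns :: "(complex \<Rightarrow> complex) \<Rightarrow> 'a \<Rightarrow> 't::chilbert_space"

sublocale hardy_tensor \<subseteq> orthonormal_tensor hardy2 hardy2_inner E tns "\<lambda>n z. z ^ n"
  by unfold_locales (auto simp: monomial_in_hardy2 hardy2_inner_monomials)

context hardy_tensor
begin

text \<open>The chosen adjoint fixes no values outside the disc, so the functions themselves need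
  not coincide; equality of coefficients suffices for equality of the tensors.\<close>

lemma tns_Mz_adj_monomial:
  assumes "v \<in> E"
  shows "tns (hardy_Mz_adj (\<lambda>z. z ^ Suc n)) v = tns (\<lambda>z. z ^ n) v" "tns (hardy_Mz_adj (\<lambda>z. z ^ 0)) v = 0"
proof -
  have c: "taylor_coeff (hardy_Mz_adj (\<lambda>z. z ^ Suc n)) k = taylor_coeff (\<lambda>z. z ^ n) k" for k
    by (subst taylor_coeff_Mz_adj) (simp_all add: monomial_in_hardy2 taylor_coeff_monomial
        flip: power_Suc)
  show "tns (hardy_Mz_adj (\<lambda>z. z ^ Suc n)) v = tns (\<lambda>z. z ^ n) v"
    by (rule tns_cong[OF Mz_adj_in[OF monomial_in_hardy2] monomial_in_hardy2 assms, where c = 1])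
      (simp_all only: hardy2_inner_cong[OF c c] hardy2_inner_cong[OF c refl]
        hardy2_inner_cong[OF refl c] hardy2_inner_monomials if_True simp_thms)
  have "taylor_coeff (hardy_Mz_adj (\<lambda>z. z ^ 0)) k = 0" for k
    by (subst taylor_coeff_Mz_adj) (simp_all only: monomial_in_hardy2 taylor_coeff_monomial, simp)
  then have "hardy2_inner (hardy_Mz_adj (\<lambda>z. z ^ 0)) (hardy_Mz_adj (\<lambda>z. z ^ 0)) = 0"
    by (simp only: hardy2_inner_def) simp
  then show "tns (hardy_Mz_adj (\<lambda>z. z ^ 0)) v = 0"
    by (rule tns_null[OF Mz_adj_in[OF monomial_in_hardy2] assms])
qed

end

section \<open>Arc length on the circle and the Fourier basis\<close>

lemma borel_measurable_cis [measurable]: "cis \<in> borel_measurable borel"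
  by (intro borel_measurable_continuous_onI continuous_intros)

lemma borel_measurable_cnj [measurable]: "cnj \<in> borel_measurable borel"
  by (intro borel_measurable_continuous_onI continuous_intros)

lemma cis_measurable_uniform: "cis \<in> measurable (uniform_measure lborel {0..2 * pi}) borel"
  by measurable

lemma sets_circle_measure [simp, measurable_cong]: "sets circle_measure = sets borel"
  by (simp add: circle_measure_def)

lemma space_circle_measure [simp]: "space circle_measure = UNIV"
  by (simp add: circle_measure_def)

lemma finite_measure_circle: "finite_measure circle_measure"
proof (rule finite_measureI)
  have "emeasure circle_measure (space circle_measure) = emeasure (uniform_measure lborel {0..2 * pi}) UNIV"
    unfolding circle_measure_def by (subst emeasure_distr) (auto simp: cis_measurable_uniform)
  also have "\<dots> = 1"
    by (subst emeasure_uniform_measure) (auto simp: divide_ennreal)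
  finally show "emeasure circle_measure (space circle_measure) \<noteq> \<infinity>"
    by simp
qed

lemma AE_circle: "AE z in circle_measure. cmod z = 1"
  unfolding circle_measure_def
  by (subst AE_distr_iff) (auto simp: cis_measurable_uniform)

lemma integral_circle:
  fixes f :: "complex \<Rightarrow> complex"
  assumes f: "f \<in> borel_measurable borel"
  shows "(\<integral>z. f z \<partial>circle_measure) = (\<integral>t. indicator {0..2 * pi} t *\<^sub>R f (cis t) \<partial>lborel) / (2 * pi)"
proof -
  note f[measurable]
  have "(\<integral>z. f z \<partial>circle_measure) = (\<integral>t. f (cis t) \<partial>uniform_measure lborel {0..2 * pi})"
    unfolding circle_measure_def by (rule integral_distr[OF cis_measurable_uniform f])
  also have "uniform_measure lborel {0..2 * pi} = density lborel (\<lambda>t. ennreal (indicator {0..2 * pi} t / (2 * pi)))"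
    unfolding uniform_measure_def
    by (intro density_cong) (auto simp: indicator_def divide_ennreal simp flip: ennreal_1)
  also have "(\<integral>t. f (cis t) \<partial>density lborel (\<lambda>t. ennreal (indicator {0..2 * pi} t / (2 * pi))))
      = (\<integral>t. (indicator {0..2 * pi} t / (2 * pi)) *\<^sub>R f (cis t) \<partial>lborel)"
    by (rule integral_density) auto
  also have "\<dots> = (\<integral>t. (indicator {0..2 * pi} t *\<^sub>R f (cis t)) / (2 * pi) \<partial>lborel)"
    by (intro Bochner_Integration.integral_cong refl) (simp add: scaleR_conv_of_real)
  also have "\<dots> = (\<integral>t. indicator {0..2 * pi} t *\<^sub>R f (cis t) \<partial>lborel) / (2 * pi)"
    by (rule integral_divide_zero)
  finally show ?thesis .
qed

lemma borel_measurable_power_int: "(\<lambda>z::complex. z powi k) \<in> borel_measurable borel"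
  by (cases "k \<ge> 0") (simp_all add: power_int_def)

lemma power_int_in_circle_L2: "(\<lambda>z. z powi k) \<in> circle_L2"
proof -
  interpret finite_measure circle_measure
    by (rule finite_measure_circle)
  have "integrable circle_measure (\<lambda>z. (cmod (z powi k))\<^sup>2) \<longleftrightarrow> integrable circle_measure (\<lambda>_. 1 :: real)"
  proof (rule integrable_cong_AE)
    show "AE z in circle_measure. (cmod (z powi k))\<^sup>2 = 1"
      using AE_circle by eventually_elim (simp add: norm_power_int)
  qed (use borel_measurable_power_int[of k] in measurable)
  then show ?thesis
    using borel_measurable_power_int by (simp add: circle_L2_def)
qed

lemma integral_cis_circle:
  "(\<integral>t. indicator {0..2 * pi} t *\<^sub>R cis (of_int m * t) \<partial>lborel) = (if m = 0 then 2 * pi else 0)"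
proof (cases "m = 0")
  case True
  then show ?thesis
    by (simp add: scaleR_conv_of_real one_complex.ctr[symmetric])
next
  case False
  define F where "F t = cis (of_int m * t) / (\<i> * of_int m)" for t :: real
  have "(\<integral>t. indicator {0..2 * pi} t *\<^sub>R cis (of_int m * t) \<partial>lborel) = F (2 * pi) - F 0"
  proof (rule integral_FTC_atLeastAtMost)
    show "(F has_vector_derivative cis (of_int m * t)) (at t within {0..2 * pi})" for t
    proof -
      have "((\<lambda>z. exp (\<i> * of_int m * z) / (\<i> * of_int m)) has_field_derivative
          exp (\<i> * of_int m * of_real t)) (at (of_real t))"
        using False by (auto intro!: derivative_eq_intros)
      from has_vector_derivative_real_field[OF this]
      show ?thesis
        by (simp add: F_def[abs_def] cis_conv_exp mult_ac)
    qed
    show "continuous_on {0..2 * pi} (\<lambda>t. cis (of_int m * t))"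
      by (intro continuous_intros)
  qed simp
  also have "cis (of_int m * (2 * pi)) = 1"
    using cis_multiple_2pi[of "of_int m"] by (simp add: mult_ac)
  then have "F (2 * pi) - F 0 = 0"
    by (simp add: F_def)
  finally show ?thesis
    using False by simp
qed

lemma circle_L2_inner_power_int:
  "circle_L2_inner (\<lambda>z. z powi i) (\<lambda>z. z powi j) = (if i = j then 1 else 0)"
proof -
  have "circle_L2_inner (\<lambda>z. z powi i) (\<lambda>z. z powi j)
      = (\<integral>t. indicator {0..2 * pi} t *\<^sub>R (cis t powi i * cnj (cis t powi j)) \<partial>lborel) / (2 * pi)"
    unfolding circle_L2_inner_def
    using borel_measurable_power_int[measurable] by (intro integral_circle) measurable
  moreover have "cis t powi i * cnj (cis t powi j) = cis (of_int (i - j) * t)" for t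
    by (simp add: cis_power_int cis_mult cis_cnj algebra_simps)
  ultimately show ?thesis
    by (simp only: integral_cis_circle) simp
qed

abbreviation "circle_Mz_adj \<equiv> adjoint_wrt circle_L2 circle_L2_inner mult_z"

lemma circle_L2_unimodular_mult:
  assumes f: "f \<in> circle_L2" and c: "c \<in> borel_measurable borel" "\<And>z. cmod z = 1 \<Longrightarrow> cmod (c z) = 1"
  shows "(\<lambda>z. c z * f z) \<in> circle_L2"
proof -
  note c(1)[measurable]
  have [measurable]: "f \<in> borel_measurable borel"
    using f by (simp add: circle_L2_def)
  have "integrable circle_measure (\<lambda>z. (cmod (c z * f z))\<^sup>2) \<longleftrightarrow> integrable circle_measure (\<lambda>z. (cmod (f z))\<^sup>2)"
  proof (rule integrable_cong_AE)
    show "AE z in circle_measure. (cmod (c z * f z))\<^sup>2 = (cmod (f z))\<^sup>2"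
      using AE_circle by eventually_elim (simp add: norm_mult c(2))
  qed measurable
  then show ?thesis
    using f by (simp add: circle_L2_def)
qed

lemma mult_z_in_circle_L2: "f \<in> circle_L2 \<Longrightarrow> mult_z f \<in> circle_L2"
  unfolding mult_z_def by (rule circle_L2_unimodular_mult) auto

lemma mult_cnj_in_circle_L2: "f \<in> circle_L2 \<Longrightarrow> (\<lambda>z. cnj z * f z) \<in> circle_L2"
  by (rule circle_L2_unimodular_mult) auto

lemma circle_L2_inner_mult_z: "circle_L2_inner (mult_z f) g = circle_L2_inner f (\<lambda>z. cnj z * g z)"
  by (simp add: circle_L2_inner_def mult_z_def mult_ac)

lemma circle_L2_inner_cnj: "circle_L2_inner g f = cnj (circle_L2_inner f g)"
  unfolding circle_L2_inner_def Bochner_Integration.integral_cnj[symmetric] by (simp add: mult_ac)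

lemma circle_L2_inner_cong_AE:
  assumes "f \<in> circle_L2" "f' \<in> circle_L2" "g \<in> circle_L2" "AE z in circle_measure. f z = f' z"
  shows "circle_L2_inner f g = circle_L2_inner f' g"
proof -
  have [measurable]: "f \<in> borel_measurable borel" "f' \<in> borel_measurable borel" "g \<in> borel_measurable borel"
    using assms by (auto simp: circle_L2_def)
  show ?thesis
    unfolding circle_L2_inner_def
  proof (rule integral_cong_AE)
    show "AE z in circle_measure. f z * cnj (g z) = f' z * cnj (g z)"
      using assms(4) by eventually_elim simp
  qed measurable
qed

lemma Me_adj_in: "g \<in> circle_L2 \<Longrightarrow> circle_Mz_adj g \<in> circle_L2"
  by (rule adjoint_wrt_exists(1)[where X = circle_L2 and ip = circle_L2_inner
        and T = mult_z and T' = "\<lambda>g z. cnj z * g z"])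
    (simp_all only: mult_cnj_in_circle_L2 circle_L2_inner_mult_z)

lemma circle_L2_inner_Me_adj:
  "f \<in> circle_L2 \<Longrightarrow> g \<in> circle_L2 \<Longrightarrow> circle_L2_inner f (circle_Mz_adj g) = circle_L2_inner (mult_z f) g"
  by (rule adjoint_wrt_exists(2)[where X = circle_L2 and ip = circle_L2_inner
        and T = mult_z and T' = "\<lambda>g z. cnj z * g z"])
    (simp_all only: mult_cnj_in_circle_L2 circle_L2_inner_mult_z)

text \<open>One adjoint is moved across as multiplication by \<open>z\<close>, which moves back as
  multiplication by \<open>cnj z\<close>; after conjugation the other adjoint can be moved as well.
  The two factors cancel since \<open>z * cnj z = 1\<close> almost everywhere.\<close>

lemma circle_L2_inner_Me_adj_Me_adj:
  assumes f: "f \<in> circle_L2" and g: "g \<in> circle_L2"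
  shows "circle_L2_inner (circle_Mz_adj f) (circle_Mz_adj g) = circle_L2_inner f g"
proof -
  have cg: "(\<lambda>z. cnj z * g z) \<in> circle_L2"
    by (rule mult_cnj_in_circle_L2[OF g])
  have "circle_L2_inner (circle_Mz_adj f) (circle_Mz_adj g) = circle_L2_inner (mult_z (circle_Mz_adj f)) g"
    by (rule circle_L2_inner_Me_adj[OF Me_adj_in[OF f] g])
  also have "\<dots> = cnj (circle_L2_inner (\<lambda>z. cnj z * g z) (circle_Mz_adj f))"
    unfolding circle_L2_inner_mult_z by (rule circle_L2_inner_cnj)
  also have "\<dots> = cnj (circle_L2_inner (mult_z (\<lambda>z. cnj z * g z)) f)"
    by (simp add: circle_L2_inner_Me_adj[OF cg f])
  also have "circle_L2_inner (mult_z (\<lambda>z. cnj z * g z)) f = circle_L2_inner g f"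
  proof (rule circle_L2_inner_cong_AE[OF mult_z_in_circle_L2[OF cg] g f])
    show "AE z in circle_measure. mult_z (\<lambda>z. cnj z * g z) z = g z"
      using AE_circle
    proof eventually_elim
      fix z assume "cmod z = 1"
      then have "z * cnj z = 1"
        by (simp flip: complex_norm_square)
      then show "mult_z (\<lambda>z. cnj z * g z) z = g z"
        by (simp add: mult_z_def mult.assoc[symmetric])
    qed
  qed
  also have "cnj (circle_L2_inner g f) = circle_L2_inner f g"
    by (rule circle_L2_inner_cnj[symmetric])
  finally show ?thesis .
qed

locale circle_tensor = tensor circle_L2 circle_L2_inner E tns
  for E :: "'a::chilbert_space set" and tns :: "(complex \<Rightarrow> complex) \<Rightarrow> 'a \<Rightarrow> 't::chilbert_space"

sublocale circle_tensor \<subseteq> orthonormal_tensor circle_L2 circle_L2_inner E tns "\<lambda>k z. z powi k"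
  by unfold_locales (auto simp: power_int_in_circle_L2 circle_L2_inner_power_int)

context circle_tensor
begin

lemma tns_Me_adj_power_int:
  assumes "v \<in> E"
  shows "tns (circle_Mz_adj (\<lambda>z. z powi (k + 1))) v = tns (\<lambda>z. z powi k) v"
proof -
  let ?f = "circle_Mz_adj (\<lambda>z. z powi (k + 1))" and ?g = "\<lambda>z::complex. z powi k"
  note in_L2 = power_int_in_circle_L2
  have "circle_L2_inner ?g ?f = circle_L2_inner (mult_z ?g) (\<lambda>z. z powi (k + 1))"
    by (rule circle_L2_inner_Me_adj[OF in_L2 in_L2])
  also have "\<dots> = circle_L2_inner (\<lambda>z. z powi (k + 1)) (\<lambda>z. z powi (k + 1))"
  proof (rule circle_L2_inner_cong_AE[OF mult_z_in_circle_L2[OF in_L2] in_L2 in_L2])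
    \<comment> \<open>At \<open>z = 0\<close> the power law fails for \<open>k = -1\<close>, where
      the values are 0 and 1; the origin is a null set for arc length.\<close>
    show "AE z in circle_measure. mult_z ?g z = z powi (k + 1)"
      using AE_circle
    proof eventually_elim
      fix z assume "cmod z = 1"
      then have "z \<noteq> 0"
        by auto
      then show "mult_z ?g z = z powi (k + 1)"
        by (simp add: mult_z_def power_int_add)
    qed
  qed
  finally have 1: "circle_L2_inner ?g ?f = 1"
    by (simp add: circle_L2_inner_power_int)
  have "circle_L2_inner ?f ?g = 1"
    by (subst circle_L2_inner_cnj) (simp add: 1)
  then show ?thesis
    using 1 by (intro tns_cong[OF Me_adj_in[OF in_L2] in_L2 assms, where c = 1])
      (simp_all add: circle_L2_inner_Me_adj_Me_adj in_L2 circle_L2_inner_power_int)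
qed

end

section \<open>The model space\<close>

context orthonormal_tensor
begin

lemma
  assumes A: "bounded_clinear_on E E A"
  shows bounded_clinear_tensor_op_id: "bounded_clinear_on TS TS (tensor_op F E tns id A)"
    and tensor_op_id_tns: "f \<in> F \<Longrightarrow> v \<in> E \<Longrightarrow> tensor_op F E tns id A (tns f v) = tns f (A v)"
  using bounded_clinear_tensor_op[where M = id and b = "\<lambda>_. 0", OF _ _ A]
    tensor_op_tns[where M = id and b = "\<lambda>_. 0", OF _ _ A] by simp_all

lemma tensor_op_id_has_sum:
  assumes A: "bounded_clinear_on E E A"
    and c: "\<And>i. c i \<in> E" and s: "((\<lambda>i. (norm (c i))\<^sup>2) has_sum s) UNIV"
  shows "((\<lambda>i. tns (e i) (A (c i))) has_sum tensor_op F E tns id A (\<Sum>\<^sub>\<infinity>i. tns (e i) (c i))) UNIV"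
  using bounded_clinear_on_infsum_tns[OF bounded_clinear_tensor_op_id[OF A] c s]
  by (simp only: tensor_op_id_tns[OF A e_in c])

end

context hardy_tensor
begin

lemmas Mz_adj_gram = Mz_adj_in hardy2_inner_Mz_adj

lemma bounded_clinear_tensor_op_Mz_adj:
  "bounded_clinear_on E E A \<Longrightarrow> bounded_clinear_on TS TS (tensor_op hardy2 E tns hardy_Mz_adj A)"
  by (rule bounded_clinear_tensor_op[OF Mz_adj_gram])

lemma tensor_op_Mz_adj_has_sum:
  assumes A: "bounded_clinear_on E E A"
    and c: "\<And>k. c k \<in> E" and s: "((\<lambda>k. (norm (c k))\<^sup>2) has_sum s) UNIV"
  shows "((\<lambda>k. tns (\<lambda>z. z ^ k) (A (c (Suc k)))) has_sum
    tensor_op hardy2 E tns hardy_Mz_adj A (\<Sum>\<^sub>\<infinity>k. tns (\<lambda>z. z ^ k) (c k))) UNIV"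
proof -
  let ?T = "tensor_op hardy2 E tns hardy_Mz_adj A"
  let ?f = "\<lambda>k. ?T (tns (\<lambda>z. z ^ k) (c k))"
  note As = bounded_clinear_onD(1)[OF A c]
  have f: "?f k = tns (hardy_Mz_adj (\<lambda>z. z ^ k)) (A (c k))" for k
    by (rule tensor_op_tns[OF Mz_adj_gram A monomial_in_hardy2 c])
  have "(?f has_sum ?T (\<Sum>\<^sub>\<infinity>k. tns (\<lambda>z. z ^ k) (c k))) UNIV"
    by (rule bounded_clinear_on_infsum_tns[OF bounded_clinear_tensor_op_Mz_adj[OF A] c s])
  \<comment> \<open>The shift annihilates the constant term, so the index set shrinks to the
    successors and can be reindexed.\<close>
  moreover have "?f k = 0" if "k \<in> UNIV - range Suc" for k
  proof -
    have "k = 0"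
      using that by (cases k) auto
    then show ?thesis
      unfolding f using tns_Mz_adj_monomial(2)[OF As] by simp
  qed
  ultimately have "(?f has_sum ?T (\<Sum>\<^sub>\<infinity>k. tns (\<lambda>z. z ^ k) (c k))) (range Suc)"
    by (subst has_sum_cong_neutral[where T = UNIV and g = ?f]) auto
  then have "((\<lambda>k. ?f (Suc k)) has_sum ?T (\<Sum>\<^sub>\<infinity>k. tns (\<lambda>z. z ^ k) (c k))) UNIV"
    by (simp only: has_sum_reindex inj_Suc o_def)
  then show ?thesis
    unfolding f by (simp only: tns_Mz_adj_monomial(1)[OF As])
qed

end

context circle_tensor
begin

lemma
  assumes A: "bounded_clinear_on E E A"
  shows bounded_clinear_tensor_op_Me_adj: "bounded_clinear_on TS TS (tensor_op circle_L2 E tns circle_Mz_adj A)"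
    and tensor_op_Me_adj_tns: "f \<in> circle_L2 \<Longrightarrow> v \<in> E \<Longrightarrow>
      tensor_op circle_L2 E tns circle_Mz_adj A (tns f v) = tns (circle_Mz_adj f) (A v)"
proof -
  have gram: "circle_L2_inner (circle_Mz_adj f) (circle_Mz_adj g) + 0 * cnj 0 = circle_L2_inner f g"
    if "f \<in> circle_L2" "g \<in> circle_L2" for f g
    using that by (simp add: circle_L2_inner_Me_adj_Me_adj)
  show "bounded_clinear_on TS TS (tensor_op circle_L2 E tns circle_Mz_adj A)"
    by (rule bounded_clinear_tensor_op[OF Me_adj_in gram A])
  show "f \<in> circle_L2 \<Longrightarrow> v \<in> E \<Longrightarrow>
      tensor_op circle_L2 E tns circle_Mz_adj A (tns f v) = tns (circle_Mz_adj f) (A v)"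
    by (rule tensor_op_tns[OF Me_adj_in gram A])
qed

lemma tensor_op_Me_adj_has_sum:
  assumes A: "bounded_clinear_on E E A"
    and c: "\<And>k. c k \<in> E" and s: "((\<lambda>k. (norm (c k))\<^sup>2) has_sum s) UNIV"
  shows "((\<lambda>k. tns (\<lambda>z. z powi k) (A (c (k + 1)))) has_sum
    tensor_op circle_L2 E tns circle_Mz_adj A (\<Sum>\<^sub>\<infinity>k. tns (\<lambda>z. z powi k) (c k))) UNIV"
proof -
  let ?T = "tensor_op circle_L2 E tns circle_Mz_adj A"
  let ?f = "\<lambda>k. ?T (tns (\<lambda>z. z powi k) (c k))"
  have f: "?f k = tns (circle_Mz_adj (\<lambda>z. z powi k)) (A (c k))" for k
    by (rule tensor_op_Me_adj_tns[OF A power_int_in_circle_L2 c])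
  have inj: "inj (\<lambda>k::int. k + 1)" and surj: "range (\<lambda>k::int. k + 1) = UNIV"
    by (auto simp: inj_def surj_def intro: exI[of _ "x - 1" for x])
  have "(?f has_sum ?T (\<Sum>\<^sub>\<infinity>k. tns (\<lambda>z. z powi k) (c k))) (range (\<lambda>k. k + 1))"
    unfolding surj
    by (rule bounded_clinear_on_infsum_tns[OF bounded_clinear_tensor_op_Me_adj[OF A] c s])
  then have "((\<lambda>k. ?f (k + 1)) has_sum ?T (\<Sum>\<^sub>\<infinity>k. tns (\<lambda>z. z powi k) (c k))) UNIV"
    by (simp only: has_sum_reindex inj o_def)
  then show ?thesis
    unfolding f by (simp only: tns_Me_adj_power_int[OF bounded_clinear_onD(1)[OF A c]])
qed

end

lemma bounded_clinear_on_map_prod: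
  assumes S: "bounded_clinear_on E E' S" and T: "bounded_clinear_on F F' T"
  shows "bounded_clinear_on (E \<times> F) (E' \<times> F') (map_prod S T)"
proof -
  obtain K where K: "K > 0" "\<And>x. x \<in> E \<Longrightarrow> norm (S x) \<le> K * norm x"
    using bounded_clinear_on_bound[OF S] by blast
  obtain L where L: "L > 0" "\<And>x. x \<in> F \<Longrightarrow> norm (T x) \<le> L * norm x"
    using bounded_clinear_on_bound[OF T] by blast
  show ?thesis
  proof (rule bounded_clinear_onI[where K = "K + L"])
    fix p assume "p \<in> E \<times> F"
    then obtain x y where p: "p = (x, y)" "x \<in> E" "y \<in> F"
      by blast
    have "norm (map_prod S T p) \<le> norm (S x) + norm (T y)"
      by (simp add: p norm_Pair_le)
    also have "\<dots> \<le> K * norm x + L * norm y"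
      using K L p by (intro add_mono) auto
    also have "\<dots> \<le> K * norm p + L * norm p"
      using K L norm_fst_le[of x y] norm_snd_le[of y x] p
      by (intro add_mono mult_left_mono) auto
    finally show "norm (map_prod S T p) \<le> (K + L) * norm p"
      by (simp add: algebra_simps)
  qed (auto simp: bounded_clinear_onD[OF S] bounded_clinear_onD[OF T] scaleC_prod_def)
qed

context contraction
begin

lemma cinner_D_cadjoint_on_D:
  assumes X: "bounded_clinear_on DS DS X"
  shows "cinner z (D (cadjoint_on DS X (D y))) = cinner (D (X (D z))) y"
  using cinner_cadjoint_on[OF closed_csubspace_DS X D_in D_in]
  by (simp add: cinner_D flip: cinner_D)

end

section \<open>The isometry \<open>W\<close> and its intertwining relations\<close>

locale durszt_model = cnu_contraction P
  for P :: "'h::chilbert_space \<Rightarrow> 'h" +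
  fixes tns1 :: "(complex \<Rightarrow> complex) \<Rightarrow> 'h \<Rightarrow> 't::chilbert_space"
    and tns2 :: "(complex \<Rightarrow> complex) \<Rightarrow> 'h \<Rightarrow> 'u::chilbert_space"
  assumes tns1: "hilbert_tensor hardy2 hardy2_inner (defect_space P) tns1"
    and tns2: "hilbert_tensor circle_L2 circle_L2_inner (defect_space (cadjoint P)) tns2"

sublocale durszt_model \<subseteq> adj: contraction "cadjoint P"
  by (rule contraction_Pa)

sublocale durszt_model \<subseteq> T1: hardy_tensor "defect_space P" tns1
  by unfold_locales (fact tns1 closed_csubspace_DS)+

sublocale durszt_model \<subseteq> T2: circle_tensor "defect_space (cadjoint P)" tns2
  by unfold_locales (fact tns2 adj.closed_csubspace_DS)+

context durszt_model
begin

abbreviation "op1 \<equiv> tensor_op hardy2 DS tns1"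
abbreviation "op2 \<equiv> tensor_op circle_L2 adj.DS tns2"
abbreviation "W1 \<equiv> durszt_W1 P tns1"
abbreviation "W2 \<equiv> durszt_W2 P tns2"

definition W :: "'h \<Rightarrow> 't \<times> 'u" where "W = durszt_W P tns1 tns2"

lemmas W1_hyps = D_in has_sum_D_P_pow

lemma W1_has_sum: "((\<lambda>k. tns1 (\<lambda>z. z ^ k) (D ((P ^^ k) x))) has_sum W1 x) UNIV"
  unfolding durszt_W1_def by (rule has_sum_infsum[OF T1.tns_summable[OF W1_hyps]])

lemma norm_W1_sq: "(norm (W1 x))\<^sup>2 = (norm x)\<^sup>2 - (norm (R x))\<^sup>2"
  unfolding durszt_W1_def by (rule T1.norm_infsum_tns_sq[OF W1_hyps])

lemma W1_in: "W1 x \<in> T1.TS"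
  unfolding durszt_W1_def by (rule T1.infsum_tns_in[OF W1_hyps])

lemma W2_eq:
  assumes x: "x \<in> H0"
  shows "W2 x = (\<Sum>\<^sub>\<infinity>k. tns2 (\<lambda>z. z powi k) (adj.D (orbit k x)))"
proof -
  let ?f = "\<lambda>k. tns2 (\<lambda>z. z powi k) (adj.D (orbit k x))"
  have "W2 x = infsum ?f {..-1} + infsum ?f {0..}"
    unfolding durszt_W2_def
    by (intro arg_cong2[of _ _ _ _ "(+)"] infsum_cong) (simp_all add: orbit_eq_durszt x)
  also have "\<dots> = infsum ?f ({..-1} \<union> {0..})"
    by (rule infsum_Un_disjoint[symmetric]) (auto intro: T2.tns_summable[OF adj.D_in has_sum_D_orbit[OF x]])
  also have "{..-1} \<union> {0..} = (UNIV :: int set)"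
    by auto
  finally show ?thesis .
qed

lemma W2_has_sum:
  assumes x: "x \<in> H0"
  shows "((\<lambda>k. tns2 (\<lambda>z. z powi k) (adj.D (orbit k x))) has_sum W2 x) UNIV"
  unfolding W2_eq[OF x] by (rule has_sum_infsum[OF T2.tns_summable[OF adj.D_in has_sum_D_orbit[OF x]]])

lemma
  assumes x: "x \<in> H0"
  shows norm_W2_sq: "(norm (W2 x))\<^sup>2 = (norm (R x))\<^sup>2" and W2_in: "W2 x \<in> T2.TS"
  unfolding W2_eq[OF x]
  by (rule T2.norm_infsum_tns_sq[OF adj.D_in has_sum_D_orbit[OF x]],
      rule T2.infsum_tns_in[OF adj.D_in has_sum_D_orbit[OF x]])

lemma W1_add: "W1 (x + y) = W1 x + W1 y"
proof (rule has_sum_unique[OF W1_has_sum])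
  show "((\<lambda>k. tns1 (\<lambda>z. z ^ k) (D ((P ^^ k) (x + y)))) has_sum W1 x + W1 y) UNIV"
    using has_sum_add[OF W1_has_sum W1_has_sum, of x y]
    by (simp add: bounded_clinear_UNIV[OF bounded_clinear_P_pow] D_linear
        T1.tns_add monomial_in_hardy2 D_in)
qed

lemma W1_scaleC: "W1 (c *\<^sub>C x) = c *\<^sub>C W1 x"
proof (rule has_sum_unique[OF W1_has_sum])
  show "((\<lambda>k. tns1 (\<lambda>z. z ^ k) (D ((P ^^ k) (c *\<^sub>C x)))) has_sum c *\<^sub>C W1 x) UNIV"
    using has_sum_scaleC[OF W1_has_sum, of c x]
    by (simp add: bounded_clinear_UNIV[OF bounded_clinear_P_pow] D_linear
        T1.tns_scaleC monomial_in_hardy2 D_in)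
qed

lemma W2_add:
  assumes "x \<in> H0" "y \<in> H0"
  shows "W2 (x + y) = W2 x + W2 y"
proof (rule has_sum_unique[OF W2_has_sum])
  show "((\<lambda>k. tns2 (\<lambda>z. z powi k) (adj.D (orbit k (x + y)))) has_sum W2 x + W2 y) UNIV"
    using has_sum_add[OF W2_has_sum W2_has_sum, of x y] assms
    by (simp add: orbit_add adj.D_linear
        T2.tns_add power_int_in_circle_L2 adj.D_in)
qed (use assms H0_add in auto)

lemma W2_scaleC:
  assumes "x \<in> H0"
  shows "W2 (c *\<^sub>C x) = c *\<^sub>C W2 x"
proof (rule has_sum_unique[OF W2_has_sum])
  show "((\<lambda>k. tns2 (\<lambda>z. z powi k) (adj.D (orbit k (c *\<^sub>C x)))) has_sum c *\<^sub>C W2 x) UNIV"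
    using has_sum_scaleC[OF W2_has_sum, of x c] assms
    by (simp add: orbit_scaleC adj.D_linear
        T2.tns_scaleC power_int_in_circle_L2 adj.D_in)
qed (use assms H0_scaleC in auto)

lemma norm_W1_W2: "x \<in> H0 \<Longrightarrow> norm (W1 x, W2 x) = norm x"
  by (simp add: norm_Pair norm_W1_sq norm_W2_sq)

text \<open>The definite description requires both halves: the isometric graph over the dense
  subspace \<open>H0\<close> extends, and two bounded operators that agree on \<open>H0\<close> are
  equal.\<close>

lemma bounded_clinear_W: "bounded_clinear W"
  and W_H0: "x \<in> H0 \<Longrightarrow> W x = (W1 x, W2 x)"
proof -
  let ?is = "\<lambda>W. bounded_clinear W \<and> (\<forall>x\<in>H0. W x = (W1 x, W2 x))"
  let ?G = "(\<lambda>x. (x, W1 x, W2 x)) ` H0"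
  have "complex_vector.subspace ?G"
  proof (rule csubspace_image[OF _ csubspace_H0])
    show "bounded_clinear_on H0 UNIV (\<lambda>x. (x, W1 x, W2 x))"
    proof (rule bounded_clinear_onI[where K = 2])
      fix x assume "x \<in> H0"
      then show "norm (x, W1 x, W2 x) \<le> 2 * norm x"
        using norm_Pair_le[of x "(W1 x, W2 x)"] by (simp add: norm_W1_W2)
    qed (auto simp: W1_add W2_add W1_scaleC W2_scaleC scaleC_prod_def)
  qed
  moreover have "norm p \<le> 1 * norm x" if "(x, p) \<in> ?G" for x p
    using that by (auto simp: norm_W1_W2)
  ultimately obtain g where g: "bounded_clinear_on (closure (fst ` ?G)) (closure (snd ` ?G)) g"
    and eq: "\<forall>(x, p)\<in>?G. g x = p"
    by (rule extension_from_graph)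
  have "fst ` ?G = H0"
    by (simp add: image_image)
  then have "bounded_clinear_on UNIV (closure (snd ` ?G)) g"
    using g dense_H0 by simp
  then have "bounded_clinear g"
    by (rule bounded_clinear_on_subset) simp_all
  then have g_is: "?is g"
    using eq by auto
  have "W' = g" if "?is W'" for W'
  proof
    fix x
    show "W' x = g x"
      by (rule bounded_clinear_on_eq_closure[of UNIV UNIV W' UNIV g H0 x])
        (use that g_is dense_H0 in auto)
  qed
  then have "?is W"
    unfolding W_def durszt_W_def using g_is by (intro theI[of ?is g]) blast+
  then show "bounded_clinear W" "x \<in> H0 \<Longrightarrow> W x = (W1 x, W2 x)"
    by auto
qed

lemma H0_closed_induct:
  assumes "closed {x. Pr x}" "\<And>x. x \<in> H0 \<Longrightarrow> Pr x"
  shows "Pr x"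
proof -
  have "closure H0 \<subseteq> {x. Pr x}"
    using assms by (intro closure_minimal) auto
  then show ?thesis
    using dense_H0 by auto
qed

lemma continuous_on_W: "continuous_on UNIV W"
  by (intro linear_continuous_on bounded_clinear_imp_bounded_linear bounded_clinear_W)

lemma norm_W: "norm (W x) = norm x"
  by (rule H0_closed_induct[where x = x])
    (auto simp: W_H0 norm_W1_W2 intro!: closed_Collect_eq continuous_intros continuous_on_W)

lemma W_in: "W x \<in> T1.TS \<times> T2.TS"
proof (rule H0_closed_induct[where x = x])
  have "closed (W -` (T1.TS \<times> T2.TS))"
    using closed_csubspaceD(2)[OF T1.closed_csubspace_TS] closed_csubspaceD(2)[OF T2.closed_csubspace_TS]
    by (intro continuous_closed_vimage closed_Times continuous_on_W[unfolded continuous_on_eq_continuous_at[OF open_UNIV], rule_format])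
      auto
  then show "closed {x. W x \<in> T1.TS \<times> T2.TS}"
    by (simp add: vimage_def)
qed (simp add: W_H0 W1_in W2_in)

text \<open>The formula for the second component is available only on \<open>H0\<close>; density
  carries the intertwining relation to the whole space, and the relation makes the range of
  \<open>W\<close> invariant.\<close>

lemma unitarily_equivalent_via_W:
  assumes T: "bounded_clinear T" and T_H0: "\<And>x. x \<in> H0 \<Longrightarrow> T x \<in> H0"
    and R1: "bounded_clinear_on T1.TS T1.TS R1" and R2: "bounded_clinear_on T2.TS T2.TS R2"
    and eq1: "\<And>x. W1 (T x) = R1 (W1 x)" and eq2: "\<And>x. x \<in> H0 \<Longrightarrow> W2 (T x) = R2 (W2 x)"
  shows "unitarily_equivalent_via W T (map_prod R1 R2) (range W)"
proof -
  have WT: "bounded_clinear (\<lambda>x. W (T x))"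
    by (rule bounded_clinear_on_compose[OF bounded_clinear_W T])
  have "bounded_clinear_on UNIV (T1.TS \<times> T2.TS) W"
    by (rule bounded_clinear_on_subset[OF bounded_clinear_W]) (auto simp: W_in)
  from bounded_clinear_on_compose[OF bounded_clinear_on_map_prod[OF R1 R2] this]
  have RW: "bounded_clinear_on UNIV (T1.TS \<times> T2.TS) (\<lambda>x. map_prod R1 R2 (W x))" .
  have eq: "W (T x) = map_prod R1 R2 (W x)" for x
    by (rule bounded_clinear_on_eq_closure[OF WT RW, of H0])
      (simp_all add: W_H0 T_H0 eq1 eq2 dense_H0)
  then have "map_prod R1 R2 ` range W \<subseteq> range W"
    by (auto simp: image_image simp flip: eq)
  then show ?thesis
    unfolding unitarily_equivalent_via_def using bounded_clinear_W norm_W eq by simp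
qed

lemma W1_P: "W1 (P x) = op1 hardy_Mz_adj id (W1 x)"
proof (rule has_sum_unique[OF W1_has_sum])
  have id: "bounded_clinear_on DS DS id"
    unfolding id_def by (rule bounded_clinear_on_ident) simp
  show "((\<lambda>k. tns1 (\<lambda>z. z ^ k) (D ((P ^^ k) (P x)))) has_sum
      op1 hardy_Mz_adj id (W1 x)) UNIV"
    using T1.tensor_op_Mz_adj_has_sum[OF id W1_hyps] by (simp add: durszt_W1_def funpow_swap1)
qed

lemma W2_P:
  assumes x: "x \<in> H0"
  shows "W2 (P x) = op2 circle_Mz_adj id (W2 x)"
proof (rule has_sum_unique[OF W2_has_sum])
  have id: "bounded_clinear_on adj.DS adj.DS id"
    unfolding id_def by (rule bounded_clinear_on_ident) simp
  show "((\<lambda>k. tns2 (\<lambda>z. z powi k) (adj.D (orbit k (P x)))) has_sum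
      op2 circle_Mz_adj id (W2 x)) UNIV"
    using T2.tensor_op_Me_adj_has_sum[OF id adj.D_in has_sum_D_orbit[OF x]] x by (simp add: W2_eq orbit_P)
qed (use x H0_P in auto)

text \<open>Applied to \<open>(P ^^ k) x\<close>, the hypothesis splits the coefficient at
  \<open>k\<close> into \<open>C\<close> of the old coefficient and \<open>C'\<close> of the next
  one, which the adjoint shift brings to position \<open>k\<close>.\<close>

lemma W1_intertwine:
  assumes C: "bounded_clinear_on DS DS C"
    and C': "bounded_clinear_on DS DS C'"
    and S: "\<And>x. S (P x) = P (S x)" and eq: "\<And>x. D (S x) = C (D x) + C' (D (P x))"
  shows "W1 (S x) = op1 id C (W1 x)
    + op1 hardy_Mz_adj C' (W1 x)"
proof (rule has_sum_unique[OF W1_has_sum])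
  have S_pow: "(P ^^ k) (S x) = S ((P ^^ k) x)" for k
    by (induction k) (simp_all add: S)
  have "tns1 (\<lambda>z. z ^ k) (D ((P ^^ k) (S x))) = tns1 (\<lambda>z. z ^ k) (C (D ((P ^^ k) x)))
      + tns1 (\<lambda>z. z ^ k) (C' (D ((P ^^ Suc k) x)))" for k
    by (simp add: S_pow eq T1.tns_add monomial_in_hardy2 bounded_clinear_onD(1)[OF C D_in]
        bounded_clinear_onD(1)[OF C' D_in])
  then show "((\<lambda>k. tns1 (\<lambda>z. z ^ k) (D ((P ^^ k) (S x)))) has_sum
      op1 id C (W1 x)
      + op1 hardy_Mz_adj C' (W1 x)) UNIV"
    using has_sum_add[OF T1.tensor_op_id_has_sum[OF C W1_hyps, of x]
        T1.tensor_op_Mz_adj_has_sum[OF C' W1_hyps, of x]]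
    by (simp only: durszt_W1_def)
qed

text \<open>Every coefficient vector is \<open>orbit k x = Pa (orbit (k + 1) x)\<close>. Hence a
  relation on the range of \<open>Pa\<close> is enough, and the vector \<open>y\<close> in it yields
  the shifted coefficient.\<close>

lemma W2_intertwine:
  assumes B: "bounded_clinear_on adj.DS adj.DS B"
    and B': "bounded_clinear_on adj.DS adj.DS B'"
    and S: "S \<in> commutant" and eq: "\<And>y. adj.D (S (Pa y)) = B (adj.D (Pa y)) + B' (adj.D y)"
    and x: "x \<in> H0"
  shows "W2 (S x) = op2 id B (W2 x)
    + op2 circle_Mz_adj B' (W2 x)"
proof (rule has_sum_unique[OF W2_has_sum])
  have "tns2 (\<lambda>z. z powi k) (adj.D (orbit k (S x))) = tns2 (\<lambda>z. z powi k) (B (adj.D (orbit k x)))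
      + tns2 (\<lambda>z. z powi k) (B' (adj.D (orbit (k + 1) x)))" for k
    using eq[of "orbit (k + 1) x"]
    by (simp add: orbit_commutant[OF S x] Pa_orbit[OF x] T2.tns_add power_int_in_circle_L2
        bounded_clinear_onD(1)[OF B adj.D_in] bounded_clinear_onD(1)[OF B' adj.D_in])
  then show "((\<lambda>k. tns2 (\<lambda>z. z powi k) (adj.D (orbit k (S x)))) has_sum
      op2 id B (W2 x)
      + op2 circle_Mz_adj B' (W2 x)) UNIV"
    using has_sum_add[OF T2.tensor_op_id_has_sum[OF B adj.D_in has_sum_D_orbit[OF x]]
        T2.tensor_op_Me_adj_has_sum[OF B' adj.D_in has_sum_D_orbit[OF x]]]
    by (simp only: W2_eq[OF x])
qed (use x S H0_commutant in auto)

end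

section \<open>\<open>\<Gamma>\<^sub>n\<close>-contractions\<close>

lemma foldr_funpow_zero:
  assumes "\<forall>i\<in>set xs. k i = 0"
  shows "foldr (\<lambda>i R. (T i ^^ k i) \<circ> R) xs S = S"
  using assms by (induction xs) auto

lemma mpoly_op_one: "mpoly_op n (Poly_Mapping.single 0 1) T = id"
proof
  fix x
  have "foldr (\<lambda>i R. (T i ^^ Poly_Mapping.lookup (0 :: nat \<Rightarrow>\<^sub>0 nat) i) \<circ> R) [1..<Suc n] id = id"
    by (rule foldr_funpow_zero) simp
  then show "mpoly_op n (Poly_Mapping.single 0 1) T x = id x"
    by (simp add: mpoly_op_def del: upt_Suc)
qed

lemma mpoly_op_last:
  assumes "n \<ge> 1"
  shows "mpoly_op n (Poly_Mapping.single (Poly_Mapping.single n 1) 1) T = T n"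
proof
  fix x
  let ?m = "Poly_Mapping.lookup (Poly_Mapping.single n (1::nat))"
  have "[1..<Suc n] = [1..<n] @ [n]"
    using assms by simp
  then have "foldr (\<lambda>i R. (T i ^^ ?m i) \<circ> R) [1..<Suc n] id
      = foldr (\<lambda>i R. (T i ^^ ?m i) \<circ> R) [1..<n] (T n)"
    by (simp add: lookup_single)
  also have "\<dots> = T n"
    by (rule foldr_funpow_zero) (auto simp: lookup_single when_def)
  finally show "mpoly_op n (Poly_Mapping.single (Poly_Mapping.single n 1) 1) T x = T n x"
    by (simp add: mpoly_op_def del: upt_Suc)
qed

lemma mpoly_eval_one: "mpoly_eval n (Poly_Mapping.single 0 1) z = 1"
  by (simp add: mpoly_eval_def)

lemma mpoly_eval_last:
  assumes "n \<ge> 1"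
  shows "mpoly_eval n (Poly_Mapping.single (Poly_Mapping.single n 1) 1) z = z n"
proof -
  have "(\<Prod>i\<in>{1..n}. z i ^ Poly_Mapping.lookup (Poly_Mapping.single n 1) i)
      = (\<Prod>i\<in>{1..n}. if i = n then z i else 1)"
    by (intro prod.cong) (auto simp: lookup_single when_def)
  then show ?thesis
    using assms by (simp add: mpoly_eval_def)
qed

text \<open>The last elementary symmetric function is the product of all coordinates, because
  \<open>{1..n}\<close> is its only subset with \<open>n\<close> elements.\<close>

lemma Gamma_last_le_1:
  assumes "n \<ge> 1" "z \<in> Gamma n"
  shows "cmod (z n) \<le> 1"
proof -
  obtain w where w: "\<forall>i\<in>{1..n}. cmod (w i) \<le> 1"
    and z: "z = (\<lambda>i\<in>{1..n}. \<Sum>J | J \<subseteq> {1..n} \<and> card J = i. \<Prod>j\<in>J. w j)"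
    using assms(2) unfolding Gamma_def by blast
  have "{J. J \<subseteq> {1..n} \<and> card J = n} = {{1..n}}"
    using card_subset_eq[of "{1..n}"] by auto
  then have "z n = (\<Prod>j\<in>{1..n}. w j)"
    using assms(1) by (simp add: z)
  also have "cmod \<dots> \<le> 1"
    unfolding prod_norm[symmetric] using w by (intro prod_le_1) auto
  finally show ?thesis .
qed

lemma Gamma_nonempty: "Gamma n \<noteq> {}"
  unfolding Gamma_def by (auto intro: exI[of _ "\<lambda>_. 0"])

text \<open>The spectral set inequality for the rational function with numerator the last coordinate
  and denominator 1.\<close>

lemma Gamma_contraction_norm_le:
  assumes n: "n \<ge> 1" and G: "Gamma_contraction n S P"
  shows "norm (P x) \<le> norm x"
proof -
  let ?p = "Poly_Mapping.single (Poly_Mapping.single n 1) 1 :: cmpoly"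
    and ?q = "Poly_Mapping.single 0 1 :: cmpoly"
  have "bounded_clinear ((S(n := P)) n)"
    using G n unfolding Gamma_contraction_def Let_def by (metis atLeastAtMost_iff le_refl)
  then have bP: "bounded_linear P"
    by (simp add: bounded_clinear_imp_bounded_linear)
  have "spectral_set n (Gamma n) (S(n := P))"
    using G by (simp add: Gamma_contraction_def Let_def)
  from this[unfolded spectral_set_def, THEN conjunct2, THEN spec[of _ ?p], THEN spec[of _ ?q], THEN mp]
  have "onorm (mpoly_op n ?p (S(n := P)) \<circ> inv (mpoly_op n ?q (S(n := P))))
      \<le> (SUP z\<in>Gamma n. cmod (mpoly_eval n ?p z / mpoly_eval n ?q z))"
    by (simp only: mpoly_eval_one) simp
  then have "onorm P \<le> (SUP z\<in>Gamma n. cmod (z n))"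
    unfolding mpoly_op_one mpoly_op_last[OF n] mpoly_eval_one mpoly_eval_last[OF n] by simp
  also have "\<dots> \<le> 1"
    using Gamma_last_le_1[OF n] Gamma_nonempty by (intro cSUP_least) auto
  finally have "onorm P * norm x \<le> 1 * norm x"
    by (intro mult_right_mono) auto
  then show ?thesis
    using onorm[OF bP, of x] by simp
qed

lemma Gamma_contractionD:
  assumes n: "n \<ge> 1" and G: "Gamma_contraction n S P"
  shows "bounded_clinear P" "i \<in> {1..n - 1} \<Longrightarrow> bounded_clinear (S i)"
    "i \<in> {1..n - 1} \<Longrightarrow> S i (P x) = P (S i x)"
proof -
  define T where "T = S(n := P)"
  have T: "\<And>i. i \<in> {1..n} \<Longrightarrow> bounded_clinear (T i)"
    "\<And>i j. i \<in> {1..n} \<Longrightarrow> j \<in> {1..n} \<Longrightarrow> T i \<circ> T j = T j \<circ> T i"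
    using G unfolding Gamma_contraction_def Let_def T_def by blast+
  have Tn: "T n = P" "n \<in> {1..n}"
    using n by (auto simp: T_def)
  have Ti: "T i = S i" "i \<in> {1..n}" if "i \<in> {1..n - 1}" for i
    using that n by (auto simp: T_def)
  show "bounded_clinear P"
    using T(1)[OF Tn(2)] Tn(1) by simp
  show "i \<in> {1..n - 1} \<Longrightarrow> bounded_clinear (S i)"
    using T(1) Ti by metis
  show "i \<in> {1..n - 1} \<Longrightarrow> S i (P x) = P (S i x)"
    using T(2)[OF Ti(2) Tn(2)] Ti(1) Tn(1) by (metis comp_apply)
qed

context durszt_model
begin

text \<open>\<open>cadjoint S\<close> commutes with \<open>P\<close> by assumption and with
  \<open>Pa\<close> by taking adjoints in \<open>S P = P S\<close>. So it lies in the commutant, and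
  with it its own adjoint \<open>S\<close>.\<close>

lemma commutant_of_doubly_commuting:
  assumes S: "bounded_clinear S" and comm: "\<And>x. S (P x) = P (S x)"
    and comm': "\<And>x. cadjoint S (P x) = P (cadjoint S x)"
  shows "S \<in> commutant"
proof -
  have "cadjoint S (Pa x) = Pa (cadjoint S x)" for x
    by (rule cinner_ext) (simp add: cinner_cadjoint[OF S] cinner_Pa comm)
  then have "cadjoint S \<in> commutant"
    using S comm' by (simp add: commutant_def bounded_clinear_cadjoint_on')
  from commutant_cadjoint[OF this] show ?thesis
    by (simp add: cadjoint_cadjoint S)
qed

text \<open>After multiplication by \<open>D\<close> the left side is
  \<open>S x - Pa (P (S x))\<close>. Inserting \<open>cadjoint S' (P x)\<close> splits it into the
  relation for \<open>X\<close> at \<open>x\<close> and the adjoint of the relation for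
  \<open>X'\<close> at \<open>P x\<close>.\<close>

lemma D_FO:
  assumes S: "S \<in> commutant" and S': "S' \<in> commutant"
    and X: "bounded_clinear_on DS DS X"
      "\<And>x. S x - cadjoint S' (P x) = D (X (D x))"
    and X': "bounded_clinear_on DS DS X'"
      "\<And>x. S' x - cadjoint S (P x) = D (X' (D x))"
  shows "D (S x) = X (D x) + cadjoint_on DS X' (D (P x))"
proof (rule defect_space_eqI)
  let ?X'' = "cadjoint_on DS X'"
  note Ss = commutantD[OF S] and Ss' = commutantD[OF S']
  have in_space: "X (D x) \<in> DS" "?X'' (D (P x)) \<in> DS"
    using bounded_clinear_onD(1)[OF X(1) D_in]
      cadjoint_on_in[OF closed_csubspace_DS X'(1) D_in] by auto
  then show "X (D x) + ?X'' (D (P x)) \<in> DS"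
    by (rule closed_csubspaceD(4)[OF closed_csubspace_DS])
  have "D (?X'' (D (P x))) = cadjoint S' (P x) - Pa (S (P x))"
  proof (rule cinner_ext)
    fix z
    have "cinner z (D (?X'' (D (P x)))) = cinner (S' z - cadjoint S (P z)) (P x)"
      by (simp add: cinner_D_cadjoint_on_D[OF X'(1)] X'(2))
    also have "\<dots> = cinner z (cadjoint S' (P x) - Pa (S (P x)))"
      by (simp add: cinner.diff_left cinner.diff_right cinner_cadjoint[OF Ss'(1)] cinner_Pa
          cinner_cadjoint_on_left Ss(1))
    finally show "cinner z (D (?X'' (D (P x)))) = cinner z (cadjoint S' (P x) - Pa (S (P x)))" .
  qed
  then show "D (D (S x)) = D (X (D x) + ?X'' (D (P x)))"
    by (simp add: D_D D_linear Ss(2) flip: X(2))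
qed (rule D_in)

text \<open>\<open>P Pa\<close> differs from the identity by the square of \<open>adj.D\<close>, so
  it commutes with \<open>adj.D\<close> and preserves the closure of its range.\<close>

lemma P_Pa_in_DS:
  assumes "v \<in> adj.DS"
  shows "P (Pa v) \<in> adj.DS"
proof -
  have b: "bounded_clinear (\<lambda>x. P (Pa x))"
    by (rule bounded_clinear_on_compose[OF bounded_clinear_P bounded_clinear_Pa])
  have "P (Pa (adj.D x)) = adj.D (P (Pa x))" for x
    by (rule adj.D_commute[OF b]) (simp add: cadjoint_Pa)
  then show ?thesis
    using bounded_clinear_on_image_closure[OF b, of "range adj.D" v] assms
    by (auto simp: defect_space_def)
qed

text \<open>After multiplication by \<open>adj.D\<close> the left side is
  \<open>S (Pa y) - P (Pa (S (Pa y)))\<close>. Inserting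
  \<open>P (cadjoint S' (Pa y)) = P (Pa (cadjoint S' y))\<close> splits it into the adjoint of the
  relation for \<open>B\<close> at \<open>Pa y\<close> and \<open>P Pa\<close> applied to the
  relation for \<open>B'\<close> at \<open>y\<close>.\<close>

lemma adj_D_FO:
  assumes S: "S \<in> commutant" and S': "S' \<in> commutant"
    and B: "bounded_clinear_on adj.DS adj.DS B"
      "\<And>x. cadjoint S x - S' (Pa x) = adj.D (B (adj.D x))"
    and B': "bounded_clinear_on adj.DS adj.DS B'"
      "\<And>x. cadjoint S' x - S (Pa x) = adj.D (B' (adj.D x))"
  shows "adj.D (S (Pa y)) = cadjoint_on adj.DS B (adj.D (Pa y)) + P (Pa (B' (adj.D y)))"
proof (rule adj.defect_space_eqI)
  let ?B'' = "cadjoint_on adj.DS B"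
  note Ss = commutantD[OF S] and Ss' = commutantD[OF S']
  have in_space: "?B'' (adj.D (Pa y)) \<in> adj.DS" "P (Pa (B' (adj.D y))) \<in> adj.DS"
    using cadjoint_on_in[OF adj.closed_csubspace_DS B(1) adj.D_in]
      bounded_clinear_onD(1)[OF B'(1) adj.D_in] by (auto intro: P_Pa_in_DS)
  then show "?B'' (adj.D (Pa y)) + P (Pa (B' (adj.D y))) \<in> adj.DS"
    by (rule closed_csubspaceD(4)[OF adj.closed_csubspace_DS])
  have 1: "adj.D (?B'' (adj.D (Pa y))) = S (Pa y) - P (cadjoint S' (Pa y))"
  proof (rule cinner_ext)
    fix z
    have "cinner z (adj.D (?B'' (adj.D (Pa y)))) = cinner (cadjoint S z - S' (Pa z)) (Pa y)"
      by (simp add: adj.cinner_D_cadjoint_on_D[OF B(1)] B(2))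
    also have "\<dots> = cinner z (S (Pa y) - P (cadjoint S' (Pa y)))"
      by (simp add: cinner.diff_left cinner.diff_right cinner_cadjoint_on_left Ss(1)
          flip: cinner_cadjoint[OF Ss'(1)] cinner_Pa_left)
    finally show "cinner z (adj.D (?B'' (adj.D (Pa y)))) = cinner z (S (Pa y) - P (cadjoint S' (Pa y)))" .
  qed
  have b: "bounded_clinear (\<lambda>x. P (Pa x))"
    by (rule bounded_clinear_on_compose[OF bounded_clinear_P bounded_clinear_Pa])
  have "adj.D (P (Pa (B' (adj.D y)))) = P (Pa (adj.D (B' (adj.D y))))"
    by (rule adj.D_commute[OF b, symmetric]) (simp add: cadjoint_Pa)
  also have "\<dots> = P (cadjoint S' (Pa y)) - P (Pa (S (Pa y)))"
    using commutantD(3)[OF commutant_cadjoint[OF S']]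
    by (simp add: bounded_clinear_UNIV[OF bounded_clinear_P] bounded_clinear_UNIV[OF bounded_clinear_Pa]
        flip: B'(2))
  finally show "adj.D (adj.D (S (Pa y))) = adj.D (?B'' (adj.D (Pa y)) + P (Pa (B' (adj.D y))))"
    by (simp add: 1 adj.D_D cadjoint_Pa adj.D_linear)
qed (rule adj.D_in)

end

theorem theorem4p5:
  fixes n :: nat
    and S :: "nat \<Rightarrow> 'h::chilbert_space \<Rightarrow> 'h" and P :: "'h \<Rightarrow> 'h"
    and A B :: "nat \<Rightarrow> 'h \<Rightarrow> 'h"
    and tns1 :: "(complex \<Rightarrow> complex) \<Rightarrow> 'h \<Rightarrow> 't::chilbert_space"
    and tns2 :: "(complex \<Rightarrow> complex) \<Rightarrow> 'h \<Rightarrow> 'u::chilbert_space"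
  defines "DP \<equiv> defect_space P" and "DP' \<equiv> defect_space (cadjoint P)"
  defines "op1 \<equiv> tensor_op hardy2 DP tns1"
    and "op2 \<equiv> tensor_op circle_L2 DP' tns2"
    and "Mz_adj \<equiv> adjoint_wrt hardy2 hardy2_inner mult_z"
    and "Me_adj \<equiv> adjoint_wrt circle_L2 circle_L2_inner mult_z"
  defines "W \<equiv> durszt_W P tns1 tns2"
  assumes "n \<ge> 2"
    and "Gamma_contraction n S P"
    and "cnu P"
    and "\<forall>i\<in>{1..n - 1}. cadjoint (S i) \<circ> P = P \<circ> cadjoint (S i)"
    and "FO_tuple n S P A"
    and "FO_tuple n (\<lambda>i. cadjoint (S i)) (cadjoint P) B"
    and "hilbert_tensor hardy2 hardy2_inner DP tns1"
    and "hilbert_tensor circle_L2 circle_L2_inner DP' tns2"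
  shows "range W \<subseteq> tensor_space hardy2 DP tns1 \<times> tensor_space circle_L2 DP' tns2 \<and>
    (\<forall>i\<in>{1..n - 1}.
      unitarily_equivalent_via W (S i)
        (map_prod
          (\<lambda>f. op1 id (A i) f + op1 Mz_adj (cadjoint_on DP (A (n - i))) f)
          (\<lambda>g. op2 id (cadjoint_on DP' (B i)) g
             + op2 Me_adj (\<lambda>y. P (cadjoint P (B (n - i) y))) g))
        (range W)) \<and>
    unitarily_equivalent_via W P (map_prod (op1 Mz_adj id) (op2 Me_adj id)) (range W)"
proof (intro conjI ballI)
  have n: "n \<ge> 1"
    using \<open>n \<ge> 2\<close> by simp
  note G = Gamma_contractionD[OF n \<open>Gamma_contraction n S P\<close>]
  interpret model: durszt_model P tns1 tns2
    using G(1) Gamma_contraction_norm_le[OF n \<open>Gamma_contraction n S P\<close>] assms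
    by unfold_locales (simp_all add: DP_def DP'_def)
  have W: "W = model.W"
    by (simp add: W_def model.W_def)
  show "range W \<subseteq> tensor_space hardy2 DP tns1 \<times> tensor_space circle_L2 DP' tns2"
    unfolding W DP_def DP'_def using model.W_in by blast
  have id: "bounded_clinear_on F F id" for F :: "'h set"
    unfolding id_def by (rule bounded_clinear_on_ident) simp
  show "unitarily_equivalent_via W P (map_prod (op1 Mz_adj id) (op2 Me_adj id)) (range W)"
    unfolding W op1_def op2_def DP_def DP'_def Mz_adj_def Me_adj_def
    by (intro model.unitarily_equivalent_via_W model.bounded_clinear_P model.W1_P model.W2_P
        model.T1.bounded_clinear_tensor_op_Mz_adj model.T2.bounded_clinear_tensor_op_Me_adj id)
      (simp add: model.H0_P)
  fix i assume i: "i \<in> {1..n - 1}"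
  \<comment> \<open>The reflected index is admissible, and reflecting twice returns
    \<open>i\<close>; hence the relation for index \<open>n - i\<close> involves the adjoint of
    \<open>S i\<close> itself.\<close>
  then have ni: "n - i \<in> {1..n - 1}" and ii: "n - (n - i) = i"
    by auto
  have comm: "S j \<in> model.commutant" if "j \<in> {1..n - 1}" for j
    using assms(11) that G(2,3)[OF that]
    by (intro model.commutant_of_doubly_commuting) (auto simp: fun_eq_iff)
  have A: "bounded_clinear_on DP DP (A j)" "S j x - cadjoint (S (n - j)) (P x) = defect_op P (A j (defect_op P x))"
    if "j \<in> {1..n - 1}" for j x
    using \<open>FO_tuple n S P A\<close> that by (auto simp: FO_tuple_def DP_def)
  have B: "bounded_clinear_on DP' DP' (B j)" "cadjoint (S j) x - S (n - j) (cadjoint P x)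
      = defect_op (cadjoint P) (B j (defect_op (cadjoint P) x))"
    if j: "j \<in> {1..n - 1}" for j x
  proof -
    \<comment> \<open>For the tuple of adjoints the defining relation contains a double adjoint of
      \<open>S (n - j)\<close>, which has to be removed first.\<close>
    have "n - j \<in> {1..n - 1}"
      using j by auto
    then have "cadjoint (cadjoint (S (n - j))) = S (n - j)"
      by (intro cadjoint_cadjoint G(2))
    moreover have "bounded_clinear_on DP' DP' (B j)"
      "cadjoint (S j) x - cadjoint (cadjoint (S (n - j))) (cadjoint P x)
        = defect_op (cadjoint P) (B j (defect_op (cadjoint P) x))"
      using \<open>FO_tuple n (\<lambda>i. cadjoint (S i)) (cadjoint P) B\<close> j
      unfolding FO_tuple_def DP'_def by blast+
    ultimately show "bounded_clinear_on DP' DP' (B j)" "cadjoint (S j) x - S (n - j) (cadjoint P x)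
      = defect_op (cadjoint P) (B j (defect_op (cadjoint P) x))"
      by simp_all
  qed
  note A' = bounded_clinear_cadjoint_on'[OF model.closed_csubspace_DS A(1)[unfolded DP_def, OF ni]]
  note B' = bounded_clinear_cadjoint_on'[OF model.adj.closed_csubspace_DS B(1)[unfolded DP'_def, OF i]]
  have PPB: "bounded_clinear_on DP' DP' (\<lambda>y. P (cadjoint P (B (n - i) y)))"
    by (rule bounded_clinear_on_subset[OF bounded_clinear_on_compose[OF
            bounded_clinear_on_compose[OF model.bounded_clinear_P model.bounded_clinear_Pa]
            bounded_clinear_on_subset[OF B(1)[OF ni]]]])
      (auto simp: DP'_def intro: model.P_Pa_in_DS bounded_clinear_onD(1)[OF B(1)[OF ni], unfolded DP'_def])
  show "unitarily_equivalent_via W (S i)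
        (map_prod
          (\<lambda>f. op1 id (A i) f + op1 Mz_adj (cadjoint_on DP (A (n - i))) f)
          (\<lambda>g. op2 id (cadjoint_on DP' (B i)) g
             + op2 Me_adj (\<lambda>y. P (cadjoint P (B (n - i) y))) g))
        (range W)"
    unfolding W
  proof (rule model.unitarily_equivalent_via_W[OF G(2)[OF i]])
    show "S i x \<in> model.H0" if "x \<in> model.H0" for x
      using model.H0_commutant[OF comm[OF i] that] by simp
    show "bounded_clinear_on model.T1.TS model.T1.TS
        (\<lambda>f. op1 id (A i) f
          + op1 Mz_adj (cadjoint_on DP (A (n - i))) f)"
      unfolding op1_def DP_def Mz_adj_def
      by (intro bounded_clinear_on_add model.T1.bounded_clinear_tensor_op_id A' A(1)[unfolded DP_def] i
          model.T1.bounded_clinear_tensor_op_Mz_adj closed_csubspaceD(1)[OF model.T1.closed_csubspace_TS])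
    show "bounded_clinear_on model.T2.TS model.T2.TS
        (\<lambda>g. op2 id (cadjoint_on DP' (B i)) g
          + op2 Me_adj (\<lambda>y. P (cadjoint P (B (n - i) y))) g)"
      unfolding op2_def DP'_def Me_adj_def
      by (intro bounded_clinear_on_add model.T2.bounded_clinear_tensor_op_id B' PPB[unfolded DP'_def]
          model.T2.bounded_clinear_tensor_op_Me_adj closed_csubspaceD(1)[OF model.T2.closed_csubspace_TS])
    fix x
    show "model.W1 (S i x) = op1 id (A i) (model.W1 x)
        + op1 Mz_adj (cadjoint_on DP (A (n - i))) (model.W1 x)"
      unfolding op1_def DP_def Mz_adj_def
      using A[OF i] A[OF ni] G(3)[OF i]
      by (intro model.W1_intertwine model.D_FO[OF comm[OF i] comm[OF ni]] A') (simp_all add: DP_def ii)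
    assume x: "x \<in> model.H0"
    show "model.W2 (S i x) = op2 id
          (cadjoint_on DP' (B i)) (model.W2 x)
        + op2 Me_adj
          (\<lambda>y. P (cadjoint P (B (n - i) y))) (model.W2 x)"
      unfolding op2_def DP'_def Me_adj_def
      using B[OF i] B[OF ni] 
      by (intro model.W2_intertwine comm i x model.adj_D_FO[OF comm[OF i] comm[OF ni]] B'
          PPB[unfolded DP'_def]) (simp_all add: DP'_def ii)
  qed
qed

end
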